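(* Let $\mathcal{P}^+\subset \mathrm{Sym}^2(\mathbb{R}^n)$ be an elliptic cone and let $\Omega\subset\mathbb{R}^n$ be a bounded domain with smooth, strictly $\mathcal{P}^+$-convex boundary (i.e. strictly $\mathcal{P}^+$-convex at every point of $\partial\Omega$). Let $\varphi\in C(\partial\Omega)$, and let $\mathrm{PSH}(\varphi)$ be the family of all upper semi-continuous functions $v:\overline\Omega\to[-\infty,\infty)$ such that $v|_{\Omega}\in \mathrm{PSH}(\Omega)$ and $v|_{\partial\Omega}\le\varphi$. Define $u$ on $\overline\Omega$ by $u(x)=\sup\{v(x): v\in \mathrm{PSH}(\varphi)\}$. Then: (1) $u\in C(\overline\Omega)$; (2) $u$ is $\mathcal{P}^+$-partially pluriharmonic on $\Omega$; (3) $u|_{\partial\Omega}=\varphi$ on $\partial\Omega$.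
   Context: $\mathrm{Sym}^2(\mathbb{R}^n)$ is the space of quadratic forms on $\mathbb{R}^n$ (real symmetric $n\times n$ matrices) with inner product $\langle A,B\rangle=\mathrm{tr}(AB)$. For a linear subspace $W\subset\mathbb{R}^n$, $\mathrm{Sym}^2(W)$ is regarded as the subspace of $\mathrm{Sym}^2(\mathbb{R}^n)$ of those $A$ that vanish on $W^\perp$ (i.e. $Aw=0$ for $w\in W^\perp$). Cones. Let $\mathcal{P}^+\subset\mathrm{Sym}^2(\mathbb{R}^n)$ be a closed convex cone with vertex at the origin, with polar $\mathcal{P}_+=\{A:\langle A,B\rangle\ge0\ \forall B\in\mathcal{P}^+\}$. $\mathrm{Int}\,\mathcal{P}_+$ denotes the interior of $\mathcal{P}_+$ relative to its linear span. $\mathcal{P}^+$ is an elliptic cone if every $A\in\mathrm{Int}\,\mathcal{P}_+$ is positive definite. Plurisubharmonic functions. Let $X\subset\mathbb{R}^n$ be open. $\mathrm{USC}(X)$ is the set of upper semi-continuous functions $X\to[-\infty,\infty)$ not identically $-\infty$ on any connected component. A distribution $u$ on $X$ is $\mathcal{P}^+$-plurisubharmonic if $\Delta_A u:=\langle\mathrm{Hess}\,u,A\rangle\ge0$ (a non-negative measure) for every $A\in\mathcal{P}_+$. $\mathrm{PSH}(X)$ denotes the set of $u\in\mathrm{USC}(X)\cap L^1_{\rm loc}(X)$ which are $\mathcal{P}^+$-plurisubharmonic as distributions and satisfy $u(x)=\mathrm{ess}\limsup_{y\to x}u(y)$ for all $x\in X$. Subaffine functions. An upper semi-continuous $w:X\to[-\infty,\infty)$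 is subaffine on $X$ if for every compact $K\subset X$ and every affine function $a$, $w\le a$ on $\partial K$ implies $w\le a$ on $K$. $\mathrm{SA}(X)$ is the set of such $w$ that are locally subaffine (each point has a neighborhood on which $w$ is subaffine); the function $\equiv-\infty$ is allowed. $\widetilde{\mathrm{PSH}}(X)$ is the set of $v\in\mathrm{USC}(X)$ such that $A+v\in\mathrm{SA}(X)$ for every $A\in\mathcal{P}^+$, where $A$ denotes the quadratic function $x\mapsto\langle Ax,x\rangle$. A function $u$ is $\mathcal{P}^+$-partially pluriharmonic on $X$ if $u\in\mathrm{PSH}(X)$ and $-u\in\widetilde{\mathrm{PSH}}(X)$. Boundary convexity. A defining function for $\partial\Omega$ is a smooth function $\rho$ on a neighborhood of $\partial\Omega$ such that in this neighborhood $\Omega=\{\rho<0\}$, and $\nabla\rho\ne0$ on $\partial\Omega$. $A\in\mathcal{P}_+$ is tangential at $x\in\partial\Omega$ if $A\in\mathrm{Sym}^2(T_x\partial\Omega)$. $\partial\Omega$ is strictly $\mathcal{P}^+$-convex at $x$ if $\langle\mathrm{Hess}_x\rho,A\rangle>0$ for all non-zero $A\in\mathcal{P}_+$ tangential at $x$ (this is independent of the choice of $\rho$). *)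

theory Defs
  imports "HOL-Analysis.Analysis" "HOL-Probability.Essential_Supremum"
begin

definition partial :: "'n::finite \<Rightarrow> (real^'n \<Rightarrow> real) \<Rightarrow> real^'n \<Rightarrow> real" where
  "partial i f x = frechet_derivative f (at x) (axis i 1)"

definition grad :: "(real^'n::finite \<Rightarrow> real) \<Rightarrow> real^'n \<Rightarrow> real^'n" where
  "grad f x = (\<chi> i. partial i f x)"

definition Hess :: "(real^'n::finite \<Rightarrow> real) \<Rightarrow> real^'n \<Rightarrow> real^'n^'n" where
  "Hess f x = (\<chi> i j. partial i (partial j f) x)"

text \<open>Functions of class \<open>C\<^sup>k\<close> and \<open>C\<^sup>\<infinity>\<close>; only meant for open \<open>S\<close>.\<close>

primrec Ck_on :: "nat \<Rightarrow> (real^'n::finite) set \<Rightarrow> (real^'n \<Rightarrow> real) \<Rightarrow> bool" where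
  "Ck_on 0 S f \<longleftrightarrow> continuous_on S f"
| "Ck_on (Suc k) S f \<longleftrightarrow> (\<forall>x\<in>S. f differentiable (at x)) \<and> (\<forall>i. Ck_on k S (partial i f))"

definition smooth_on :: "(real^'n::finite) set \<Rightarrow> (real^'n \<Rightarrow> real) \<Rightarrow> bool" where
  "smooth_on S f \<longleftrightarrow> (\<forall>k. Ck_on k S f)"

definition Sym2 :: "(real^'n::finite) set \<Rightarrow> (real^'n^'n) set" where
  "Sym2 W = {A. transpose A = A \<and> (\<forall>w\<in>W\<^sup>\<bottom>. A *v w = 0)}"

definition sym_inner :: "real^'n^'n \<Rightarrow> real^'n^'n::finite \<Rightarrow> real" where
  "sym_inner A B = trace (A ** B)"

definition polar_cone :: "(real^'n^'n::finite) set \<Rightarrow> (real^'n^'n) set" where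
  "polar_cone P = {A \<in> Sym2 UNIV. \<forall>B\<in>P. 0 \<le> sym_inner A B}"

definition closed_convex_cone :: "(real^'n^'n::finite) set \<Rightarrow> bool" where
  "closed_convex_cone P \<longleftrightarrow> P \<subseteq> Sym2 UNIV \<and> closed P \<and> convex_cone P"

definition Int_polar :: "(real^'n^'n::finite) set \<Rightarrow> (real^'n^'n) set" where
  "Int_polar P = top_of_set (span (polar_cone P)) interior_of (polar_cone P)"

definition positive_definite :: "real^'n^'n::finite \<Rightarrow> bool" where
  "positive_definite A \<longleftrightarrow> transpose A = A \<and> (\<forall>x. x \<noteq> 0 \<longrightarrow> 0 < (A *v x) \<bullet> x)"

definition elliptic_cone :: "(real^'n^'n::finite) set \<Rightarrow> bool" where
  "elliptic_cone P \<longleftrightarrow> closed_convex_cone P \<and> (\<forall>A \<in> Int_polar P. positive_definite A)"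

text \<open>
  Functions with values in \<open>[-\<infinity>, \<infinity>)\<close> on a set \<open>S\<close> are total functions into the extended
  reals; their values outside \<open>S\<close> are irrelevant.
\<close>

definition usc_on :: "'a::topological_space set \<Rightarrow> ('a \<Rightarrow> ereal) \<Rightarrow> bool" where
  "usc_on S u \<longleftrightarrow>
     (\<forall>x\<in>S. u x < \<infinity> \<and> (\<forall>c. u x < c \<longrightarrow> (\<forall>\<^sub>F y in at x within S. u y < c)))"

definition USC :: "(real^'n::finite) set \<Rightarrow> (real^'n \<Rightarrow> ereal) set" where
  "USC X = {u. usc_on X u \<and> (\<forall>C \<in> components X. \<exists>x\<in>C. u x \<noteq> -\<infinity>)}"

text \<open>
  Since \<^term>\<open>real_of_ereal\<close> sends infinite values to \<open>0\<close>, finiteness almost everywhere has to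
  be required separately.
\<close>

definition L1_loc :: "(real^'n::finite) set \<Rightarrow> (real^'n \<Rightarrow> ereal) set" where
  "L1_loc X = {u. (AE x in lebesgue. x \<in> X \<longrightarrow> \<bar>u x\<bar> \<noteq> \<infinity>) \<and>
     (\<forall>K. compact K \<and> K \<subseteq> X \<longrightarrow> (\<lambda>x. real_of_ereal (u x)) absolutely_integrable_on K)}"

definition ess_limsup :: "(real^'n::finite) set \<Rightarrow> (real^'n \<Rightarrow> ereal) \<Rightarrow> real^'n \<Rightarrow> ereal" where
  "ess_limsup X u x = (INF r\<in>{0<..}. esssup (lebesgue_on (ball x r \<inter> X)) u)"

definition test_functions :: "(real^'n::finite) set \<Rightarrow> (real^'n \<Rightarrow> real) set" where
  "test_functions X =
     {\<psi>. smooth_on UNIV \<psi> \<and> compact (closure {x. \<psi> x \<noteq> 0}) \<and> closure {x. \<psi> x \<noteq> 0} \<subseteq> X}"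

text \<open>
  A distribution on \<open>X\<close> is represented by its action on \<^term>\<open>test_functions X\<close>. Below, only
  the distributions given by locally integrable functions, and their derivatives, are used, so
  continuity of the functional holds automatically and is not part of the definitions.
\<close>

type_synonym 'n distr = "(real^'n \<Rightarrow> real) \<Rightarrow> real"

definition distr_of :: "(real^'n::finite) set \<Rightarrow> (real^'n \<Rightarrow> ereal) \<Rightarrow> 'n distr" where
  "distr_of X u \<psi> = (LINT x:X|lebesgue. real_of_ereal (u x) * \<psi> x)"

definition distr_partial :: "'n::finite \<Rightarrow> 'n distr \<Rightarrow> 'n distr" where
  "distr_partial i T \<psi> = - T (partial i \<psi>)"

text \<open>
  \<open>\<langle>Hess T, A\<rangle> = tr ((Hess T) A)\<close>, where \<open>Hess T\<close> is the matrix of the distributions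
  \<open>\<partial>\<^sub>i \<partial>\<^sub>j T\<close>.
\<close>

definition distr_Laplacian :: "real^'n^'n \<Rightarrow> 'n::finite distr \<Rightarrow> 'n distr" where
  "distr_Laplacian A T \<psi> =
     (\<Sum>i\<in>UNIV. \<Sum>j\<in>UNIV. distr_partial i (distr_partial j T) \<psi> * A $ j $ i)"

text \<open>
  Non-negativity of a distribution means non-negativity on non-negative test functions; the
  non-negative distributions are exactly the non-negative Radon measures.
\<close>

definition distr_nonneg :: "(real^'n::finite) set \<Rightarrow> 'n distr \<Rightarrow> bool" where
  "distr_nonneg X T \<longleftrightarrow> (\<forall>\<psi> \<in> test_functions X. (\<forall>x. 0 \<le> \<psi> x) \<longrightarrow> 0 \<le> T \<psi>)"

definition psh_distr :: "(real^'n^'n) set \<Rightarrow> (real^'n) set \<Rightarrow> 'n::finite distr \<Rightarrow> bool" where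
  "psh_distr P X T \<longleftrightarrow> (\<forall>A \<in> polar_cone P. distr_nonneg X (distr_Laplacian A T))"

definition PSH :: "(real^'n^'n) set \<Rightarrow> (real^'n::finite) set \<Rightarrow> (real^'n \<Rightarrow> ereal) set" where
  "PSH P X = {u \<in> USC X \<inter> L1_loc X.
     psh_distr P X (distr_of X u) \<and> (\<forall>x\<in>X. u x = ess_limsup X u x)}"

definition subaffine_on :: "(real^'n::finite) set \<Rightarrow> (real^'n \<Rightarrow> ereal) \<Rightarrow> bool" where
  "subaffine_on X w \<longleftrightarrow> usc_on X w \<and>
     (\<forall>K b c. compact K \<and> K \<subseteq> X \<longrightarrow>
        (\<forall>x \<in> frontier K. w x \<le> ereal (b \<bullet> x + c)) \<longrightarrow> (\<forall>x\<in>K. w x \<le> ereal (b \<bullet> x + c)))"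

definition SA :: "(real^'n::finite) set \<Rightarrow> (real^'n \<Rightarrow> ereal) set" where
  "SA X = {w. usc_on X w \<and> (\<forall>x\<in>X. \<exists>U. open U \<and> x \<in> U \<and> U \<subseteq> X \<and> subaffine_on U w)}"

definition PSH_tilde :: "(real^'n^'n) set \<Rightarrow> (real^'n::finite) set \<Rightarrow> (real^'n \<Rightarrow> ereal) set" where
  "PSH_tilde P X = {v \<in> USC X. \<forall>A\<in>P. (\<lambda>x. ereal ((A *v x) \<bullet> x) + v x) \<in> SA X}"

definition partially_pluriharmonic ::
  "(real^'n^'n) set \<Rightarrow> (real^'n::finite) set \<Rightarrow> (real^'n \<Rightarrow> ereal) \<Rightarrow> bool" where
  "partially_pluriharmonic P X u \<longleftrightarrow> u \<in> PSH P X \<and> (\<lambda>x. - u x) \<in> PSH_tilde P X"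

definition defining_function ::
  "(real^'n::finite) set \<Rightarrow> (real^'n) set \<Rightarrow> (real^'n \<Rightarrow> real) \<Rightarrow> bool" where
  "defining_function \<Omega> U \<rho> \<longleftrightarrow> open U \<and> frontier \<Omega> \<subseteq> U \<and> smooth_on U \<rho> \<and>
     \<Omega> \<inter> U = {x\<in>U. \<rho> x < 0} \<and> (\<forall>x \<in> frontier \<Omega>. grad \<rho> x \<noteq> 0)"

text \<open>The tangent space of the boundary, which is a level set of its defining function \<open>\<rho>\<close>.\<close>

definition tangent_hyperplane :: "(real^'n::finite \<Rightarrow> real) \<Rightarrow> real^'n \<Rightarrow> (real^'n) set" where
  "tangent_hyperplane \<rho> x = {v. grad \<rho> x \<bullet> v = 0}"

definition strictly_convex_at ::
  "(real^'n^'n) set \<Rightarrow> (real^'n::finite \<Rightarrow> real) \<Rightarrow> real^'n \<Rightarrow> bool" where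
  "strictly_convex_at P \<rho> x \<longleftrightarrow>
     (\<forall>A \<in> polar_cone P. A \<in> Sym2 (tangent_hyperplane \<rho> x) \<and> A \<noteq> 0 \<longrightarrow>
        0 < sym_inner (Hess \<rho> x) A)"

text \<open>
  The pointwise condition does not depend on the choice of \<open>\<rho>\<close>, so it is immaterial that one
  \<open>\<rho>\<close> is chosen for all boundary points.
\<close>

definition smooth_strictly_convex_boundary ::
  "(real^'n^'n) set \<Rightarrow> (real^'n::finite) set \<Rightarrow> bool" where
  "smooth_strictly_convex_boundary P \<Omega> \<longleftrightarrow>
     (\<exists>U \<rho>. defining_function \<Omega> U \<rho> \<and> (\<forall>x \<in> frontier \<Omega>. strictly_convex_at P \<rho> x))"

definition PSH_boundary ::
  "(real^'n^'n) set \<Rightarrow> (real^'n::finite) set \<Rightarrow> (real^'n \<Rightarrow> real) \<Rightarrow> (real^'n \<Rightarrow> ereal) set" where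
  "PSH_boundary P \<Omega> \<phi> = {v. usc_on (closure \<Omega>) v \<and> v \<in> PSH P \<Omega> \<and>
     (\<forall>x \<in> frontier \<Omega>. v x \<le> ereal (\<phi> x))}"

end

theory Submission
  imports Defs
begin

text \<open>
  Fix a positive definite \<open>A\<close> in the polar cone. A smooth bump function of the quadratic form of
  \<open>A\<inverse>\<close> yields kernels whose means \<open>mean r\<close> are, up to a positive factor, differentiated in \<open>r\<close> by
  applying \<open>\<Delta>\<^sub>A\<close> to a non-negative test function. Hence a distributional subsolution has means that
  increase with \<open>r\<close>, and the normalisation by the essential limes superior turns this into the
  pointwise inequality \<open>v x \<le> mean r v x\<close>. Conversely, this inequality for small radii, locally
  uniformly, implies \<open>\<Delta>\<^sub>A v \<ge> 0\<close> by Taylor expansion of the test function. In this form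
  plurisubharmonicity is stable under suprema, truncation, translation and gluing, and gives the
  maximum principle.

  Adding a multiple of its square makes the defining function strictly plurisubharmonic near the
  boundary. Large multiples of it, corrected by a polynomial close to \<open>\<phi>\<close>, are barriers from below
  and above. Gluing translates of members of \<open>PSH(\<phi>)\<close> to the lower barrier (Walsh) shows that the
  Perron function is uniformly continuous, and gluing a quadratic function to it shows that its
  negative is dually plurisubharmonic.
\<close>

subsection \<open>Functions of class \<open>C\<^sup>k\<close>\<close>

text \<open>Three obstacles shape the proof. The supremum of \<open>PSH_boundary\<close> is not
  known to be measurable at the outset, so it cannot be averaged. Therefore continuity comes first:
  Walsh's translation is applied to one member at a time, with a modulus that does not depend on the
  member, and only the continuous supremum is then fed into the mean value calculus. Secondly,
  elements of the polar cone may be degenerate, while a kernel needs the inverse matrix; the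
  analysis is done for positive definite \<open>A\<close>, and \<open>A + t A0\<close> with
  \<open>t\<close> tending to 0 reaches the others. Thirdly, a mean inequality is useful only with
  radii uniform on compact sets; to preserve this, gluing demands its inequality on a whole strip of
  width \<open>\<eta>\<close> inside the gluing domain. The kernel profile \<open>\<kappa>0\<close>
  is minus the derivative of the smooth cut-off \<open>\<Phi>\<close>. With this choice the
  derivative of the dilated kernel in the dilation parameter and \<open>\<Delta>\<^sub>A\<close> of
  a dilate of \<open>\<Phi> \<circ> q\<close> are the same function up to a scalar factor, so
  monotonicity of means is an instance of the distributional inequality.\<close>

lemma partial_eq:
  assumes "(f has_derivative f') (at x)"
  shows "partial i f x = f' (axis i 1)"
  using assms by (simp add: partial_def frechet_derivative_at[symmetric])

lemma has_derivative_partial: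
  fixes f :: "real^'n::finite \<Rightarrow> real"
  assumes "f differentiable (at x)"
  shows "(f has_derivative (\<lambda>y. \<Sum>i\<in>UNIV. partial i f x * y $ i)) (at x)"
proof -
  let ?f' = "frechet_derivative f (at x)"
  have D: "(f has_derivative ?f') (at x)"
    using assms by (simp add: frechet_derivative_works)
  then interpret bounded_linear ?f' by (rule has_derivative_bounded_linear)
  have "?f' y = (\<Sum>i\<in>UNIV. partial i f x * y $ i)" for y
  proof -
    have "y = (\<Sum>i\<in>UNIV. y $ i *\<^sub>R axis i 1)"
      using basis_expansion[of y] by (simp add: scalar_mult_eq_scaleR)
    then have "?f' y = ?f' (\<Sum>i\<in>UNIV. y $ i *\<^sub>R axis i 1)" by simp
    also have "\<dots> = (\<Sum>i\<in>UNIV. ?f' (y $ i *\<^sub>R axis i 1))" by (rule sum)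
    finally show ?thesis by (simp add: scaleR partial_def mult.commute)
  qed
  then have "?f' = (\<lambda>y. \<Sum>i\<in>UNIV. partial i f x * y $ i)" by blast
  with D show ?thesis by simp
qed

lemma partial_cong:
  assumes "open S" "x \<in> S" "\<And>y. y \<in> S \<Longrightarrow> f y = g y"
  shows "partial i f x = partial i g x"
proof -
  have "(f has_derivative f') (at x) \<longleftrightarrow> (g has_derivative f') (at x)" for f'
    using has_derivative_transform_within_open[OF _ assms(1,2), of _ f' UNIV g]
      has_derivative_transform_within_open[OF _ assms(1,2), of _ f' UNIV f] assms(3) by metis
  then show ?thesis by (simp add: partial_def frechet_derivative_def)
qed

lemma differentiable_cong_open:
  assumes "open S" "x \<in> S" "\<And>y. y \<in> S \<Longrightarrow> f y = g y" "f differentiable (at x)"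
  shows "g differentiable (at x)"
  using assms has_derivative_transform_within_open[of f _ x UNIV S g]
  unfolding differentiable_def by metis

text \<open>The rules for \<open>partial\<close> hold only at points of \<open>S\<close>, while
  \<open>Ck_on\<close> recurses on the total function \<open>partial i f\<close>; derivative
  formulas enter the recursion through this congruence.\<close>

lemma Ck_on_cong:
  assumes "open S" "\<And>x. x \<in> S \<Longrightarrow> f x = g x" "Ck_on k S f"
  shows "Ck_on k S g"
  using assms(2,3)
proof (induction k arbitrary: f g)
  case 0
  then show ?case using continuous_on_cong[of S S f g] by simp
next
  case (Suc k)
  have "Ck_on k S (partial i g)" for i
    by (rule Suc.IH[of "partial i f"]) (use Suc.prems in \<open>auto intro: partial_cong[OF assms(1)]\<close>)
  moreover have "g differentiable (at x)" if "x \<in> S" for x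
    by (rule differentiable_cong_open[OF assms(1) that, of f]) (use Suc.prems that in auto)
  ultimately show ?case by simp
qed

lemma Ck_on_pred: "Ck_on (Suc k) S f \<Longrightarrow> Ck_on k S f"
proof (induction k arbitrary: f)
  case 0
  then show ?case
    by (auto simp: intro!: continuous_at_imp_continuous_on differentiable_imp_continuous_within)
next
  case (Suc k)
  have "Ck_on k S (partial i f)" for i
    by (rule Suc.IH) (use Suc.prems in simp)
  with Suc.prems show ?case by simp
qed

lemma Ck_on_continuous: "Ck_on k S f \<Longrightarrow> continuous_on S f"
  by (induction k) (auto dest: Ck_on_pred simp del: Ck_on.simps(2))

lemma Ck_on_subset: "Ck_on k S f \<Longrightarrow> T \<subseteq> S \<Longrightarrow> Ck_on k T f"
  by (induction k arbitrary: f) (auto intro: continuous_on_subset)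

lemma partial_const [simp]: "partial i (\<lambda>x. c) = (\<lambda>x. 0)"
  by (rule ext) (rule partial_eq[OF has_derivative_const])

lemma Ck_on_const [simp]: "Ck_on k S (\<lambda>x. c)"
  by (induction k arbitrary: c) auto

lemma partial_add:
  assumes "f differentiable (at x)" "g differentiable (at x)"
  shows "partial i (\<lambda>x. f x + g x) x = partial i f x + partial i g x"
proof -
  obtain f' g' where *: "(f has_derivative f') (at x)" "(g has_derivative g') (at x)"
    using assms unfolding differentiable_def by blast
  show ?thesis
    using partial_eq[OF *(1)] partial_eq[OF *(2)] partial_eq[OF has_derivative_add[OF *]] by simp
qed

lemma partial_mult:
  fixes f g :: "real^'n::finite \<Rightarrow> real"
  assumes "f differentiable (at x)" "g differentiable (at x)"
  shows "partial i (\<lambda>x. f x * g x) x = f x * partial i g x + partial i f x * g x"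
proof -
  obtain f' g' where *: "(f has_derivative f') (at x)" "(g has_derivative g') (at x)"
    using assms unfolding differentiable_def by blast
  show ?thesis
    using partial_eq[OF *(1)] partial_eq[OF *(2)] partial_eq[OF has_derivative_mult[OF *]] by simp
qed

lemma partial_cmult:
  fixes f :: "real^'n::finite \<Rightarrow> real"
  assumes "f differentiable (at x)"
  shows "partial i (\<lambda>x. c * f x) x = c * partial i f x"
  using partial_mult[of "\<lambda>x. c" x f i] assms by simp

lemma partial_compose:
  fixes g :: "real^'n::finite \<Rightarrow> real" and F :: "real \<Rightarrow> real"
  assumes "g differentiable (at x)" "(F has_real_derivative F') (at (g x))"
  shows "partial i (\<lambda>x. F (g x)) x = F' * partial i g x"
  using assms partial_eq partial_eq[OF diff_chain_at[of g _ x F "\<lambda>y. F' * y"]]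
  unfolding differentiable_def has_field_derivative_def o_def by metis

lemma Ck_on_add:
  assumes "open S"
  shows "Ck_on k S f \<Longrightarrow> Ck_on k S g \<Longrightarrow> Ck_on k S (\<lambda>x. f x + g x)"
proof (induction k arbitrary: f g)
  case 0
  then show ?case by (auto intro: continuous_on_add)
next
  case (Suc k)
  have "Ck_on k S (partial i (\<lambda>x. f x + g x))" for i
    by (rule Ck_on_cong[OF assms, of "\<lambda>x. partial i f x + partial i g x"])
      (use Suc in \<open>auto simp: partial_add\<close>)
  then show ?case using Suc.prems by (auto intro: differentiable_add)
qed

lemma Ck_on_mult:
  fixes f g :: "real^'n::finite \<Rightarrow> real"
  assumes "open S"
  shows "Ck_on k S f \<Longrightarrow> Ck_on k S g \<Longrightarrow> Ck_on k S (\<lambda>x. f x * g x)"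
proof (induction k arbitrary: f g)
  case 0
  then show ?case by (auto intro: continuous_on_mult)
next
  case (Suc k)
  have d: "f differentiable (at x)" "g differentiable (at x)" if "x \<in> S" for x
    using Suc.prems that by simp_all
  have "Ck_on k S (partial i (\<lambda>x. f x * g x))" for i
  proof (rule Ck_on_cong[OF assms])
    show "Ck_on k S (\<lambda>x. f x * partial i g x + partial i f x * g x)"
      by (rule Ck_on_add[OF assms Suc.IH Suc.IH])
        (use Suc.prems Ck_on_pred[OF Suc.prems(1)] Ck_on_pred[OF Suc.prems(2)] in simp_all)
    show "f x * partial i g x + partial i f x * g x = partial i (\<lambda>x. f x * g x) x" if "x \<in> S" for x
      by (rule partial_mult[OF d[OF that], symmetric])
  qed
  with d show ?case by (simp add: differentiable_mult)
qed

lemma Ck_on_bounded_linear: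
  fixes f :: "real^'n::finite \<Rightarrow> real"
  assumes "bounded_linear f"
  shows "Ck_on k S f"
proof (cases k)
  case 0
  then show ?thesis using assms by (simp add: linear_continuous_on)
next
  case (Suc m)
  have D: "(f has_derivative f) (at x)" for x
    using assms by (rule bounded_linear_imp_has_derivative)
  have "partial i f = (\<lambda>x. f (axis i 1))" for i
    using partial_eq[OF D] by blast
  with D Suc show ?thesis by (auto simp: differentiable_def)
qed

lemma Ck_on_real_polynomial_function:
  fixes f :: "real^'n::finite \<Rightarrow> real"
  assumes "real_polynomial_function f"
  shows "Ck_on k UNIV f"
  using assms
  by induction (auto intro: Ck_on_bounded_linear Ck_on_add Ck_on_mult)

text \<open>The functions \<open>p(1/(1-s)) exp(-1/(1-s))\<close>, cut off at \<open>s = 1\<close>, are closed under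
  differentiation and vanish to infinite order at \<open>1\<close>.\<close>

definition bump :: "real poly \<Rightarrow> real \<Rightarrow> real" where
  "bump p s = (if s < 1 then poly p (1 / (1 - s)) * exp (- (1 / (1 - s))) else 0)"

lemma poly_exp_tendsto_0: "((\<lambda>x. poly p x * exp (- x)) \<longlongrightarrow> (0::real)) at_top"
proof -
  have "poly p x * exp (- x) = (\<Sum>i\<le>degree p. coeff p i * (x ^ i / exp x))" for x :: real
    by (simp add: poly_altdef exp_minus sum_distrib_right divide_inverse mult.assoc)
  moreover have "((\<lambda>x. \<Sum>i\<le>degree p. coeff p i * (x ^ i / exp x)) \<longlongrightarrow> (\<Sum>i\<le>degree p. coeff p i * 0)) at_top"
    by (intro tendsto_intros tendsto_power_div_exp_0)
  ultimately show ?thesis by simp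
qed

text \<open>With \<open>t = 1 / (1 - s)\<close> one has \<open>dt/ds = t\<^sup>2\<close>, so
  \<open>p(t) exp(-t)\<close> differentiates to \<open>t\<^sup>2 (p' - p)(t) exp(-t)\<close>; the
  factor \<open>[:0,0,1:]\<close> is \<open>t\<^sup>2\<close>. The delicate point is
  \<open>s = 1\<close>.\<close>

lemma bump_has_real_derivative:
  "(bump p has_real_derivative bump ([:0,0,1:] * (pderiv p - p)) s) (at s)"
proof -
  consider "s < 1" | "s > 1" | "s = 1" by linarith
  then show ?thesis
  proof cases
    case 1
    let ?f = "\<lambda>s. poly p (1 / (1 - s)) * exp (- (1 / (1 - s)))"
    have a: "((\<lambda>s. 1 / (1 - s)) has_real_derivative (1 / (1 - s))\<^sup>2) (at s)"
      using 1 by (auto intro!: derivative_eq_intros simp: power2_eq_square)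
    have b: "((\<lambda>s. poly p (1 / (1 - s))) has_real_derivative poly (pderiv p) (1 / (1 - s)) * (1 / (1 - s))\<^sup>2) (at s)"
      by (rule DERIV_chain2[OF poly_DERIV a])
    have c: "((\<lambda>s. exp (- (1 / (1 - s)))) has_real_derivative exp (- (1 / (1 - s))) * - (1 / (1 - s))\<^sup>2) (at s)"
      by (rule DERIV_chain2[OF DERIV_exp DERIV_minus[OF a]])
    have eq: "poly (pderiv p) t * t\<^sup>2 * e + e * - t\<^sup>2 * poly p t = poly ([:0,0,1:] * (pderiv p - p)) t * e"
      for t e :: real
      by (simp add: power2_eq_square algebra_simps)
    have "bump ([:0,0,1:] * (pderiv p - p)) s
        = poly ([:0,0,1:] * (pderiv p - p)) (1 / (1 - s)) * exp (- (1 / (1 - s)))"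
      using 1 by (simp only: bump_def if_True)
    then have "(?f has_real_derivative bump ([:0,0,1:] * (pderiv p - p)) s) (at s)"
      using DERIV_mult[OF b c] unfolding eq by simp
    then show ?thesis
      by (rule has_field_derivative_transform_within_open[where S="{..<1}"]) (use 1 in \<open>auto simp: bump_def\<close>)
  next
    case 2
    have "((\<lambda>s. 0) has_real_derivative bump ([:0,0,1:] * (pderiv p - p)) s) (at s)"
      using 2 by (simp add: bump_def)
    then show ?thesis
      by (rule has_field_derivative_transform_within_open[where S="{1<..}"]) (use 2 in \<open>auto simp: bump_def\<close>)
  next
    case 3
    have "((\<lambda>y. (bump p y - bump p 1) / (y - 1)) \<longlongrightarrow> 0) (at 1)"
    proof (rule filterlim_split_at)
      have *: "filterlim (\<lambda>s::real. 1 / (1 - s)) at_top (at_left 1)"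
      proof -
        have "((\<lambda>s. 1 - s) \<longlongrightarrow> 1 - 1) (at_left (1::real))" by (intro tendsto_intros)
        moreover have "eventually (\<lambda>s. 1 - s > 0) (at_left (1::real))"
          unfolding eventually_at_filter by (intro always_eventually) simp
        ultimately have "filterlim (\<lambda>s. 1 - s) (at_right 0) (at_left (1::real))"
          by (intro tendsto_imp_filterlim_at_right) auto
        from filterlim_compose[OF filterlim_inverse_at_top_right this]
        show ?thesis by (simp add: inverse_eq_divide)
      qed
      \<comment> \<open>For \<open>s < 1\<close> the difference quotient at 1 is
        \<open>- t p(t) exp(-t)\<close> with \<open>t = 1 / (1 - s)\<close>; the extra factor
        \<open>t\<close> is \<open>[:0,1:]\<close>.\<close>
      have "((\<lambda>s. - (poly ([:0,1:] * p) (1 / (1 - s)) * exp (- (1 / (1 - s))))) \<longlongrightarrow> - 0) (at_left (1::real))"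
        by (rule tendsto_minus[OF filterlim_compose[OF poly_exp_tendsto_0 *]])
      then have "((\<lambda>s. - (poly ([:0,1:] * p) (1 / (1 - s)) * exp (- (1 / (1 - s))))) \<longlongrightarrow> 0) (at_left (1::real))"
        by (simp only: minus_zero)
      then show "((\<lambda>y. (bump p y - bump p 1) / (y - 1)) \<longlongrightarrow> 0) (at_left 1)"
      proof (rule Lim_transform_eventually)
        have "- (poly ([:0,1:] * p) (1 / (1 - s)) * exp (- (1 / (1 - s)))) = (bump p s - bump p 1) / (s - 1)"
          if "s < 1" for s
        proof -
          have "(bump p s - bump p 1) / (s - 1) = (poly p (1 / (1 - s)) * exp (- (1 / (1 - s)))) / (s - 1)"
            using that by (simp add: bump_def)
          also have "\<dots> = - (1 / (1 - s) * poly p (1 / (1 - s)) * exp (- (1 / (1 - s))))"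
            using that by (simp add: minus_divide_right)
          finally show ?thesis by simp
        qed
        then show "\<forall>\<^sub>F s in at_left 1. - (poly ([:0,1:] * p) (1 / (1 - s)) * exp (- (1 / (1 - s))))
            = (bump p s - bump p 1) / (s - 1)"
          unfolding eventually_at_filter by (intro always_eventually) simp
      qed
      show "((\<lambda>y. (bump p y - bump p 1) / (y - 1)) \<longlongrightarrow> 0) (at_right 1)"
        by (rule Lim_transform_eventually[OF tendsto_const], unfold eventually_at_filter, intro always_eventually)
          (simp add: bump_def)
    qed
    moreover have "bump q 1 = 0" for q by (simp add: bump_def)
    ultimately show ?thesis by (simp only: 3 has_field_derivative_iff)
  qed
qed

lemma continuous_on_bump: "continuous_on S (bump p)"
  by (meson DERIV_isCont bump_has_real_derivative continuous_at_imp_continuous_on)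

text \<open>The induction runs over all \<open>p\<close> at once, because a derivative changes the
  polynomial but stays in the family.\<close>

lemma Ck_on_bump_compose:
  fixes g :: "real^'n::finite \<Rightarrow> real"
  assumes "open S" "\<And>k. Ck_on k S g"
  shows "Ck_on k S (\<lambda>x. bump p (g x))"
proof (induction k arbitrary: p)
  case 0
  have "continuous_on S g" using assms(2)[of 0] by simp
  then show ?case by (simp add: continuous_on_compose2[OF continuous_on_bump[of UNIV]])
next
  case (Suc k)
  have g: "g differentiable (at x)" if "x \<in> S" for x
    using assms(2)[of 1] that by simp
  have "Ck_on k S (partial i (\<lambda>x. bump p (g x)))" for i
  proof (rule Ck_on_cong[OF assms(1)])
    show "Ck_on k S (\<lambda>x. bump ([:0,0,1:] * (pderiv p - p)) (g x) * partial i g x)"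
      using assms(2)[of "Suc k"] by (intro Ck_on_mult assms(1) Suc) simp
    show "bump ([:0,0,1:] * (pderiv p - p)) (g x) * partial i g x = partial i (\<lambda>x. bump p (g x)) x"
      if "x \<in> S" for x
      by (rule partial_compose[OF g[OF that] bump_has_real_derivative, symmetric])
  qed
  moreover have "(\<lambda>x. bump p (g x)) differentiable (at x)" if "x \<in> S" for x
  proof -
    have "bump p differentiable (at (g x))"
      using bump_has_real_derivative[of p "g x"] unfolding has_field_derivative_def
      by (rule differentiableI)
    from differentiable_chain_at[OF g[OF that] this] show ?thesis by (simp only: o_def)
  qed
  ultimately show ?case by simp
qed

subsection \<open>Hessians and Taylor's formula\<close>

lemma sym_inner_eq: "sym_inner H A = (\<Sum>i\<in>UNIV. \<Sum>j\<in>UNIV. H $ i $ j * A $ j $ i)"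
  by (simp add: sym_inner_def trace_def matrix_matrix_mult_def)

lemma Hess_cong:
  assumes "open S" "x \<in> S" "\<And>y. y \<in> S \<Longrightarrow> f y = g y"
  shows "Hess f x = Hess g x"
proof -
  have "partial i (partial j f) x = partial i (partial j g) x" for i j
    by (rule partial_cong[OF assms(1,2)]) (rule partial_cong[OF assms(1) _ assms(3)])
  then show ?thesis unfolding Hess_def by simp
qed

lemma Ck_on_2D:
  assumes "Ck_on 2 S f" "x \<in> S"
  shows "f differentiable (at x)" "partial i f differentiable (at x)"
  using assms by (auto simp: numeral_2_eq_2)

lemma continuous_on_Hess:
  assumes "Ck_on 2 S f"
  shows "continuous_on S (Hess f)"
  using assms unfolding Hess_def
  by (auto intro!: continuous_intros simp: numeral_2_eq_2)

lemma continuous_on_grad: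
  assumes "Ck_on 1 S f"
  shows "continuous_on S (grad f)"
  using assms unfolding grad_def
  by (auto intro!: continuous_intros)

lemma Hess_add:
  fixes f g :: "real^'n::finite \<Rightarrow> real"
  assumes "open S" "Ck_on 2 S f" "Ck_on 2 S g" "x \<in> S"
  shows "Hess (\<lambda>x. f x + g x) x = Hess f x + Hess g x"
proof -
  have "partial i (partial j (\<lambda>x. f x + g x)) x = partial i (partial j f) x + partial i (partial j g) x" for i j
  proof -
    have "partial i (partial j (\<lambda>x. f x + g x)) x = partial i (\<lambda>x. partial j f x + partial j g x) x"
      by (rule partial_cong[OF assms(1,4)])
        (rule partial_add[OF Ck_on_2D(1)[OF assms(2)] Ck_on_2D(1)[OF assms(3)]])
    also have "\<dots> = partial i (partial j f) x + partial i (partial j g) x"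
      by (rule partial_add[OF Ck_on_2D(2)[OF assms(2,4)] Ck_on_2D(2)[OF assms(3,4)]])
    finally show ?thesis .
  qed
  then show ?thesis unfolding Hess_def vec_eq_iff by simp
qed

lemma Hess_mult:
  fixes f g :: "real^'n::finite \<Rightarrow> real"
  assumes "open S" "Ck_on 2 S f" "Ck_on 2 S g" "x \<in> S"
  shows "Hess (\<lambda>x. f x * g x) x $ i $ j = f x * Hess g x $ i $ j + partial i f x * partial j g x
     + partial j f x * partial i g x + Hess f x $ i $ j * g x"
proof -
  note f = Ck_on_2D[OF assms(2)] and g = Ck_on_2D[OF assms(3)]
  have "partial i (partial j (\<lambda>x. f x * g x)) x = partial i (\<lambda>x. f x * partial j g x + partial j f x * g x) x"
    by (rule partial_cong[OF assms(1,4)]) (rule partial_mult[OF f(1) g(1)])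
  also have "\<dots> = partial i (\<lambda>x. f x * partial j g x) x + partial i (\<lambda>x. partial j f x * g x) x"
    by (rule partial_add[OF differentiable_mult[OF f(1) g(2)] differentiable_mult[OF f(2) g(1)]])
      (rule assms(4))+
  also have "partial i (\<lambda>x. f x * partial j g x) x = f x * partial i (partial j g) x + partial i f x * partial j g x"
    by (rule partial_mult[OF f(1) g(2)]) (rule assms(4))+
  also have "partial i (\<lambda>x. partial j f x * g x) x = partial j f x * partial i g x + partial i (partial j f) x * g x"
    by (rule partial_mult[OF f(2) g(1)]) (rule assms(4))+
  finally show ?thesis unfolding Hess_def by simp
qed

lemma Hess_cmult:
  fixes f :: "real^'n::finite \<Rightarrow> real"
  assumes "open S" "Ck_on 2 S f" "x \<in> S"
  shows "Hess (\<lambda>x. c * f x) x = c *\<^sub>R Hess f x"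
proof -
  have "Hess (\<lambda>x. c * f x) x $ i $ j = c * Hess f x $ i $ j" for i j
  proof -
    have "Hess (\<lambda>x. c) x $ i $ j = 0" unfolding Hess_def by simp
    then show ?thesis using Hess_mult[OF assms(1) Ck_on_const assms(2,3), of c i j] by simp
  qed
  then show ?thesis unfolding vec_eq_iff by simp
qed

text \<open>Maclaurin's formula of order 2 for the restriction of \<open>f\<close> to the segment;
  \<open>d m\<close> is the derivative of order \<open>m\<close> of that restriction.\<close>

lemma Taylor2:
  fixes f :: "real^'n::finite \<Rightarrow> real"
  assumes "Ck_on 2 S f" "\<And>t. 0 \<le> t \<Longrightarrow> t \<le> 1 \<Longrightarrow> x + t *\<^sub>R y \<in> S"
  shows "\<exists>t\<in>{0..1}. f (x + y) = f x + grad f x \<bullet> y + (Hess f (x + t *\<^sub>R y) *v y) \<bullet> y / 2"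
proof -
  define d where "d m t = (if m = 0 then f (x + t *\<^sub>R y)
     else if m = 1 then \<Sum>i\<in>UNIV. partial i f (x + t *\<^sub>R y) * y $ i
     else \<Sum>j\<in>UNIV. (\<Sum>i\<in>UNIV. partial i (partial j f) (x + t *\<^sub>R y) * y $ i) * y $ j)" for m :: nat and t
  have line: "((\<lambda>t. x + t *\<^sub>R y) has_derivative (\<lambda>t. t *\<^sub>R y)) (at t)" for t
    by (auto intro!: derivative_eq_intros)
  have D: "((\<lambda>t. g (x + t *\<^sub>R y)) has_real_derivative (\<Sum>i\<in>UNIV. partial i g (x + t *\<^sub>R y) * y $ i)) (at t)"
    if "g differentiable (at (x + t *\<^sub>R y))" for g t
  proof -
    have "((\<lambda>t. g (x + t *\<^sub>R y)) has_derivative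
        (\<lambda>s. \<Sum>i\<in>UNIV. partial i g (x + t *\<^sub>R y) * (s *\<^sub>R y) $ i)) (at t)"
      using diff_chain_at[OF line has_derivative_partial[OF that]] by (simp only: o_def)
    moreover have "(\<lambda>s. \<Sum>i\<in>UNIV. partial i g (x + t *\<^sub>R y) * (s *\<^sub>R y) $ i)
        = (*) (\<Sum>i\<in>UNIV. partial i g (x + t *\<^sub>R y) * y $ i)"
      by (rule ext) (simp add: sum_distrib_left sum_distrib_right mult_ac)
    ultimately show ?thesis by (simp only: has_field_derivative_def)
  qed
  have "\<exists>t>0. t < 1 \<and> f (x + 1 *\<^sub>R y) = (\<Sum>m<2. d m 0 / fact m * 1 ^ m) + d 2 t / fact 2 * 1 ^ 2"
  proof (rule Maclaurin)
    show "(0::real) < 1" "(0::nat) < 2" by simp_all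
    show "d 0 = (\<lambda>t. f (x + t *\<^sub>R y))" by (auto simp: d_def)
    show "\<forall>m t. m < 2 \<and> 0 \<le> t \<and> t \<le> 1 \<longrightarrow> (d m has_real_derivative d (Suc m) t) (at t)"
    proof (intro allI impI)
      fix m :: nat and t :: real assume *: "m < 2 \<and> 0 \<le> t \<and> t \<le> 1"
      with assms(2) have xt: "x + t *\<^sub>R y \<in> S" by simp
      note dd = Ck_on_2D[OF assms(1) xt]
      from * have "m = 0 \<or> m = 1" by auto
      then show "(d m has_real_derivative d (Suc m) t) (at t)"
      proof
        assume "m = 0"
        then show ?thesis using D[OF dd(1)] unfolding d_def by simp
      next
        assume m: "m = 1"
        have "((\<lambda>t. \<Sum>j\<in>UNIV. partial j f (x + t *\<^sub>R y) * y $ j) has_real_derivative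
           (\<Sum>j\<in>UNIV. (\<Sum>i\<in>UNIV. partial i (partial j f) (x + t *\<^sub>R y) * y $ i) * y $ j)) (at t)"
          by (intro DERIV_sum DERIV_cmult_right D dd)
        then show ?thesis using m unfolding d_def by simp
      qed
    qed
  qed
  then obtain t where t: "0 < t" "t < 1" and eq: "f (x + y) = (\<Sum>m<2. d m 0 / fact m) + d 2 t / 2"
    by auto
  have "d 2 t = (Hess f (x + t *\<^sub>R y) *v y) \<bullet> y"
    unfolding d_def Hess_def matrix_vector_mult_def inner_vec_def
    by (simp add: sum_distrib_left sum_distrib_right) (subst sum.swap, simp add: mult_ac)
  moreover have "(\<Sum>m<2. d m 0 / fact m) = f x + grad f x \<bullet> y"
    by (simp add: d_def grad_def inner_vec_def numeral_2_eq_2)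
  ultimately show ?thesis using eq t by auto
qed

lemma bounded_bilinear_matrix_vector_mult: "bounded_bilinear (\<lambda>(A::real^'n::finite^'m::finite) x. A *v x)"
  unfolding bilinear_conv_bounded_bilinear[symmetric] bilinear_def
  by (auto intro!: linearI simp: matrix_vector_right_distrib matrix_vector_mult_add_rdistrib
      matrix_vector_mult_scaleR scaleR_matrix_vector_assoc)

lemma quadratic_form_bound: "\<exists>B>0. \<forall>(A::real^'n::finite^'n) x. \<bar>(A *v x) \<bullet> x\<bar> \<le> B * norm A * (norm x)\<^sup>2"
proof -
  obtain B where B: "B > 0" "\<And>(A::real^'n^'n) x. norm (A *v x) \<le> norm A * norm x * B"
    using bounded_bilinear.pos_bounded[OF bounded_bilinear_matrix_vector_mult] by blast
  have "\<bar>(A *v x) \<bullet> x\<bar> \<le> B * norm A * (norm x)\<^sup>2" for A :: "real^'n^'n" and x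
  proof -
    have "\<bar>(A *v x) \<bullet> x\<bar> \<le> norm (A *v x) * norm x" by (rule Cauchy_Schwarz_ineq2)
    also have "\<dots> \<le> (norm A * norm x * B) * norm x" by (intro mult_right_mono B) auto
    finally show ?thesis by (simp add: power2_eq_square mult_ac)
  qed
  with B(1) show ?thesis by blast
qed

lemma compact_cball_neighbourhood:
  fixes K X :: "'a::euclidean_space set"
  assumes "compact K" "open X" "K \<subseteq> X"
  obtains e where "e > 0" "compact {x + y |x y. x \<in> K \<and> y \<in> cball 0 e}"
    "{x + y |x y. x \<in> K \<and> y \<in> cball 0 e} \<subseteq> X"
proof -
  obtain e where e: "e > 0" "(\<Union>x\<in>K. ball x e) \<subseteq> X"
    using compact_subset_open_imp_ball_epsilon_subset[OF assms] by blast
  \<comment> \<open>The radius is halved to pass from open to closed balls.\<close>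
  have "{x + y |x y. x \<in> K \<and> y \<in> cball 0 (e/2)} \<subseteq> X"
  proof clarify
    fix x y :: 'a assume "x \<in> K" "y \<in> cball 0 (e/2)"
    then have "x + y \<in> ball x e" using e(1) by (auto simp: dist_norm)
    then show "x + y \<in> X" using e(2) \<open>x \<in> K\<close> by blast
  qed
  then show ?thesis
    using that[of "e/2"] e(1) compact_sums[OF assms(1) compact_cball[of 0 "e/2"]] by simp
qed

text \<open>The remainder in \<open>Taylor2\<close> contains the Hessian at an intermediate point.
  Uniform continuity of \<open>Hess f\<close> on a compact neighbourhood of \<open>K\<close>
  replaces it by the Hessian at \<open>x\<close>, with one \<open>\<delta>\<close> for all of
  \<open>K\<close>.\<close>

lemma Taylor2_uniform:
  fixes f :: "real^'n::finite \<Rightarrow> real"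
  assumes "open S" "Ck_on 2 S f" "compact K" "K \<subseteq> S" "\<epsilon> > 0"
  shows "\<exists>\<delta>>0. \<forall>x\<in>K. \<forall>y. norm y \<le> \<delta> \<longrightarrow> x + y \<in> S \<and>
     \<bar>f (x + y) - f x - grad f x \<bullet> y - (Hess f x *v y) \<bullet> y / 2\<bar> \<le> \<epsilon> * (norm y)\<^sup>2"
proof -
  obtain e where e: "e > 0" "compact {x + y |x y. x \<in> K \<and> y \<in> cball 0 e}"
     "{x + y |x y. x \<in> K \<and> y \<in> cball 0 e} \<subseteq> S"
    by (rule compact_cball_neighbourhood[OF assms(3,1,4)])
  define K' where "K' = {x + y |x y. x \<in> K \<and> y \<in> cball 0 e}"
  obtain B where B: "B > 0" "\<And>(A::real^'n^'n) x. \<bar>(A *v x) \<bullet> x\<bar> \<le> B * norm A * (norm x)\<^sup>2"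
    using quadratic_form_bound by blast
  have "uniformly_continuous_on K' (Hess f)"
    unfolding K'_def
    by (rule compact_uniformly_continuous[OF continuous_on_subset[OF continuous_on_Hess[OF assms(2)] e(3)] e(2)])
  moreover have "0 < \<epsilon> / B" using assms(5) B(1) by simp
  ultimately obtain d where d: "d > 0"
    "\<And>x x'. x \<in> K' \<Longrightarrow> x' \<in> K' \<Longrightarrow> dist x' x < d \<Longrightarrow> dist (Hess f x') (Hess f x) < \<epsilon> / B"
    unfolding uniformly_continuous_on_def by meson
  define \<delta> where "\<delta> = min e (d/2)"
  have "x + y \<in> S \<and>
     \<bar>f (x + y) - f x - grad f x \<bullet> y - (Hess f x *v y) \<bullet> y / 2\<bar> \<le> \<epsilon> * (norm y)\<^sup>2"
    if x: "x \<in> K" and y: "norm y \<le> \<delta>" for x y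
  proof -
    have le: "norm (t *\<^sub>R y) \<le> \<delta>" if "0 \<le> t" "t \<le> 1" for t
    proof -
      have "norm (t *\<^sub>R y) \<le> norm y" using that by (simp add: mult_left_le_one_le)
      then show "norm (t *\<^sub>R y) \<le> \<delta>" using y by linarith
    qed
    have in_K: "x + t *\<^sub>R y \<in> K'" if "0 \<le> t" "t \<le> 1" for t
    proof -
      have "t *\<^sub>R y \<in> cball 0 e" using le[OF that] by (simp add: \<delta>_def)
      with x show ?thesis unfolding K'_def by blast
    qed
    have in_S: "x + t *\<^sub>R y \<in> S" if "0 \<le> t" "t \<le> 1" for t
      using in_K[OF that] e(3) unfolding K'_def by blast
    obtain t where t: "0 \<le> t" "t \<le> 1" "f (x + y) = f x + grad f x \<bullet> y + (Hess f (x + t *\<^sub>R y) *v y) \<bullet> y / 2"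
      using Taylor2[OF assms(2) in_S] by auto
    let ?D = "Hess f (x + t *\<^sub>R y) - Hess f x"
    have "dist (x + t *\<^sub>R y) x < d"
      using le[OF t(1,2)] d(1) by (simp add: \<delta>_def dist_norm)
    then have "norm ?D \<le> \<epsilon> / B"
      using d(2)[OF in_K[of 0] in_K[OF t(1,2)]] by (simp add: dist_norm)
    then have "B * norm ?D \<le> \<epsilon>" using B(1) by (simp add: pos_le_divide_eq mult.commute)
    then have "B * norm ?D * (norm y)\<^sup>2 \<le> \<epsilon> * (norm y)\<^sup>2" by (rule mult_right_mono) simp
    then have "\<bar>(?D *v y) \<bullet> y\<bar> \<le> \<epsilon> * (norm y)\<^sup>2"
      using B(2)[of ?D y] by linarith
    moreover have "(?D *v y) \<bullet> y = (Hess f (x + t *\<^sub>R y) *v y) \<bullet> y - (Hess f x *v y) \<bullet> y"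
      by (simp add: matrix_vector_mult_diff_rdistrib inner_diff_left)
    moreover have "0 \<le> \<epsilon> * (norm y)\<^sup>2" using assms(5) by simp
    ultimately have "\<bar>f (x + y) - f x - grad f x \<bullet> y - (Hess f x *v y) \<bullet> y / 2\<bar> \<le> \<epsilon> * (norm y)\<^sup>2"
      unfolding t(3) by (simp add: abs_if split: if_splits)
    then show ?thesis using in_S[of 1] by simp
  qed
  moreover have "\<delta> > 0" using e(1) d(1) by (simp add: \<delta>_def)
  ultimately show ?thesis by blast
qed

subsection \<open>Integrals over Euclidean space\<close>

lemma has_real_derivative_partial_line:
  fixes f :: "real^'n::finite \<Rightarrow> real"
  assumes "f differentiable (at (x + t *\<^sub>R axis i 1))"
  shows "((\<lambda>t. f (x + t *\<^sub>R axis i 1)) has_real_derivative partial i f (x + t *\<^sub>R axis i 1)) (at t)"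
proof -
  have "((\<lambda>t. x + t *\<^sub>R axis i 1) has_derivative (\<lambda>t. t *\<^sub>R axis i (1::real))) (at t)"
    by (auto intro!: derivative_eq_intros)
  from diff_chain_at[OF this has_derivative_partial[OF assms]]
  have "((\<lambda>t. f (x + t *\<^sub>R axis i 1)) has_derivative
      (\<lambda>s. \<Sum>j\<in>UNIV. partial j f (x + t *\<^sub>R axis i 1) * (s *\<^sub>R axis i (1::real)) $ j)) (at t)"
    by (simp only: o_def)
  moreover have "(\<Sum>j\<in>UNIV. partial j f (x + t *\<^sub>R axis i 1) * (s *\<^sub>R axis i (1::real)) $ j)
      = partial i f (x + t *\<^sub>R axis i 1) * s" for s
  proof -
    have "(\<Sum>j\<in>UNIV. partial j f (x + t *\<^sub>R axis i 1) * (s *\<^sub>R axis i (1::real)) $ j)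
      = (\<Sum>j\<in>UNIV. if j = i then partial i f (x + t *\<^sub>R axis i 1) * s else 0)"
      by (rule sum.cong) (auto simp: axis_def)
    then show ?thesis by simp
  qed
  ultimately show ?thesis by (simp add: has_field_derivative_def)
qed

lemma integrable_lborel_compact_support:
  fixes f :: "'a::euclidean_space \<Rightarrow> real"
  assumes "compact S" "continuous_on S f" "\<And>x. x \<notin> S \<Longrightarrow> f x = 0"
  shows "integrable lborel f"
proof -
  have "(\<lambda>x. indicator S x *\<^sub>R f x) = f"
  proof
    show "indicator S x *\<^sub>R f x = f x" for x
      using assms(3)[of x] by (cases "x \<in> S") auto
  qed
  with borel_integrable_compact[OF assms(1,2)] show ?thesis by simp
qed

lemma integrable_indicator_bounded:
  fixes S :: "'a::euclidean_space set"
  assumes "S \<in> sets borel" "bounded S"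
  shows "integrable lborel (indicator S :: 'a \<Rightarrow> real)"
  using emeasure_bounded_finite[OF assms(2)] assms(1)
  by (intro integrable_real_indicator) (simp_all add: less_top[symmetric])

lemma integrable_mult_bounded:
  fixes F g :: "'a::euclidean_space \<Rightarrow> real"
  assumes "integrable lborel F" "g \<in> borel_measurable borel" "\<And>x. \<bar>g x\<bar> \<le> B"
  shows "integrable lborel (\<lambda>x. F x * g x)"
proof (rule Bochner_Integration.integrable_bound)
  have [measurable]: "F \<in> borel_measurable borel" "g \<in> borel_measurable borel" using assms by auto
  show "integrable lborel (\<lambda>x. B * F x)" using assms(1) by simp
  show "(\<lambda>x. F x * g x) \<in> borel_measurable lborel" by measurable
  have "\<bar>F x\<bar> * \<bar>g x\<bar> \<le> \<bar>F x\<bar> * \<bar>B\<bar>" for x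
    using assms(3)[of x] by (intro mult_left_mono) auto
  then show "AE x in lborel. norm (F x * g x) \<le> norm (B * F x)"
    by (auto simp: abs_mult mult.commute)
qed

lemma integral_translation:
  fixes f :: "'a::euclidean_space \<Rightarrow> real"
  assumes "f \<in> borel_measurable borel"
  shows "(\<integral>x. f (x + c) \<partial>lborel) = (\<integral>x. f x \<partial>lborel)"
    and "integrable lborel f \<Longrightarrow> integrable lborel (\<lambda>x. f (x + c))"
proof -
  have [measurable]: "f \<in> borel_measurable borel" by fact
  have "(\<integral>x. f x \<partial>lborel) = (\<integral>x. f x \<partial>distr lborel borel ((+) c))"
    by (simp add: lborel_distr_plus)
  also have "\<dots> = (\<integral>x. f (c + x) \<partial>lborel)" by (rule integral_distr) auto
  finally show "(\<integral>x. f (x + c) \<partial>lborel) = (\<integral>x. f x \<partial>lborel)" by (simp add: add.commute)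
  assume "integrable lborel f"
  then have "integrable (distr lborel borel ((+) c)) f" by (simp add: lborel_distr_plus)
  then have "integrable lborel (\<lambda>x. f (c + x))" by (rule integrable_distr[rotated]) auto
  then show "integrable lborel (\<lambda>x. f (x + c))" by (simp add: add.commute)
qed

lemma integral_dilation:
  fixes f :: "'a::euclidean_space \<Rightarrow> real"
  assumes "f \<in> borel_measurable borel" "r \<noteq> 0"
  shows "(\<integral>y. f (x + r *\<^sub>R y) \<partial>lborel) = \<bar>1 / r\<bar> ^ DIM('a) * (\<integral>z. f z \<partial>lborel)"
proof -
  have [measurable]: "f \<in> borel_measurable borel" by fact
  have eq: "lborel = density (distr lborel borel (\<lambda>y::'a. x + r *\<^sub>R y)) (\<lambda>_. ennreal (\<bar>r\<bar> ^ DIM('a)))"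
    using lborel_affine[OF assms(2), of x] by (simp add: ennreal_power)
  have "(\<integral>z. f z \<partial>lborel) = (\<integral>z. f z \<partial>density (distr lborel borel (\<lambda>y. x + r *\<^sub>R y)) (\<lambda>_. ennreal (\<bar>r\<bar> ^ DIM('a))))"
    using eq by simp
  also have "\<dots> = (\<integral>y. \<bar>r\<bar> ^ DIM('a) * f (x + r *\<^sub>R y) \<partial>lborel)"
    by (simp add: integral_density integral_distr)
  finally show ?thesis using assms(2) by (simp add: power_one_over)
qed

lemma bounded_continuous_compact_support:
  fixes f :: "'a::euclidean_space \<Rightarrow> real"
  assumes "continuous_on UNIV f" "\<And>x. R < norm x \<Longrightarrow> f x = 0"
  obtains B where "B > 0" "\<And>x. \<bar>f x\<bar> \<le> B"
proof -
  have "bounded (f ` cball 0 R)"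
    using assms(1) by (intro compact_imp_bounded compact_continuous_image) (auto intro: continuous_on_subset)
  then obtain B where B: "B > 0" "\<And>x. x \<in> cball 0 R \<Longrightarrow> \<bar>f x\<bar> \<le> B"
    by (auto simp: bounded_pos)
  have "\<bar>f x\<bar> \<le> B" for x
    using B assms(2)[of x] by (cases "norm x \<le> R") auto
  with B(1) show ?thesis by (rule that)
qed

text \<open>By translation invariance every difference quotient has integral 0, and the quotients
  converge boundedly to the derivative. The steps are at most 1, so all quotients vanish outside
  \<open>cball 0 (R + 1)\<close>, which carries the dominating function.\<close>

lemma integral_partial_eq_0:
  fixes f :: "real^'n::finite \<Rightarrow> real"
  assumes "Ck_on 1 UNIV f" "\<And>x. R < norm x \<Longrightarrow> f x = 0"
  shows "(\<integral>x. partial i f x \<partial>lborel) = 0"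
proof -
  have diff: "f differentiable (at x)" for x using assms(1) by simp
  have cp: "continuous_on UNIV (partial i f)" using assms(1) by simp
  have cont: "continuous_on UNIV f" using Ck_on_continuous[OF assms(1)] .
  have p0: "partial i f x = 0" if "R < norm x" for x
  proof -
    have "open {x::real^'n. R < norm x}" by (intro open_Collect_less continuous_intros)
    then have "partial i f x = partial i (\<lambda>x. 0) x"
      using that assms(2) by (intro partial_cong[of "{x. R < norm x}"]) auto
    then show ?thesis by simp
  qed
  obtain B where B: "B > 0" "\<And>x. \<bar>partial i f x\<bar> \<le> B"
    using bounded_continuous_compact_support[OF cp p0] by metis
  define h where "h m = 1 / real (Suc m)" for m
  define s where "s m x = (f (x + h m *\<^sub>R axis i 1) - f x) / h m" for m x
  have h: "0 < h m" "h m \<le> 1" for m by (auto simp: h_def)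
  have int_f: "integrable lborel f"
    by (rule integrable_lborel_compact_support[of "cball 0 R"])
      (use assms(2) cont in \<open>auto intro: continuous_on_subset\<close>)
  have meas[measurable]: "f \<in> borel_measurable borel" "partial i f \<in> borel_measurable borel"
    using cont cp by (auto intro: borel_measurable_continuous_onI)
  have s0: "(\<integral>x. s m x \<partial>lborel) = 0" for m
  proof -
    have "(\<integral>x. s m x \<partial>lborel) = ((\<integral>x. f (x + h m *\<^sub>R axis i 1) \<partial>lborel) - (\<integral>x. f x \<partial>lborel)) / h m"
      unfolding s_def by (simp add: integral_translation(2)[OF meas(1) int_f] int_f)
    then show ?thesis by (simp add: integral_translation(1)[OF meas(1)])
  qed
  have "(\<lambda>m. \<integral>x. s m x \<partial>lborel) \<longlonglongrightarrow> (\<integral>x. partial i f x \<partial>lborel)"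
  proof (rule integral_dominated_convergence[where w="\<lambda>x. B * indicator (cball 0 (R+1)) x"])
    show "AE x in lborel. (\<lambda>m. s m x) \<longlonglongrightarrow> partial i f x"
    proof (rule AE_I2)
      fix x
      have "((\<lambda>t. f (x + t *\<^sub>R axis i 1)) has_real_derivative partial i f x) (at 0)"
        using has_real_derivative_partial_line[of f x 0 i] diff by simp
      then have lim: "((\<lambda>t. (f (x + t *\<^sub>R axis i 1) - f x) / t) \<longlongrightarrow> partial i f x) (at 0)"
        by (simp add: has_field_derivative_iff)
      have "filterlim h (at 0) sequentially"
        unfolding filterlim_at using LIMSEQ_inverse_real_of_nat
        by (simp add: h_def[abs_def] inverse_eq_divide)
      from filterlim_compose[OF lim this] show "(\<lambda>m. s m x) \<longlonglongrightarrow> partial i f x"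
        by (simp add: s_def)
    qed
    show "AE x in lborel. norm (s m x) \<le> B * indicator (cball 0 (R+1)) x" for m
    proof (rule AE_I2)
      fix x
      show "norm (s m x) \<le> B * indicator (cball 0 (R+1)) x"
      proof (cases "norm x \<le> R + 1")
        case True
        have "\<exists>z>0. z < h m \<and> f (x + h m *\<^sub>R axis i 1) - f (x + 0 *\<^sub>R axis i 1)
            = (h m - 0) * partial i f (x + z *\<^sub>R axis i 1)"
          by (rule MVT2[OF h(1)]) (rule has_real_derivative_partial_line[OF diff])
        then obtain z where "s m x = partial i f (x + z *\<^sub>R axis i 1)"
          using h(1)[of m] unfolding s_def by auto
        then show ?thesis using B True by simp
      next
        case False
        have "norm x \<le> norm (x + h m *\<^sub>R axis i 1) + norm (h m *\<^sub>R axis i (1::real))"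
          using norm_triangle_ineq4[of "x + h m *\<^sub>R axis i 1" "h m *\<^sub>R axis i 1"] by simp
        also have "norm (h m *\<^sub>R axis i (1::real) :: real^'n) \<le> 1" using h[of m] by (simp add: norm_axis_1)
        finally have "R < norm (x + h m *\<^sub>R axis i 1)" "R < norm x" using False by auto
        then show ?thesis using False by (simp add: s_def assms(2))
      qed
    qed
    show "integrable lborel (\<lambda>x::real^'n. B * indicator (cball 0 (R+1)) x :: real)"
      by (intro integrable_mult_right integrable_indicator_bounded) auto
    show "s m \<in> borel_measurable lborel" for m
      unfolding s_def by simp
  qed simp
  then show ?thesis using s0 by (simp add: LIMSEQ_const_iff)
qed

lemma integral_pos_continuous:
  fixes f :: "'a::euclidean_space \<Rightarrow> real"
  assumes "continuous_on UNIV f" "integrable lborel f" "\<And>x. 0 \<le> f x" "0 < f a"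
  shows "0 < (\<integral>x. f x \<partial>lborel)"
proof (rule ccontr)
  assume "\<not> ?thesis"
  moreover have "0 \<le> (\<integral>x. f x \<partial>lborel)" using assms(3) by simp
  ultimately have "(\<integral>x. f x \<partial>lborel) = 0" by simp
  then have "AE x in lborel. f x = 0"
    using integral_nonneg_eq_0_iff_AE[OF assms(2)] assms(3) by simp
  moreover have "open {x. f x > 0}" using assms(1) by (intro open_Collect_less continuous_intros)
  then obtain e where e: "e > 0" "ball a e \<subseteq> {x. f x > 0}"
    using assms(4) open_contains_ball by blast
  ultimately have "AE x in lborel. x \<notin> ball a e" by (auto elim!: eventually_mono)
  then have "emeasure lborel (ball a e) = 0"
    by (subst (asm) AE_iff_measurable[where N="ball a e"]) auto
  then show False using content_ball_pos[OF e(1), of a] by (simp add: measure_def)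
qed

text \<open>\<open>F\<close> is merely integrable, so all regularity has to come from
  \<open>k\<close>: the mean value theorem bounds its difference quotients by \<open>C\<close>, and
  \<open>C * norm (F z)\<close> dominates.\<close>

lemma has_real_derivative_integral:
  fixes k k' :: "real \<Rightarrow> 'a \<Rightarrow> real" and F :: "'a \<Rightarrow> real"
  assumes F: "integrable M F" and s: "a < s" "s < b"
    and D: "\<And>t z. a < t \<Longrightarrow> t < b \<Longrightarrow> ((\<lambda>t. k t z) has_real_derivative k' t z) (at t)"
    and bd: "\<And>t z. a < t \<Longrightarrow> t < b \<Longrightarrow> \<bar>k' t z\<bar> \<le> C"
    and int: "\<And>t. a < t \<Longrightarrow> t < b \<Longrightarrow> integrable M (\<lambda>z. F z * k t z)"
    and m: "\<And>t. k' t \<in> borel_measurable M"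
  shows "((\<lambda>t. \<integral>z. F z * k t z \<partial>M) has_real_derivative (\<integral>z. F z * k' s z \<partial>M)) (at s)"
  unfolding has_field_derivative_iff tendsto_at_iff_sequentially
proof (intro allI impI)
  fix X :: "nat \<Rightarrow> real"
  assume X: "\<forall>i. X i \<in> UNIV - {s}" "X \<longlonglongrightarrow> s"
  \<comment> \<open>From some index on the sequence stays in the interval where \<open>k\<close> is
    differentiable; \<open>LIMSEQ_offset\<close> undoes the shift at the end.\<close>
  have "eventually (\<lambda>i. a < X i \<and> X i < b) sequentially"
    using order_tendstoD[OF X(2)] s by (intro eventually_conj) auto
  then obtain N where N: "\<And>i. i \<ge> N \<Longrightarrow> a < X i" "\<And>i. i \<ge> N \<Longrightarrow> X i < b"
    by (auto simp: eventually_sequentially)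
  define Y where "Y i = X (i + N)" for i
  have Y: "a < Y i" "Y i < b" "Y i \<noteq> s" for i using N X(1) by (auto simp: Y_def)
  have Ys: "filterlim Y (at s) sequentially"
    unfolding filterlim_at using LIMSEQ_ignore_initial_segment[OF X(2), of N] Y(3) by (auto simp: Y_def[abs_def])
  have [measurable]: "F \<in> borel_measurable M" using F by auto
  let ?q = "\<lambda>i z. (F z * k (Y i) z - F z * k s z) / (Y i - s)"
  have "(\<lambda>i. \<integral>z. ?q i z \<partial>M) \<longlonglongrightarrow> (\<integral>z. F z * k' s z \<partial>M)"
  proof (rule integral_dominated_convergence[where w="\<lambda>z. C * norm (F z)"])
    show "(\<lambda>z. F z * k' s z) \<in> borel_measurable M" using m by simp
    show "?q i \<in> borel_measurable M" for i
      using borel_measurable_integrable[OF int[OF Y(1,2)]] borel_measurable_integrable[OF int[OF s]]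
      by (intro borel_measurable_divide borel_measurable_diff) auto
    show "integrable M (\<lambda>z. C * norm (F z))" using F by simp
    show "AE z in M. (\<lambda>i. ?q i z) \<longlonglongrightarrow> F z * k' s z"
    proof (rule AE_I2)
      fix z
      have "((\<lambda>t. (F z * k t z - F z * k s z) / (t - s)) \<longlongrightarrow> F z * k' s z) (at s)"
        using DERIV_cmult[OF D[OF s, of z], of "F z"] unfolding has_field_derivative_iff .
      from filterlim_compose[OF this Ys] show "(\<lambda>i. ?q i z) \<longlonglongrightarrow> F z * k' s z" .
    qed
    show "AE z in M. norm (?q i z) \<le> C * norm (F z)" for i
    proof (rule AE_I2)
      fix z
      have "\<bar>k (Y i) z - k s z\<bar> \<le> C * \<bar>Y i - s\<bar>"
      proof (rule field_differentiable_bound[where S="{a<..<b}" and f'="\<lambda>t. k' t z", unfolded real_norm_def])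
        show "((\<lambda>t. k t z) has_real_derivative k' t z) (at t within {a<..<b})" if "t \<in> {a<..<b}" for t
          using D[of t z] that by (auto intro: has_field_derivative_at_within)
      qed (use bd s Y in auto)
      then have "\<bar>k (Y i) z - k s z\<bar> / \<bar>Y i - s\<bar> \<le> C"
        using Y(3)[of i] by (simp add: divide_le_eq)
      then have "\<bar>F z\<bar> * (\<bar>k (Y i) z - k s z\<bar> / \<bar>Y i - s\<bar>) \<le> \<bar>F z\<bar> * C"
        by (intro mult_left_mono) auto
      then show "norm (?q i z) \<le> C * norm (F z)"
        by (simp add: abs_mult right_diff_distrib[symmetric] mult.commute)
    qed
  qed
  moreover have "(\<lambda>i. \<integral>z. ?q i z \<partial>M) = (\<lambda>i. ((\<integral>z. F z * k (Y i) z \<partial>M) - (\<integral>z. F z * k s z \<partial>M)) / (Y i - s))"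
    using int[OF Y(1,2)] int[OF s] by simp
  ultimately have "(\<lambda>i. ((\<lambda>t. ((\<integral>z. F z * k t z \<partial>M) - (\<integral>z. F z * k s z \<partial>M)) / (t - s)) \<circ> X) (i + N))
      \<longlonglongrightarrow> (\<integral>z. F z * k' s z \<partial>M)"
    by (simp only: Y_def o_def)
  then show "((\<lambda>t. ((\<integral>z. F z * k t z \<partial>M) - (\<integral>z. F z * k s z \<partial>M)) / (t - s)) \<circ> X)
      \<longlonglongrightarrow> (\<integral>z. F z * k' s z \<partial>M)"
    by (rule LIMSEQ_offset)
qed

subsection \<open>Means with respect to an elliptic kernel\<close>

text \<open>\<open>Q\<close> is the inverse of \<open>A\<close>, and \<open>Q_ge\<close> puts the
  ellipsoid \<open>q < 1\<close> into the unit ball, so that the kernel of radius \<open>r\<close>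
  at \<open>x\<close> lives in \<open>cball x r\<close>. Every positive definite matrix satisfies
  this after multiplication by a positive constant.\<close>

locale elliptic_kernel =
  fixes A Q :: "real^'n::finite^'n"
  assumes A_sym: "transpose A = A" and Q_sym: "transpose Q = Q"
    and AQ: "A ** Q = mat 1"
    and Q_ge: "\<And>y. (norm y)\<^sup>2 \<le> (Q *v y) \<bullet> y"
begin

definition q :: "real^'n \<Rightarrow> real" where "q y = (Q *v y) \<bullet> y"

text \<open>\<open>\<Phi>\<close> is a test function and \<open>\<kappa>0 = -\<Phi>'\<close>, so that \<open>- A\<nabla>(\<Phi> \<circ> q)\<close> is \<open>2 y \<kappa>0(q(y))\<close>.\<close>

definition \<Phi> :: "real \<Rightarrow> real" where "\<Phi> = bump 1"
definition \<kappa>0 :: "real \<Rightarrow> real" where "\<kappa>0 = bump [:0,0,1:]"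
definition \<kappa>1 :: "real \<Rightarrow> real" where "\<kappa>1 = bump ([:0,0,1:] * (pderiv [:0,0,1:] - [:0,0,1:]))"
definition mass :: real where "mass = (\<integral>y. \<kappa>0 (q y) \<partial>lborel)"
definition \<kappa> :: "real^'n \<Rightarrow> real" where "\<kappa> y = \<kappa>0 (q y) / mass"
text \<open>The factor between the matrix of second moments of \<open>\<kappa>\<close> and
  \<open>A\<close>, in the form in which integration by parts produces it.\<close>

definition moment :: real where "moment = (\<integral>y. \<Phi> (q y) \<partial>lborel) / (2 * mass)"
definition mean :: "real \<Rightarrow> (real^'n \<Rightarrow> real) \<Rightarrow> real^'n \<Rightarrow> real" where
  "mean r f x = (\<integral>y. f (x + r *\<^sub>R y) * \<kappa> y \<partial>lborel)"

lemma DERIV_\<Phi>: "(\<Phi> has_real_derivative - \<kappa>0 s) (at s)"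
proof -
  have "bump ([:0,0,1:] * (pderiv 1 - 1)) s = - bump [:0,0,1:] s" by (simp add: bump_def)
  then show ?thesis using bump_has_real_derivative[of 1 s] by (simp add: \<Phi>_def \<kappa>0_def)
qed

lemma DERIV_\<kappa>0: "(\<kappa>0 has_real_derivative \<kappa>1 s) (at s)"
  unfolding \<kappa>0_def \<kappa>1_def by (rule bump_has_real_derivative)

lemma \<kappa>0_nonneg: "0 \<le> \<kappa>0 s" and \<Phi>_nonneg: "0 \<le> \<Phi> s"
  and \<kappa>0_eq_0: "1 \<le> s \<Longrightarrow> \<kappa>0 s = 0" and \<Phi>_eq_0: "1 \<le> s \<Longrightarrow> \<Phi> s = 0"
  and \<kappa>1_eq_0: "1 \<le> s \<Longrightarrow> \<kappa>1 s = 0"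
  by (auto simp: \<kappa>0_def \<Phi>_def \<kappa>1_def bump_def)

lemma q_nonneg: "0 \<le> q y"
  using Q_ge[of y] zero_le_power2[of "norm y"] unfolding q_def by linarith

lemma q_ge_1: "1 \<le> norm y \<Longrightarrow> 1 \<le> q y"
  using Q_ge[of y] one_le_power[of "norm y" 2] unfolding q_def by linarith

lemma q_scaleR: "q (s *\<^sub>R y) = s\<^sup>2 * q y"
  by (simp add: q_def matrix_vector_mult_scaleR power2_eq_square)

lemma q_uminus: "q (- y) = q y"
  using q_scaleR[of "-1" y] by simp

lemma Q_inner_sym: "(Q *v x) \<bullet> y = x \<bullet> (Q *v y)"
  by (metis Q_sym dot_lmul_matrix vector_transpose_matrix)

lemma A_Q_mult: "A *v (Q *v y) = y"
  by (simp add: matrix_vector_mul_assoc AQ)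

lemma has_derivative_q: "(q has_derivative (\<lambda>h. 2 * ((Q *v x) \<bullet> h))) (at x)"
proof -
  have "bounded_linear (\<lambda>y. Q *v y)" by (rule matrix_vector_mul_bounded_linear)
  then have "((\<lambda>y. Q *v y) has_derivative (\<lambda>h. Q *v h)) (at x)"
    by (rule bounded_linear_imp_has_derivative)
  from has_derivative_inner[OF this has_derivative_ident]
  have "(q has_derivative (\<lambda>h. (Q *v x) \<bullet> h + (Q *v h) \<bullet> x)) (at x)"
    by (simp only: q_def[abs_def])
  moreover have "(Q *v x) \<bullet> h + (Q *v h) \<bullet> x = 2 * ((Q *v x) \<bullet> h)" for h
    using Q_inner_sym[of h x] by (simp add: inner_commute)
  ultimately show ?thesis by simp
qed

lemma matrix_vector_mult_continuous_on [continuous_intros]: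
  "continuous_on S f \<Longrightarrow> continuous_on S (\<lambda>x. Q *v f x)"
  by (rule bounded_linear.continuous_on[OF matrix_vector_mul_bounded_linear])

lemma continuous_on_q [continuous_intros]:
  "continuous_on S f \<Longrightarrow> continuous_on S (\<lambda>x. q (f x))"
  unfolding q_def
  by (intro continuous_on_inner bounded_linear.continuous_on[OF matrix_vector_mul_bounded_linear])

lemma continuous_on_bump' [continuous_intros]:
  assumes "continuous_on S f"
  shows "continuous_on S (\<lambda>x. \<kappa>0 (f x))" "continuous_on S (\<lambda>x. \<Phi> (f x))" "continuous_on S (\<lambda>x. \<kappa>1 (f x))"
  unfolding \<kappa>0_def \<kappa>1_def \<Phi>_def
  using continuous_on_compose2[OF continuous_on_bump[of UNIV] assms] by auto

text \<open>Yields smoothness of \<open>q\<close> and of the scaled translates used as arguments of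
  \<open>bump\<close>.\<close>

lemma real_polynomial_function_q: "real_polynomial_function (\<lambda>z. c * q (z - x))"
proof -
  have lin: "bounded_linear (\<lambda>z. (Q *v z) $ i)" "bounded_linear (\<lambda>z::real^'n. z $ i)" for i
    using bounded_linear_compose[OF bounded_linear_vec_nth[of i] matrix_vector_mul_bounded_linear[of Q]]
    by (auto simp: o_def intro: bounded_linear_vec_nth)
  have "real_polynomial_function (\<lambda>z. c * (\<Sum>i\<in>UNIV. ((Q *v z) $ i + - (Q *v x) $ i) * (z $ i + - x $ i)))"
    by (intro real_polynomial_function.intros(2-4) real_polynomial_function_sum
        real_polynomial_function.intros(1)[OF lin(1)] real_polynomial_function.intros(1)[OF lin(2)]) simp
  then show ?thesis
    by (simp add: q_def inner_vec_def matrix_vector_mult_diff_distrib)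
qed

lemma integrable_kernel:
  assumes "continuous_on UNIV g"
  shows "integrable lborel (\<lambda>y. g y * \<kappa>0 (q y))" "integrable lborel (\<lambda>y. g y * \<Phi> (q y))"
proof -
  have "norm y \<le> 1" if "q y < 1" for y using q_ge_1[of y] that by linarith
  then have z: "\<kappa>0 (q y) = 0" "\<Phi> (q y) = 0" if "y \<notin> cball 0 1" for y
    using that \<kappa>0_eq_0 \<Phi>_eq_0 by (auto simp: not_less[symmetric])
  have "continuous_on (cball 0 1) g" using assms continuous_on_subset by blast
  then show "integrable lborel (\<lambda>y. g y * \<kappa>0 (q y))" "integrable lborel (\<lambda>y. g y * \<Phi> (q y))"
    using z by (auto intro!: integrable_lborel_compact_support[of "cball 0 1"] continuous_intros)
qed

lemma mass_pos: "0 < mass"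
  unfolding mass_def
proof (rule integral_pos_continuous[where a=0])
  show "integrable lborel (\<lambda>y. \<kappa>0 (q y))" using integrable_kernel(1)[of "\<lambda>_. 1"] by simp
  show "0 < \<kappa>0 (q 0)" by (simp add: q_def \<kappa>0_def bump_def)
qed (auto intro!: continuous_intros \<kappa>0_nonneg)

lemma moment_pos: "0 < moment"
proof -
  have "0 < (\<integral>y. \<Phi> (q y) \<partial>lborel)"
  proof (rule integral_pos_continuous[where a=0])
    show "integrable lborel (\<lambda>y. \<Phi> (q y))" using integrable_kernel(2)[of "\<lambda>_. 1"] by simp
    show "0 < \<Phi> (q 0)" by (simp add: q_def \<Phi>_def bump_def)
  qed (auto intro!: continuous_intros \<Phi>_nonneg)
  then show ?thesis using mass_pos by (simp add: moment_def)
qed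

lemma \<kappa>_nonneg: "0 \<le> \<kappa> y"
  using \<kappa>0_nonneg mass_pos by (simp add: \<kappa>_def less_imp_le)

lemma \<kappa>_eq_0: "1 \<le> norm y \<Longrightarrow> \<kappa> y = 0"
  by (simp add: \<kappa>_def \<kappa>0_eq_0 q_ge_1)

lemma \<kappa>_uminus: "\<kappa> (- y) = \<kappa> y"
  by (simp add: \<kappa>_def q_uminus)

lemma continuous_on_\<kappa> [continuous_intros]:
  "continuous_on S f \<Longrightarrow> continuous_on S (\<lambda>x. \<kappa> (f x))"
  using mass_pos unfolding \<kappa>_def by (auto intro!: continuous_intros)

lemma borel_measurable_\<kappa> [measurable]: "\<kappa> \<in> borel_measurable borel"
  by (intro borel_measurable_continuous_onI continuous_intros)

lemma \<kappa>_bounded: "\<exists>B>0. \<forall>y. \<kappa> y \<le> B"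
proof -
  obtain B where "B > 0" "\<And>y. \<bar>\<kappa> y\<bar> \<le> B"
    by (rule bounded_continuous_compact_support[of \<kappa> 1])
      (use \<kappa>_eq_0 continuous_on_\<kappa>[of UNIV "\<lambda>x. x"] in auto)
  then show ?thesis by (metis abs_le_D1)
qed

lemma integrable_\<kappa>: "continuous_on UNIV g \<Longrightarrow> integrable lborel (\<lambda>y. g y * \<kappa> y)"
  using integrable_kernel(1)[of g] by (simp add: \<kappa>_def)

lemma integrable_\<kappa>_1: "integrable lborel \<kappa>"
  using integrable_\<kappa>[of "\<lambda>_. 1"] by simp

lemma integral_\<kappa>: "(\<integral>y. \<kappa> y \<partial>lborel) = 1"
  using mass_pos by (simp add: \<kappa>_def mass_def)

lemma mult_\<kappa>_mono: "(norm y \<le> 1 \<Longrightarrow> a \<le> b) \<Longrightarrow> a * \<kappa> y \<le> b * \<kappa> y"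
  using \<kappa>_nonneg[of y] \<kappa>_eq_0[of y] by (cases "norm y \<le> 1") (auto intro: mult_right_mono)

section \<open>Moments of the kernel\<close>

lemma partial_\<Phi>_q: "partial l (\<lambda>y. \<Phi> (q y)) y = - (\<kappa>0 (q y) * (2 * (Q *v y) $ l))"
  and Ck_on_\<Phi>_q: "Ck_on k UNIV (\<lambda>y. \<Phi> (q y))"
proof -
  have "q differentiable (at y)" using has_derivative_q by (rule differentiableI)
  from partial_compose[OF this DERIV_\<Phi>]
  show "partial l (\<lambda>y. \<Phi> (q y)) y = - (\<kappa>0 (q y) * (2 * (Q *v y) $ l))"
    using partial_eq[OF has_derivative_q, of l y] by (simp add: inner_axis)
  have "Ck_on k UNIV q" for k
    using Ck_on_real_polynomial_function[OF real_polynomial_function_q[of 1 0]] by simp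
  then show "Ck_on k UNIV (\<lambda>y. \<Phi> (q y))"
    unfolding \<Phi>_def by (intro Ck_on_bump_compose) auto
qed

text \<open>Write \<open>y = A (Q y)\<close>; the components of \<open>(Q y) \<kappa>0(q y)\<close>
  are -1/2 times the partial derivatives of \<open>\<Phi>(q y)\<close> and so integrate to
  0.\<close>

lemma first_moment: "(\<integral>y. y $ i * \<kappa> y \<partial>lborel) = 0"
proof -
  have "\<Phi> (q y) = 0" if "1 < norm y" for y using q_ge_1[of y] \<Phi>_eq_0 that by auto
  from integral_partial_eq_0[OF Ck_on_\<Phi>_q this]
  have *: "(\<integral>y. (Q *v y) $ l * \<kappa>0 (q y) \<partial>lborel) = 0" for l
    by (simp add: partial_\<Phi>_q mult_ac)
  have "y $ i = (\<Sum>l\<in>UNIV. A $ i $ l * (Q *v y) $ l)" for y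
    using arg_cong[OF A_Q_mult[of y], of "\<lambda>v. v $ i"] by (simp add: matrix_vector_mult_def)
  then have "(\<integral>y. y $ i * \<kappa>0 (q y) \<partial>lborel) = (\<integral>y. (\<Sum>l\<in>UNIV. A $ i $ l * ((Q *v y) $ l * \<kappa>0 (q y))) \<partial>lborel)"
    by (metis (no_types, lifting) mult.assoc sum.cong sum_distrib_right)
  also have "\<dots> = (\<Sum>l\<in>UNIV. A $ i $ l * (\<integral>y. (Q *v y) $ l * \<kappa>0 (q y) \<partial>lborel))"
    by (subst Bochner_Integration.integral_sum)
      (auto intro!: integrable_mult_right integrable_kernel continuous_intros)
  finally show ?thesis by (simp add: * \<kappa>_def)
qed

text \<open>The same representation of \<open>y $ i\<close>, now integrated by parts against
  \<open>y $ j\<close>: what remains is the integral of \<open>\<Phi>(q y)\<close> times an entry of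
  \<open>A\<close>. This proportionality to \<open>A\<close> is why means with this kernel detect
  \<open>sym_inner (Hess h x) A\<close>.\<close>

lemma second_moment: "(\<integral>y. y $ i * y $ j * \<kappa> y \<partial>lborel) = moment * A $ i $ j"
proof -
  have ibp: "(\<integral>y. y $ j * (2 * (Q *v y) $ l * \<kappa>0 (q y)) \<partial>lborel)
      = (if j = l then (\<integral>y. \<Phi> (q y) \<partial>lborel) else 0)" for l
  proof -
    have C: "Ck_on k UNIV (\<lambda>y::real^'n. y $ j)" for k
      by (rule Ck_on_bounded_linear) (rule bounded_linear_vec_nth)
    have pj: "partial l (\<lambda>y::real^'n. y $ j) y = (if j = l then 1 else 0)" for y
      using partial_eq[OF bounded_linear_imp_has_derivative[OF bounded_linear_vec_nth[of j]], of l y]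
      by (simp add: axis_def)
    have "y $ j * \<Phi> (q y) = 0" if "1 < norm y" for y using q_ge_1[of y] \<Phi>_eq_0 that by auto
    from integral_partial_eq_0[OF Ck_on_mult[OF open_UNIV C Ck_on_\<Phi>_q] this]
    have "(\<integral>y. partial l (\<lambda>y. y $ j * \<Phi> (q y)) y \<partial>lborel) = 0" .
    moreover have "partial l (\<lambda>y. y $ j * \<Phi> (q y)) y
        = (if j = l then \<Phi> (q y) else 0) - y $ j * (2 * (Q *v y) $ l * \<kappa>0 (q y))" for y
      using partial_mult[of "\<lambda>y. y $ j" y "\<lambda>y. \<Phi> (q y)" l] Ck_on_2D(1)[OF C, of y] Ck_on_2D(1)[OF Ck_on_\<Phi>_q, of y]
      by (simp add: partial_\<Phi>_q pj algebra_simps)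
    moreover have "(\<integral>y. (if j = l then \<Phi> (q y) else 0) - y $ j * (2 * (Q *v y) $ l * \<kappa>0 (q y)) \<partial>lborel)
        = (\<integral>y. (if j = l then \<Phi> (q y) else 0) \<partial>lborel) - (\<integral>y. y $ j * (2 * (Q *v y) $ l * \<kappa>0 (q y)) \<partial>lborel)"
    proof (rule Bochner_Integration.integral_diff)
      show "integrable lborel (\<lambda>y. if j = l then \<Phi> (q y) else 0)"
        using integrable_kernel(2)[of "\<lambda>_. 1"] by (cases "j = l") simp_all
      show "integrable lborel (\<lambda>y. y $ j * (2 * (Q *v y) $ l * \<kappa>0 (q y)))"
        using integrable_kernel(1)[of "\<lambda>y. y $ j * (2 * (Q *v y) $ l)"]
        by (simp add: mult.assoc continuous_intros)
    qed
    ultimately show ?thesis by (cases "j = l") simp_all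
  qed
  have "y $ i = (\<Sum>l\<in>UNIV. A $ i $ l * (Q *v y) $ l)" for y
    using arg_cong[OF A_Q_mult[of y], of "\<lambda>v. v $ i"] by (simp add: matrix_vector_mult_def)
  then have "2 * (y $ i * y $ j * \<kappa>0 (q y)) = (\<Sum>l\<in>UNIV. A $ i $ l * (y $ j * (2 * (Q *v y) $ l * \<kappa>0 (q y))))" for y
    by (simp add: sum_distrib_left sum_distrib_right mult_ac)
  then have "(\<integral>y. 2 * (y $ i * y $ j * \<kappa>0 (q y)) \<partial>lborel)
      = (\<integral>y. (\<Sum>l\<in>UNIV. A $ i $ l * (y $ j * (2 * (Q *v y) $ l * \<kappa>0 (q y)))) \<partial>lborel)"
    by (simp only:)
  also have "\<dots> = (\<Sum>l\<in>UNIV. A $ i $ l * (\<integral>y. y $ j * (2 * (Q *v y) $ l * \<kappa>0 (q y)) \<partial>lborel))"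
  proof (subst Bochner_Integration.integral_sum)
    have "integrable lborel (\<lambda>y. y $ j * (2 * (Q *v y) $ l) * \<kappa>0 (q y))" for l
      by (intro integrable_kernel continuous_intros matrix_vector_mult_continuous_on)
    then show "integrable lborel (\<lambda>y. A $ i $ l * (y $ j * (2 * (Q *v y) $ l * \<kappa>0 (q y))))" for l
      by (intro integrable_mult_right) (simp only: mult.assoc)
  qed simp
  also have "\<dots> = A $ i $ j * (\<integral>y. \<Phi> (q y) \<partial>lborel)"
  proof -
    have "(\<Sum>l\<in>UNIV. A $ i $ l * (if j = l then (\<integral>y. \<Phi> (q y) \<partial>lborel) else 0))
        = (\<Sum>l\<in>UNIV. if j = l then A $ i $ l * (\<integral>y. \<Phi> (q y) \<partial>lborel) else 0)"
      by (rule sum.cong) auto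
    then show ?thesis by (simp add: ibp)
  qed
  finally have "2 * (\<integral>y. y $ i * y $ j * \<kappa>0 (q y) \<partial>lborel) = A $ i $ j * (\<integral>y. \<Phi> (q y) \<partial>lborel)"
    by simp
  then show ?thesis using mass_pos by (simp add: \<kappa>_def moment_def field_simps)
qed

section \<open>Means of quadratic and of twice differentiable functions\<close>

lemma mean_cong:
  assumes "0 < r" "\<And>z. z \<in> cball x r \<Longrightarrow> f z = g z"
  shows "mean r f x = mean r g x"
  unfolding mean_def
proof (rule Bochner_Integration.integral_cong[OF refl])
  fix y :: "real^'n"
  show "f (x + r *\<^sub>R y) * \<kappa> y = g (x + r *\<^sub>R y) * \<kappa> y"
  proof (cases "norm y \<le> 1")
    case True
    then have "x + r *\<^sub>R y \<in> cball x r" using assms(1) by (simp add: dist_norm mult_left_le)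
    then show ?thesis using assms(2) by simp
  next
    case False
    then show ?thesis by (simp add: \<kappa>_eq_0)
  qed
qed

lemma integrable_mean_continuous:
  assumes "0 < r" "continuous_on (cball x r) h"
  shows "integrable lborel (\<lambda>y. h (x + r *\<^sub>R y) * \<kappa> y)"
proof (rule integrable_lborel_compact_support[of "cball 0 1"])
  have "continuous_on (cball 0 1) (\<lambda>y. h (x + r *\<^sub>R y))"
    using assms by (intro continuous_on_compose2[OF assms(2)] continuous_intros)
      (auto simp: dist_norm mult_left_le)
  then show "continuous_on (cball 0 1) (\<lambda>y. h (x + r *\<^sub>R y) * \<kappa> y)"
    by (intro continuous_intros)
qed (auto simp: \<kappa>_eq_0)

lemma integrable_mean_bounded:
  assumes "f \<in> borel_measurable borel" "\<And>z. \<bar>f z\<bar> \<le> B"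
  shows "integrable lborel (\<lambda>y. f (x + r *\<^sub>R y) * \<kappa> y)"
proof (rule Bochner_Integration.integrable_bound)
  show "integrable lborel (\<lambda>y. B * \<kappa> y)" using integrable_\<kappa>_1 by simp
  have [measurable]: "f \<in> borel_measurable borel" by fact
  show "(\<lambda>y. f (x + r *\<^sub>R y) * \<kappa> y) \<in> borel_measurable lborel" by measurable
  have "0 \<le> B" using assms(2)[of 0] by linarith
  then show "AE y in lborel. norm (f (x + r *\<^sub>R y) * \<kappa> y) \<le> norm (B * \<kappa> y)"
    using assms(2) \<kappa>_nonneg by (auto simp: abs_mult intro!: mult_right_mono)
qed

text \<open>The linear part drops out by \<open>first_moment\<close>, and
  \<open>second_moment\<close> contracts \<open>H\<close> with \<open>A\<close>.\<close>

lemma integral_quadratic_\<kappa>: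
  "integrable lborel (\<lambda>y. (c + v \<bullet> y + (H *v y) \<bullet> y) * \<kappa> y)"
  "(\<integral>y. (c + v \<bullet> y + (H *v y) \<bullet> y) * \<kappa> y \<partial>lborel) = c + moment * sym_inner H A"
proof -
  have i1: "integrable lborel (\<lambda>y. y $ i * \<kappa> y)" for i
    by (intro integrable_\<kappa> continuous_intros)
  have i2: "integrable lborel (\<lambda>y. y $ i * y $ j * \<kappa> y)" for i j
    by (intro integrable_\<kappa> continuous_intros)
  have eq: "(c + v \<bullet> y + (H *v y) \<bullet> y) * \<kappa> y = c * \<kappa> y + (\<Sum>i\<in>UNIV. v $ i * (y $ i * \<kappa> y))
      + (\<Sum>i\<in>UNIV. \<Sum>j\<in>UNIV. H $ i $ j * (y $ i * y $ j * \<kappa> y))" for y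
  proof -
    have "(v \<bullet> y) * \<kappa> y = (\<Sum>i\<in>UNIV. v $ i * (y $ i * \<kappa> y))"
      by (simp add: inner_vec_def sum_distrib_right mult.assoc)
    moreover have "((H *v y) \<bullet> y) * \<kappa> y = (\<Sum>i\<in>UNIV. \<Sum>j\<in>UNIV. H $ i $ j * (y $ i * y $ j * \<kappa> y))"
      unfolding inner_vec_def matrix_vector_mult_def vec_lambda_beta inner_real_def sum_distrib_right
      by (simp only: mult_ac)
    ultimately show ?thesis by (simp only: distrib_right)
  qed
  show "integrable lborel (\<lambda>y. (c + v \<bullet> y + (H *v y) \<bullet> y) * \<kappa> y)"
    unfolding eq by (intro Bochner_Integration.integrable_add Bochner_Integration.integrable_sum
        integrable_mult_right i1 i2 integrable_\<kappa>_1)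
  have A: "A $ i $ j = A $ j $ i" for i j
    using arg_cong[OF A_sym, of "\<lambda>M. M $ j $ i"] by (simp add: transpose_def)
  have "(\<integral>y. (\<Sum>i\<in>UNIV. v $ i * (y $ i * \<kappa> y)) \<partial>lborel) = 0"
    by (simp add: i1 first_moment)
  moreover have "(\<integral>y. (\<Sum>i\<in>UNIV. \<Sum>j\<in>UNIV. H $ i $ j * (y $ i * y $ j * \<kappa> y)) \<partial>lborel)
      = (\<Sum>i\<in>UNIV. \<Sum>j\<in>UNIV. H $ i $ j * (moment * A $ i $ j))"
    by (simp add: i2 second_moment)
  moreover have "(\<integral>y. c * \<kappa> y \<partial>lborel) = c" by (simp add: integral_\<kappa>)
  ultimately have "(\<integral>y. (c + v \<bullet> y + (H *v y) \<bullet> y) * \<kappa> y \<partial>lborel)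
     = c + (\<Sum>i\<in>UNIV. \<Sum>j\<in>UNIV. H $ i $ j * (moment * A $ i $ j))"
    unfolding eq
    by (subst Bochner_Integration.integral_add;
        (intro Bochner_Integration.integrable_add Bochner_Integration.integrable_sum
         integrable_mult_right i1 i2 integrable_\<kappa>_1)?)+ simp
  also have "\<dots> = c + (\<Sum>i\<in>UNIV. \<Sum>j\<in>UNIV. H $ i $ j * (moment * A $ j $ i))"
    by (subst A) (rule refl)
  also have "(\<Sum>i\<in>UNIV. \<Sum>j\<in>UNIV. H $ i $ j * (moment * A $ j $ i)) = moment * sym_inner H A"
    by (simp add: sym_inner_eq sum_distrib_left mult_ac)
  finally show "(\<integral>y. (c + v \<bullet> y + (H *v y) \<bullet> y) * \<kappa> y \<partial>lborel) = c + moment * sym_inner H A" .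
qed

lemma mean_quadratic:
  "mean r (\<lambda>x. (B *v x) \<bullet> x + b \<bullet> x + c) x
    = (B *v x) \<bullet> x + b \<bullet> x + c + r\<^sup>2 * moment * sym_inner B A"
proof -
  \<comment> \<open>\<open>r\<close> times the gradient at \<open>x\<close>; the transpose appears
    because \<open>B\<close> is an arbitrary matrix.\<close>
  let ?v = "r *\<^sub>R (B *v x + transpose B *v x + b)"
  have "(B *v (x + r *\<^sub>R y)) \<bullet> (x + r *\<^sub>R y) + b \<bullet> (x + r *\<^sub>R y) + c
      = ((B *v x) \<bullet> x + b \<bullet> x + c) + ?v \<bullet> y + ((r\<^sup>2 *\<^sub>R B) *v y) \<bullet> y" for y
  proof -
    have "(transpose B *v x) \<bullet> y = (B *v y) \<bullet> x"
      by (metis dot_lmul_matrix inner_commute vector_transpose_matrix transpose_transpose)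
    then show ?thesis
      by (simp add: matrix_vector_right_distrib matrix_vector_mult_scaleR inner_add_left inner_add_right
          scaleR_matrix_vector_assoc[symmetric] power2_eq_square algebra_simps)
  qed
  moreover have "sym_inner (r\<^sup>2 *\<^sub>R B) A = r\<^sup>2 * sym_inner B A"
    by (simp add: sym_inner_eq sum_distrib_left mult.assoc)
  ultimately show ?thesis
    unfolding mean_def by (simp only: integral_quadratic_\<kappa>) simp
qed

text \<open>Under the integral \<open>h\<close> is replaced by its Taylor polynomial of degree 2,
  whose mean is known exactly; the factor 1/2 is Taylor's. Uniformity in \<open>x\<close> is
  inherited from \<open>Taylor2_uniform\<close>.\<close>

lemma mean_Taylor:
  assumes "open S" "Ck_on 2 S h" "compact K" "K \<subseteq> S" "\<epsilon> > 0"
  shows "\<exists>r0>0. \<forall>x\<in>K. \<forall>r. 0 < r \<and> r < r0 \<longrightarrow> cball x r \<subseteq> S \<and>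
    \<bar>mean r h x - h x - r\<^sup>2 * (moment * sym_inner (Hess h x) A / 2)\<bar> \<le> \<epsilon> * r\<^sup>2"
proof -
  obtain \<delta> where \<delta>: "\<delta> > 0" and T: "\<And>x y. x \<in> K \<Longrightarrow> norm y \<le> \<delta> \<Longrightarrow> x + y \<in> S \<and>
     \<bar>h (x + y) - h x - grad h x \<bullet> y - (Hess h x *v y) \<bullet> y / 2\<bar> \<le> \<epsilon> * (norm y)\<^sup>2"
    using Taylor2_uniform[OF assms] by blast
  have "cball x r \<subseteq> S \<and> \<bar>mean r h x - h x - r\<^sup>2 * (moment * sym_inner (Hess h x) A / 2)\<bar> \<le> \<epsilon> * r\<^sup>2"
    if x: "x \<in> K" and r: "0 < r" "r < \<delta>" for x r
  proof -
    have sub: "cball x r \<subseteq> S"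
    proof
      fix z assume "z \<in> cball x r"
      then have "norm (z - x) \<le> \<delta>" using r by (simp add: dist_norm norm_minus_commute)
      then show "z \<in> S" using T[OF x, of "z - x"] by simp
    qed
    define H v where "H = (r\<^sup>2 / 2) *\<^sub>R Hess h x" and "v = r *\<^sub>R grad h x"
    define p where "p y = h x + v \<bullet> y + (H *v y) \<bullet> y" for y
    have "sym_inner H A = r\<^sup>2 / 2 * sym_inner (Hess h x) A"
      unfolding sym_inner_eq H_def sum_distrib_left by (simp add: mult.assoc)
    then have I: "(\<integral>y. p y * \<kappa> y \<partial>lborel) = h x + r\<^sup>2 * (moment * sym_inner (Hess h x) A / 2)"
      unfolding p_def integral_quadratic_\<kappa> by simp
    have ip: "integrable lborel (\<lambda>y. p y * \<kappa> y)"
      unfolding p_def by (rule integral_quadratic_\<kappa>)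
    have int: "integrable lborel (\<lambda>y. h (x + r *\<^sub>R y) * \<kappa> y)"
      by (rule integrable_mean_continuous[OF r(1) continuous_on_subset[OF Ck_on_continuous[OF assms(2)] sub]])
    have bd: "\<bar>(h (x + r *\<^sub>R y) - p y) * \<kappa> y\<bar> \<le> \<epsilon> * r\<^sup>2 * \<kappa> y" for y
    proof (cases "norm y \<le> 1")
      case True
      have le: "norm (r *\<^sub>R y) \<le> r" using True r(1) by (simp add: mult_left_le)
      have "h (x + r *\<^sub>R y) - h x - grad h x \<bullet> (r *\<^sub>R y) - (Hess h x *v (r *\<^sub>R y)) \<bullet> (r *\<^sub>R y) / 2
         = h (x + r *\<^sub>R y) - p y"
        unfolding p_def H_def v_def
        by (simp add: matrix_vector_mult_scaleR power2_eq_square flip: scaleR_matrix_vector_assoc)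
      moreover have "norm (r *\<^sub>R y) \<le> \<delta>" using le r(2) by linarith
      ultimately have "\<bar>h (x + r *\<^sub>R y) - p y\<bar> \<le> \<epsilon> * (norm (r *\<^sub>R y))\<^sup>2"
        using T[OF x, of "r *\<^sub>R y"] by metis
      also have "\<dots> \<le> \<epsilon> * r\<^sup>2" using le assms(5) by (intro mult_left_mono power_mono) auto
      finally have "\<bar>h (x + r *\<^sub>R y) - p y\<bar> * \<kappa> y \<le> \<epsilon> * r\<^sup>2 * \<kappa> y"
        by (rule mult_right_mono[OF _ \<kappa>_nonneg])
      then show ?thesis using \<kappa>_nonneg[of y] by (simp only: abs_mult abs_of_nonneg)
    next
      case False
      then have "\<kappa> y = 0" by (intro \<kappa>_eq_0) simp
      then show ?thesis by (simp only: mult_zero_right abs_zero order_refl)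
    qed
    have "mean r h x - (\<integral>y. p y * \<kappa> y \<partial>lborel) = (\<integral>y. (h (x + r *\<^sub>R y) - p y) * \<kappa> y \<partial>lborel)"
      unfolding mean_def left_diff_distrib
      by (rule Bochner_Integration.integral_diff[OF int ip, symmetric])
    also have "\<bar>\<dots>\<bar> \<le> (\<integral>y. \<bar>(h (x + r *\<^sub>R y) - p y) * \<kappa> y\<bar> \<partial>lborel)" by (rule integral_abs_bound)
    also have "\<dots> \<le> (\<integral>y. \<epsilon> * r\<^sup>2 * \<kappa> y \<partial>lborel)"
    proof (rule integral_mono)
      show "integrable lborel (\<lambda>y. \<bar>(h (x + r *\<^sub>R y) - p y) * \<kappa> y\<bar>)"
        unfolding left_diff_distrib
        by (rule integrable_abs[OF Bochner_Integration.integrable_diff[OF int ip]])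
      show "integrable lborel (\<lambda>y. \<epsilon> * r\<^sup>2 * \<kappa> y)" by (rule integrable_mult_right[OF integrable_\<kappa>_1])
    qed (rule bd)
    also have "\<dots> = \<epsilon> * r\<^sup>2" by (simp add: integral_\<kappa>)
    finally have "\<bar>mean r h x - (h x + r\<^sup>2 * (moment * sym_inner (Hess h x) A / 2))\<bar> \<le> \<epsilon> * r\<^sup>2"
      unfolding I .
    then show ?thesis using sub by (simp only: diff_diff_add simp_thms)
  qed
  with \<delta> show ?thesis by blast
qed

text \<open>Substitution \<open>z = x + r y\<close>. Now \<open>x\<close> and \<open>r\<close> occur
  only in the smooth kernel, so that means of a merely integrable \<open>F\<close> can be
  differentiated in \<open>r\<close> and are continuous in \<open>x\<close>.\<close>

lemma mean_kernel:
  assumes "F \<in> borel_measurable borel" "0 < r"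
  shows "mean r F x = (1 / r) ^ CARD('n) * (\<integral>z. F z * \<kappa> ((1 / r) *\<^sub>R (z - x)) \<partial>lborel)"
proof -
  have [measurable]: "F \<in> borel_measurable borel" by fact
  have "mean r F x = (\<integral>y. (\<lambda>z. F z * \<kappa> ((1 / r) *\<^sub>R (z - x))) (x + r *\<^sub>R y) \<partial>lborel)"
    using assms(2) by (simp add: mean_def)
  also have "\<dots> = \<bar>1 / r\<bar> ^ DIM(real^'n) * (\<integral>z. F z * \<kappa> ((1 / r) *\<^sub>R (z - x)) \<partial>lborel)"
    by (rule integral_dilation) (use assms in auto)
  finally show ?thesis using assms(2) by simp
qed

text \<open>Fubini's theorem: \<open>\<kappa>\<close> is integrable and one constant bounds the
  integrals of all \<open>\<bar>H y x\<bar>\<close> over \<open>x\<close>, so the product is jointly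
  integrable.\<close>

lemma \<kappa>_swap:
  fixes H :: "real^'n \<Rightarrow> real^'n \<Rightarrow> real"
  assumes m: "(\<lambda>(y, x). H y x) \<in> borel_measurable (lborel \<Otimes>\<^sub>M lborel)"
    and i: "\<And>y. integrable lborel (H y)" and C: "\<And>y. (\<integral>x. \<bar>H y x\<bar> \<partial>lborel) \<le> C"
  shows "(\<integral>x. (\<integral>y. \<kappa> y * H y x \<partial>lborel) \<partial>lborel) = (\<integral>y. \<kappa> y * (\<integral>x. H y x \<partial>lborel) \<partial>lborel)"
proof -
  have [measurable]: "(\<lambda>p. H (fst p) (snd p)) \<in> borel_measurable (lborel \<Otimes>\<^sub>M lborel)"
    using m by (simp add: case_prod_unfold)
  have "integrable (lborel \<Otimes>\<^sub>M lborel) (\<lambda>(y, x). \<kappa> y * H y x)"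
  proof (rule lborel_pair.Fubini_integrable)
    show "(\<lambda>(y, x). \<kappa> y * H y x) \<in> borel_measurable (lborel \<Otimes>\<^sub>M lborel)"
      unfolding case_prod_unfold by measurable
    show "AE y in lborel. integrable lborel (\<lambda>x. case (y, x) of (y, x) \<Rightarrow> \<kappa> y * H y x)"
      using i by simp
    show "integrable lborel (\<lambda>y. \<integral>x. norm (case (y, x) of (y, x) \<Rightarrow> \<kappa> y * H y x) \<partial>lborel)"
    proof (rule Bochner_Integration.integrable_bound)
      show "integrable lborel (\<lambda>y. C * \<kappa> y)" using integrable_\<kappa>_1 by simp
      show "(\<lambda>y. \<integral>x. norm (case (y, x) of (y, x) \<Rightarrow> \<kappa> y * H y x) \<partial>lborel) \<in> borel_measurable lborel"
        unfolding case_prod_conv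
        by (rule lborel.borel_measurable_lebesgue_integral) (simp add: case_prod_unfold)
      show "AE y in lborel. norm (\<integral>x. norm (case (y, x) of (y, x) \<Rightarrow> \<kappa> y * H y x) \<partial>lborel) \<le> norm (C * \<kappa> y)"
      proof (rule AE_I2)
        fix y
        have "0 \<le> (\<integral>x. \<bar>H y x\<bar> \<partial>lborel)" by simp
        then have "0 \<le> C" using C[of y] by linarith
        then show "norm (\<integral>x. norm (case (y, x) of (y, x) \<Rightarrow> \<kappa> y * H y x) \<partial>lborel) \<le> norm (C * \<kappa> y)"
          using mult_left_mono[OF C[of y] \<kappa>_nonneg[of y]] \<kappa>_nonneg[of y]
          by (simp add: abs_mult mult.commute)
      qed
    qed
  qed
  from lborel_pair.Fubini_integral[OF this] show ?thesis by simp
qed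

lemma integral_uminus:
  fixes f :: "real^'n \<Rightarrow> real"
  assumes "f \<in> borel_measurable borel"
  shows "(\<integral>y. f (- y) \<partial>lborel) = (\<integral>y. f y \<partial>lborel)"
  using integral_dilation[OF assms, of "-1" 0] by simp

text \<open>Averaging is self-adjoint because \<open>\<kappa>\<close> is even: exchange the
  integrals, translate by \<open>r y\<close> for fixed \<open>y\<close>, and exchange them
  back.\<close>

lemma mean_adjoint:
  assumes F: "integrable lborel F" and g: "g \<in> borel_measurable borel" "\<And>x. \<bar>g x\<bar> \<le> B"
  shows "(\<integral>x. g x * mean r F x \<partial>lborel) = (\<integral>z. F z * mean r g z \<partial>lborel)"
proof -
  have [measurable]: "F \<in> borel_measurable borel" "g \<in> borel_measurable borel" using F g by auto
  have bd: "integrable lborel (\<lambda>x. h x * f x)" "(\<integral>x. \<bar>h x * f x\<bar> \<partial>lborel) \<le> B * (\<integral>x. \<bar>f x\<bar> \<partial>lborel)"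
    if "integrable lborel f" "h \<in> borel_measurable borel" "\<And>x. \<bar>h x\<bar> \<le> B" for f h :: "real^'n \<Rightarrow> real"
  proof -
    have [measurable]: "f \<in> borel_measurable borel" "h \<in> borel_measurable borel" using that by auto
    have le: "\<bar>h x * f x\<bar> \<le> B * \<bar>f x\<bar>" for x using that(3) by (simp add: abs_mult mult_right_mono)
    have "0 \<le> B" using that(3)[of 0] by linarith
    show i: "integrable lborel (\<lambda>x. h x * f x)"
      by (rule Bochner_Integration.integrable_bound[OF integrable_mult_right[OF integrable_abs[OF that(1)], of B]])
        (use le \<open>0 \<le> B\<close> in \<open>auto simp: abs_mult\<close>)
    have "(\<integral>x. \<bar>h x * f x\<bar> \<partial>lborel) \<le> (\<integral>x. B * \<bar>f x\<bar> \<partial>lborel)"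
      by (rule integral_mono) (use le i that in auto)
    then show "(\<integral>x. \<bar>h x * f x\<bar> \<partial>lborel) \<le> B * (\<integral>x. \<bar>f x\<bar> \<partial>lborel)" by simp
  qed
  have tr: "(\<integral>x. f (x + c) \<partial>lborel) = (\<integral>x. f x \<partial>lborel)" if "f \<in> borel_measurable borel" for f :: "real^'n \<Rightarrow> real" and c
    using integral_translation(1)[OF that] .
  have "(\<integral>x. g x * mean r F x \<partial>lborel) = (\<integral>x. (\<integral>y. \<kappa> y * (g x * F (x + r *\<^sub>R y)) \<partial>lborel) \<partial>lborel)"
    unfolding mean_def by (simp add: mult_ac flip: integral_mult_right_zero)
  also have "\<dots> = (\<integral>y. \<kappa> y * (\<integral>x. g x * F (x + r *\<^sub>R y) \<partial>lborel) \<partial>lborel)"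
  proof (rule \<kappa>_swap)
    show "integrable lborel (\<lambda>x. g x * F (x + r *\<^sub>R y))" for y
      by (rule bd(1)[OF integral_translation(2)[OF _ F]]) (use g in auto)
    show "(\<integral>x. \<bar>g x * F (x + r *\<^sub>R y)\<bar> \<partial>lborel) \<le> B * (\<integral>x. \<bar>F x\<bar> \<partial>lborel)" for y
      using bd(2)[OF integral_translation(2)[OF _ F, of "r *\<^sub>R y"] g] tr[of "\<lambda>x. \<bar>F x\<bar>" "r *\<^sub>R y"] by simp
  qed (unfold case_prod_unfold, measurable)
  also have "\<dots> = (\<integral>y. \<kappa> y * (\<integral>z. F z * g (z - r *\<^sub>R y) \<partial>lborel) \<partial>lborel)"
  proof (rule Bochner_Integration.integral_cong[OF refl])
    fix y
    show "\<kappa> y * (\<integral>x. g x * F (x + r *\<^sub>R y) \<partial>lborel) = \<kappa> y * (\<integral>z. F z * g (z - r *\<^sub>R y) \<partial>lborel)"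
      using tr[of "\<lambda>z. F z * g (z - r *\<^sub>R y)" "r *\<^sub>R y"] by (simp add: mult.commute)
  qed
  also have "\<dots> = (\<integral>z. (\<integral>y. \<kappa> y * (F z * g (z - r *\<^sub>R y)) \<partial>lborel) \<partial>lborel)"
  proof (rule \<kappa>_swap[symmetric])
    have "integrable lborel (\<lambda>z. g (z - r *\<^sub>R y) * F z)"
         "(\<integral>z. \<bar>g (z - r *\<^sub>R y) * F z\<bar> \<partial>lborel) \<le> B * (\<integral>x. \<bar>F x\<bar> \<partial>lborel)" for y
      by (rule bd[OF F]; use g in measurable)+
    then show "integrable lborel (\<lambda>z. F z * g (z - r *\<^sub>R y))"
         "(\<integral>z. \<bar>F z * g (z - r *\<^sub>R y)\<bar> \<partial>lborel) \<le> B * (\<integral>x. \<bar>F x\<bar> \<partial>lborel)" for y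
      by (simp_all add: mult.commute)
  qed (unfold case_prod_unfold, measurable)
  also have "\<dots> = (\<integral>z. F z * mean r g z \<partial>lborel)"
  proof (rule Bochner_Integration.integral_cong[OF refl])
    fix z
    have "(\<integral>y. \<kappa> y * (F z * g (z - r *\<^sub>R y)) \<partial>lborel) = F z * (\<integral>y. g (z - r *\<^sub>R y) * \<kappa> y \<partial>lborel)"
      by (simp add: mult_ac flip: integral_mult_right_zero)
    also have "(\<integral>y. g (z - r *\<^sub>R y) * \<kappa> y \<partial>lborel) = mean r g z"
      unfolding mean_def using integral_uminus[of "\<lambda>y. g (z + r *\<^sub>R y) * \<kappa> y"] by (simp add: \<kappa>_uminus)
    finally show "(\<integral>y. \<kappa> y * (F z * g (z - r *\<^sub>R y)) \<partial>lborel) = F z * mean r g z" .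
  qed
  finally show ?thesis .
qed

lemma continuous_on_mean:
  assumes "integrable lborel F" "0 < r"
  shows "continuous_on UNIV (mean r F)"
proof -
  have [measurable]: "F \<in> borel_measurable borel" using assms(1) by auto
  obtain B where B: "B > 0" "\<And>y. \<kappa> y \<le> B" using \<kappa>_bounded by blast
  have "continuous_on UNIV (\<lambda>x. \<integral>z. F z * \<kappa> ((1 / r) *\<^sub>R (z - x)) \<partial>lborel)"
    unfolding continuous_on_sequentially
  proof (intro allI ballI impI)
    fix X :: "nat \<Rightarrow> real^'n" and x
    assume X: "(\<forall>n. X n \<in> UNIV) \<and> X \<longlonglongrightarrow> x"
    show "((\<lambda>x. \<integral>z. F z * \<kappa> ((1 / r) *\<^sub>R (z - x)) \<partial>lborel) \<circ> X) \<longlonglongrightarrow> (\<integral>z. F z * \<kappa> ((1 / r) *\<^sub>R (z - x)) \<partial>lborel)"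
      unfolding o_def
    proof (rule integral_dominated_convergence[where w="\<lambda>z. B * \<bar>F z\<bar>"])
      show "AE z in lborel. (\<lambda>n. F z * \<kappa> ((1 / r) *\<^sub>R (z - X n))) \<longlonglongrightarrow> F z * \<kappa> ((1 / r) *\<^sub>R (z - x))"
      proof (rule AE_I2)
        fix z
        have "isCont \<kappa> ((1 / r) *\<^sub>R (z - x))"
          using continuous_on_\<kappa>[of UNIV "\<lambda>x. x"] by (simp add: continuous_on_eq_continuous_at)
        then have "(\<lambda>n. \<kappa> ((1 / r) *\<^sub>R (z - X n))) \<longlonglongrightarrow> \<kappa> ((1 / r) *\<^sub>R (z - x))"
          using X by (intro isCont_tendsto_compose[of _ \<kappa>] tendsto_intros) auto
        then show "(\<lambda>n. F z * \<kappa> ((1 / r) *\<^sub>R (z - X n))) \<longlonglongrightarrow> F z * \<kappa> ((1 / r) *\<^sub>R (z - x))"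
          by (intro tendsto_intros)
      qed
      show "AE z in lborel. norm (F z * \<kappa> ((1 / r) *\<^sub>R (z - X n))) \<le> B * \<bar>F z\<bar>" for n
        using B(2) \<kappa>_nonneg by (auto simp: abs_mult mult.commute[of B] intro!: mult_left_mono)
      show "integrable lborel (\<lambda>z. B * \<bar>F z\<bar>)" using assms(1) by simp
    qed measurable
  qed
  then have "continuous_on UNIV (\<lambda>x. (1 / r) ^ CARD('n) * (\<integral>z. F z * \<kappa> ((1 / r) *\<^sub>R (z - x)) \<partial>lborel))"
    by (intro continuous_intros)
  moreover have "mean r F = (\<lambda>x. (1 / r) ^ CARD('n) * (\<integral>z. F z * \<kappa> ((1 / r) *\<^sub>R (z - x)) \<partial>lborel))"
    using mean_kernel[OF _ assms(2), of F] by auto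
  ultimately show ?thesis by simp
qed

section \<open>Monotonicity of means in the radius\<close>

definition test_fun :: "real^'n \<Rightarrow> real \<Rightarrow> real^'n \<Rightarrow> real" where
  "test_fun x s z = \<Phi> (s\<^sup>2 * q (z - x))"

text \<open>The profile common to two computations: up to factors depending on \<open>s\<close>
  only, it is both \<open>\<Delta>\<^sub>A\<close> of \<open>test_fun x s\<close> and the derivative
  in \<open>s\<close> of the dilated kernel.\<close>

definition Lap :: "real \<Rightarrow> real" where
  "Lap \<sigma> = real CARD('n) * \<kappa>0 \<sigma> + 2 * \<sigma> * \<kappa>1 \<sigma>"

lemma Ck_on_test_fun: "Ck_on k UNIV (test_fun x s)"
  unfolding test_fun_def[abs_def] \<Phi>_def
  by (intro Ck_on_bump_compose Ck_on_real_polynomial_function real_polynomial_function_q) simp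

lemma test_fun_nonneg: "0 \<le> test_fun x s z"
  by (simp add: test_fun_def \<Phi>_nonneg)

lemma q_ge_dist: "0 < s \<Longrightarrow> 1 / s \<le> dist x z \<Longrightarrow> 1 \<le> s\<^sup>2 * q (z - x)"
  using q_ge_1[of "s *\<^sub>R (z - x)"] unfolding q_scaleR
  by (simp add: dist_norm norm_minus_commute divide_le_eq mult.commute)

lemma test_fun_eq_0: "0 < s \<Longrightarrow> 1 / s \<le> dist x z \<Longrightarrow> test_fun x s z = 0"
  by (simp add: test_fun_def \<Phi>_eq_0 q_ge_dist)

lemma test_functions_test_fun:
  assumes "0 < s" "cball x (1 / s) \<subseteq> X"
  shows "test_fun x s \<in> test_functions X"
proof -
  have "z \<in> cball x (1 / s)" if "test_fun x s z \<noteq> 0" for z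
    using test_fun_eq_0[OF assms(1), of x z] that by (cases "1 / s \<le> dist x z") simp_all
  then have "closure {z. test_fun x s z \<noteq> 0} \<subseteq> cball x (1 / s)"
    by (intro closure_minimal) auto
  moreover from this have "compact (closure {z. test_fun x s z \<noteq> 0})"
    by (meson bounded_cball bounded_subset closed_closure compact_eq_bounded_closed)
  ultimately show ?thesis
    using assms(2) Ck_on_test_fun unfolding test_functions_def smooth_on_def by blast
qed

text \<open>With \<open>w = z - x\<close> the Hessian is
  \<open>- 4 s^4 \<kappa>1 (Q w)(Q w)^T - 2 s^2 \<kappa>0 Q\<close>. Since \<open>A\<close> inverts
  \<open>Q\<close>, contraction with \<open>A\<close> turns the rank one matrix into
  \<open>q w\<close> and \<open>Q\<close> into the dimension.\<close>

lemma Lap_test_fun: "sym_inner (Hess (test_fun x s) z) A = - 2 * s\<^sup>2 * Lap (s\<^sup>2 * q (z - x))"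
proof -
  define g where "g = (\<lambda>z. s\<^sup>2 * q (z - x))"
  have dq: "((\<lambda>z. q (z - x)) has_derivative (\<lambda>h. 2 * ((Q *v (z - x)) \<bullet> h))) (at z)" for z
  proof -
    have "((\<lambda>z. z - x) has_derivative (\<lambda>h. h)) (at z)" by (auto intro!: derivative_eq_intros)
    from diff_chain_at[OF this has_derivative_q] show ?thesis by (simp only: o_def)
  qed
  have dg: "(g has_derivative (\<lambda>h. s\<^sup>2 * (2 * ((Q *v (z - x)) \<bullet> h)))) (at z)" for z
    unfolding g_def by (rule has_derivative_mult_right[OF dq])
  then have g: "g differentiable (at z)" for z by (rule differentiableI)
  have pg: "partial i g z = 2 * s\<^sup>2 * (Q *v (z - x)) $ i" for i z
    using partial_eq[OF dg] by (simp add: inner_axis)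
  have p1: "partial j (test_fun x s) = (\<lambda>z. - (\<kappa>0 (g z) * (2 * s\<^sup>2 * (Q *v (z - x)) $ j)))" for j
    unfolding test_fun_def[abs_def] g_def[symmetric, THEN fun_cong]
    using partial_compose[OF g DERIV_\<Phi>, of j] by (intro ext) (simp add: pg)
  have dQ: "((\<lambda>z. (Q *v (z - x)) $ j) has_derivative (\<lambda>h. (Q *v h) $ j)) (at z)" for j z
  proof -
    have "bounded_linear (\<lambda>z. (Q *v z) $ j)"
      using bounded_linear_compose[OF bounded_linear_vec_nth[of j] matrix_vector_mul_bounded_linear[of Q]] by (simp add: o_def)
    then have "((\<lambda>z. (Q *v z) $ j) has_derivative (\<lambda>h. (Q *v h) $ j)) (at (z - x))"
      by (rule bounded_linear_imp_has_derivative)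
    moreover have "((\<lambda>z. z - x) has_derivative (\<lambda>h. h)) (at z)" by (auto intro!: derivative_eq_intros)
    ultimately show ?thesis using diff_chain_at[of "\<lambda>z. z - x" _ z "\<lambda>z. (Q *v z) $ j"] by (simp add: o_def)
  qed
  have pQ: "partial i (\<lambda>z. (Q *v (z - x)) $ j) z = Q $ j $ i" for i j z
    using partial_eq[OF dQ] by (simp add: matrix_vector_mult_basis column_def)
  have Qd: "(\<lambda>z. (Q *v (z - x)) $ j) differentiable (at z)" for j z using dQ by (rule differentiableI)
  have \<kappa>d: "(\<lambda>z. \<kappa>0 (g z)) differentiable (at z)" for z
  proof -
    have "\<kappa>0 differentiable (at (g z))"
      using DERIV_\<kappa>0 unfolding has_field_derivative_def by (rule differentiableI)
    from differentiable_chain_at[OF g this] show ?thesis by (simp only: o_def)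
  qed
  define c1 c2 where "c1 = - 4 * s\<^sup>2 * s\<^sup>2 * \<kappa>1 (g z)" and "c2 = - 2 * s\<^sup>2 * \<kappa>0 (g z)"
  have p2: "Hess (test_fun x s) z $ i $ j = c1 * ((Q *v (z - x)) $ i * (Q *v (z - x)) $ j) + c2 * Q $ j $ i" for i j
  proof -
    have "partial j (test_fun x s) = (\<lambda>z. (- 2 * s\<^sup>2) * (\<kappa>0 (g z) * (Q *v (z - x)) $ j))"
      unfolding p1 by (rule ext) simp
    then have "Hess (test_fun x s) z $ i $ j = partial i (\<lambda>z. (- 2 * s\<^sup>2) * (\<kappa>0 (g z) * (Q *v (z - x)) $ j)) z"
      by (simp only: Hess_def vec_lambda_beta)
    also have "\<dots> = (- 2 * s\<^sup>2) * partial i (\<lambda>z. \<kappa>0 (g z) * (Q *v (z - x)) $ j) z"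
      by (rule partial_cmult[OF differentiable_mult[OF \<kappa>d Qd]])
    also have "partial i (\<lambda>z. \<kappa>0 (g z) * (Q *v (z - x)) $ j) z
        = \<kappa>0 (g z) * partial i (\<lambda>z. (Q *v (z - x)) $ j) z + partial i (\<lambda>z. \<kappa>0 (g z)) z * (Q *v (z - x)) $ j"
      by (rule partial_mult[OF \<kappa>d Qd])
    also have "partial i (\<lambda>z. \<kappa>0 (g z)) z = \<kappa>1 (g z) * partial i g z"
      by (rule partial_compose[OF g DERIV_\<kappa>0])
    finally show ?thesis unfolding pQ pg c1_def c2_def by (simp add: distrib_left)
  qed
  have "(\<Sum>i\<in>UNIV. \<Sum>j\<in>UNIV. (Q *v (z - x)) $ i * (Q *v (z - x)) $ j * A $ j $ i)
      = (A *v (Q *v (z - x))) \<bullet> (Q *v (z - x))"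
  proof -
    have "(A *v w) \<bullet> w = (\<Sum>j\<in>UNIV. \<Sum>i\<in>UNIV. w $ i * w $ j * A $ j $ i)" for w :: "real^'n"
      unfolding inner_vec_def matrix_vector_mult_def vec_lambda_beta inner_real_def sum_distrib_right
      by (simp only: mult_ac)
    then show ?thesis by (subst sum.swap) (simp only:)
  qed
  also have "\<dots> = q (z - x)" unfolding A_Q_mult q_def by (rule inner_commute)
  finally have e1: "(\<Sum>i\<in>UNIV. \<Sum>j\<in>UNIV. (Q *v (z - x)) $ i * (Q *v (z - x)) $ j * A $ j $ i) = q (z - x)" .
  have Q: "Q $ j $ i = Q $ i $ j" for i j
    using arg_cong[OF Q_sym, of "\<lambda>M. M $ i $ j"] by (simp add: transpose_def)
  have "(\<Sum>i\<in>UNIV. \<Sum>j\<in>UNIV. Q $ j $ i * A $ j $ i) = (\<Sum>j\<in>UNIV. \<Sum>i\<in>UNIV. A $ j $ i * Q $ i $ j)"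
    by (subst sum.swap) (simp only: Q mult.commute)
  also have "\<dots> = (\<Sum>j\<in>UNIV. (A ** Q) $ j $ j)"
    by (simp add: matrix_matrix_mult_def)
  finally have e2: "(\<Sum>i\<in>UNIV. \<Sum>j\<in>UNIV. Q $ j $ i * A $ j $ i) = real CARD('n)"
    by (simp add: AQ mat_def)
  have "sym_inner (Hess (test_fun x s) z) A = (\<Sum>i\<in>UNIV. \<Sum>j\<in>UNIV.
      c1 * ((Q *v (z - x)) $ i * (Q *v (z - x)) $ j * A $ j $ i) + c2 * (Q $ j $ i * A $ j $ i))"
    unfolding sym_inner_eq p2 distrib_right by (simp only: mult.assoc)
  also have "\<dots> = c1 * q (z - x) + c2 * real CARD('n)"
    by (simp only: sum.distrib e1 e2 flip: sum_distrib_left)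
  also have "\<dots> = - 2 * s\<^sup>2 * Lap (s\<^sup>2 * q (z - x))"
    by (simp add: Lap_def g_def c1_def c2_def distrib_left)
  finally show ?thesis .
qed

lemma Lap_bounded: "\<exists>C. \<forall>\<sigma>\<ge>0. \<bar>Lap \<sigma>\<bar> \<le> C"
proof -
  have "bounded (Lap ` {0..1})"
    unfolding Lap_def by (intro compact_imp_bounded compact_continuous_image continuous_intros) simp
  then obtain C where C: "C > 0" "\<And>\<sigma>. \<sigma> \<in> {0..1} \<Longrightarrow> \<bar>Lap \<sigma>\<bar> \<le> C" by (auto simp: bounded_pos)
  have "\<bar>Lap \<sigma>\<bar> \<le> C" if "\<sigma> \<ge> 0" for \<sigma>
    using C that by (cases "\<sigma> \<le> 1") (auto simp: Lap_def \<kappa>0_eq_0 \<kappa>1_eq_0)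
  then show ?thesis by blast
qed

text \<open>In the variable \<open>s = 1 / r\<close> the mean is a positive multiple of the integral
  of \<open>F\<close> against \<open>k s\<close>. Its derivative kernel
  \<open>k' s = s ^ (N - 1) * Lap\<close> is a negative multiple of the contracted Hessian in
  \<open>pos\<close>, by \<open>Lap_test_fun\<close>; hence the mean decreases in
  \<open>s\<close>.\<close>

lemma mean_mono_radius:
  assumes F: "integrable lborel F" and r: "0 < r1" "r1 \<le> r2"
    and pos: "\<And>r. r1 \<le> r \<Longrightarrow> r \<le> r2 \<Longrightarrow> 0 \<le> (\<integral>z. F z * sym_inner (Hess (test_fun x (1 / r)) z) A \<partial>lborel)"
  shows "mean r1 F x \<le> mean r2 F x"
proof -
  have [measurable]: "F \<in> borel_measurable borel" using F by auto
  define N where "N = CARD('n)"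
  have N: "N \<ge> 1" unfolding N_def by (simp add: Suc_leI)
  define k where "k s z = s ^ N * \<kappa>0 (s\<^sup>2 * q (z - x))" for s z
  define k' where "k' s z = s ^ (N - 1) * Lap (s\<^sup>2 * q (z - x))" for s z
  define I where "I s = (\<integral>z. F z * k s z \<partial>lborel)" for s
  have mean_I: "mean r F x = I (1 / r) / mass" if "0 < r" for r
    by (subst mean_kernel)
      (use that in \<open>auto simp: I_def k_def \<kappa>_def q_scaleR N_def mult_ac simp flip: integral_mult_right_zero\<close>)
  obtain C where C: "\<And>\<sigma>. \<sigma> \<ge> 0 \<Longrightarrow> \<bar>Lap \<sigma>\<bar> \<le> C" using Lap_bounded by blast
  have k0: "k s z = 0" if "0 < s" "z \<notin> cball x (1 / s)" for s z
    using q_ge_dist[OF that(1), of x z] that(2) by (simp add: k_def \<kappa>0_eq_0)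
  have ck: "continuous_on UNIV (k s)" "continuous_on UNIV (k' s)" for s
    unfolding k_def k'_def Lap_def by (intro continuous_intros)+
  then have [measurable]: "k s \<in> borel_measurable borel" "k' s \<in> borel_measurable borel" for s
    by (auto intro: borel_measurable_continuous_onI)
  have Ik: "integrable lborel (\<lambda>z. F z * k s z)" if s: "0 < s" for s
  proof -
    have "bounded (k s ` cball x (1 / s))"
      using ck by (intro compact_imp_bounded compact_continuous_image) (auto intro: continuous_on_subset)
    then obtain M where M: "M > 0" "\<And>z. z \<in> cball x (1 / s) \<Longrightarrow> \<bar>k s z\<bar> \<le> M" by (auto simp: bounded_pos)
    have M': "\<bar>k s z\<bar> \<le> M" for z using M k0[OF s, of z] by (cases "z \<in> cball x (1 / s)") auto
    show ?thesis
    proof (rule Bochner_Integration.integrable_bound)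
      show "integrable lborel (\<lambda>z. M * F z)" using F by simp
      show "AE z in lborel. norm (F z * k s z) \<le> norm (M * F z)"
        using M' M(1) by (auto simp: abs_mult mult.commute[of M] intro!: mult_left_mono)
    qed measurable
  qed
  have DI: "(I has_real_derivative (\<integral>z. F z * k' s z \<partial>lborel)) (at s)" if s: "0 < s" for s
    unfolding I_def
  proof (rule has_real_derivative_integral[OF F, of 0 s "s + 1" k k' "(s + 1) ^ (N - 1) * C"])
    fix t z assume t: "0 < t" "t < s + 1"
    have "((\<lambda>t. t\<^sup>2 * q (z - x)) has_real_derivative 2 * t * q (z - x)) (at t)"
      by (auto intro!: derivative_eq_intros)
    from DERIV_mult[OF DERIV_pow DERIV_chain2[OF DERIV_\<kappa>0 this], of N]
    have "((\<lambda>t. k t z) has_real_derivative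
        real N * t ^ (N - 1) * \<kappa>0 (t\<^sup>2 * q (z - x)) + \<kappa>1 (t\<^sup>2 * q (z - x)) * (2 * t * q (z - x)) * t ^ N) (at t)"
      by (simp only: k_def One_nat_def)
    moreover have "t ^ N = t ^ (N - 1) * t" using N power_minus_mult[of N t] by simp
    then have "real N * t ^ (N - 1) * \<kappa>0 (t\<^sup>2 * q (z - x)) + \<kappa>1 (t\<^sup>2 * q (z - x)) * (2 * t * q (z - x)) * t ^ N
        = k' t z"
      unfolding k'_def Lap_def N_def[symmetric] power2_eq_square by (simp only: distrib_left mult_ac)
    ultimately show "((\<lambda>t. k t z) has_real_derivative k' t z) (at t)" by simp
    have "\<bar>t ^ (N - 1)\<bar> \<le> (s + 1) ^ (N - 1)" using t by (simp add: power_mono)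
    moreover have "\<bar>Lap (t\<^sup>2 * q (z - x))\<bar> \<le> C" by (intro C mult_nonneg_nonneg q_nonneg) simp
    ultimately show "\<bar>k' t z\<bar> \<le> (s + 1) ^ (N - 1) * C"
      unfolding k'_def abs_mult by (intro mult_mono) auto
  qed (use s Ik in auto)
  have "I (1 / r1) \<le> I (1 / r2)"
  proof (rule DERIV_nonpos_imp_nonincreasing[of "1 / r2" "1 / r1"])
    show "1 / r2 \<le> 1 / r1" using r by (simp add: frac_le)
    fix s assume s: "1 / r2 \<le> s" "s \<le> 1 / r1"
    have s0: "0 < s" using s(1) r by (meson divide_pos_pos less_le_trans zero_less_one)
    have "r1 \<le> 1 / s" "1 / s \<le> r2" using s s0 r by (auto simp: field_simps)
    then have "0 \<le> (\<integral>z. F z * (- 2 * s\<^sup>2 * Lap (s\<^sup>2 * q (z - x))) \<partial>lborel)"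
      using pos[of "1 / s"] by (simp add: Lap_test_fun)
    also have "\<dots> = - 2 * s\<^sup>2 * (\<integral>z. F z * Lap (s\<^sup>2 * q (z - x)) \<partial>lborel)"
      by (simp add: mult_ac flip: integral_mult_right_zero)
    finally have "(\<integral>z. F z * Lap (s\<^sup>2 * q (z - x)) \<partial>lborel) \<le> 0"
      using s0 by (simp add: mult_le_0_iff)
    moreover have "(\<integral>z. F z * k' s z \<partial>lborel) = s ^ (N - 1) * (\<integral>z. F z * Lap (s\<^sup>2 * q (z - x)) \<partial>lborel)"
      by (simp add: k'_def mult_ac flip: integral_mult_right_zero)
    ultimately have "(\<integral>z. F z * k' s z \<partial>lborel) \<le> 0" using s0 by (simp add: mult_nonneg_nonpos)
    with DI[OF s0] show "\<exists>y. (I has_real_derivative y) (at s) \<and> y \<le> 0" by blast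
  qed
  then show ?thesis
    using mean_I r mass_pos by (simp add: divide_right_mono)
qed

end

subsection \<open>From distributions to the mean value inequality\<close>

lemma usc_on_subset: "usc_on S v \<Longrightarrow> T \<subseteq> S \<Longrightarrow> usc_on T v"
  unfolding usc_on_def by (meson filter_leD at_le subsetD)

lemma usc_on_sublevel:
  assumes "usc_on S v"
  shows "\<exists>U. open U \<and> {x\<in>S. v x < c} = S \<inter> U"
proof -
  have "openin (top_of_set S) {x\<in>S. v x < c}"
    unfolding openin_subopen[of _ "{x\<in>S. v x < c}"]
  proof
    fix x assume x: "x \<in> {x\<in>S. v x < c}"
    then have "\<forall>\<^sub>F y in at x within S. v y < c" using assms by (auto simp: usc_on_def)
    then obtain U where U: "open U" "x \<in> U" "\<And>y. y \<in> U \<Longrightarrow> y \<noteq> x \<Longrightarrow> y \<in> S \<Longrightarrow> v y < c"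
      by (auto simp: eventually_at_topological)
    then have "openin (top_of_set S) (S \<inter> U)" by (simp add: openin_open_Int)
    moreover have "x \<in> S \<inter> U" using x U by simp
    moreover have "S \<inter> U \<subseteq> {x\<in>S. v x < c}"
    proof
      fix y assume "y \<in> S \<inter> U"
      then show "y \<in> {x\<in>S. v x < c}" using U(3)[of y] x by (cases "y = x") auto
    qed
    ultimately show "\<exists>T. openin (top_of_set S) T \<and> x \<in> T \<and> T \<subseteq> {x\<in>S. v x < c}" by blast
  qed
  then show ?thesis unfolding openin_open by blast
qed

lemma usc_on_measurable:
  fixes v :: "'a::euclidean_space \<Rightarrow> ereal"
  assumes "usc_on S v"
  shows "S \<in> sets lebesgue \<Longrightarrow> v \<in> borel_measurable (lebesgue_on S)"
    and "S \<in> sets borel \<Longrightarrow> v \<in> borel_measurable (restrict_space borel S)"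
proof -
  assume S: "S \<in> sets lebesgue"
  show "v \<in> borel_measurable (lebesgue_on S)"
  proof (rule borel_measurableI_less)
    fix c
    obtain U where U: "open U" "{x\<in>S. v x < c} = S \<inter> U" using usc_on_sublevel[OF assms] by blast
    have "S \<inter> U \<in> sets (lebesgue_on S)"
      using U(1) S by (auto simp: sets_restrict_space)
    then show "{x \<in> space (lebesgue_on S). v x < c} \<in> sets (lebesgue_on S)" using U(2) by simp
  qed
next
  assume S: "S \<in> sets borel"
  show "v \<in> borel_measurable (restrict_space borel S)"
  proof (rule borel_measurableI_less)
    fix c
    obtain U where U: "open U" "{x\<in>S. v x < c} = S \<inter> U" using usc_on_sublevel[OF assms] by blast
    have "S \<inter> U \<in> sets (restrict_space borel S)"
      using U(1) S by (auto simp: sets_restrict_space)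
    then show "{x \<in> space (restrict_space borel S). v x < c} \<in> sets (restrict_space borel S)"
      using U(2) by (simp add: space_restrict_space)
  qed
qed

lemma usc_on_real_measurable:
  fixes v :: "'a::euclidean_space \<Rightarrow> ereal"
  assumes "usc_on S v" "S \<in> sets borel"
  shows "(\<lambda>x. indicator S x * real_of_ereal (v x)) \<in> borel_measurable borel"
proof -
  have "(\<lambda>x. real_of_ereal (v x)) \<in> borel_measurable (restrict_space borel S)"
    using usc_on_measurable(2)[OF assms] by measurable
  then show ?thesis
    using assms(2) by (simp add: borel_measurable_restrict_space_iff)
qed

section \<open>Distributional Laplacians of functions\<close>

lemma Hess_eq_0_outside:
  assumes "z \<notin> closure {x. \<psi> x \<noteq> 0}"
  shows "Hess \<psi> z = 0"
proof -
  have "Hess \<psi> z = Hess (\<lambda>x. 0) z"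
  proof (rule Hess_cong)
    show "open (- closure {x. \<psi> x \<noteq> 0})" by (rule open_Compl[OF closed_closure])
    show "\<psi> y = 0" if "y \<in> - closure {x. \<psi> x \<noteq> 0}" for y
      using that subsetD[OF closure_subset, of y "{x. \<psi> x \<noteq> 0}"] by blast
  qed (use assms in simp)
  also have "\<dots> = 0" unfolding Hess_def vec_eq_iff by simp
  finally show ?thesis .
qed

text \<open>The two signs in \<open>distr_partial\<close> cancel, and the order of the derivatives
  is reversed, which the symmetry of \<open>A\<close> undoes. \<open>F\<close> is a globally
  integrable Borel function equal to \<open>u\<close> around the support of \<open>\<psi>\<close>;
  it moves the integral from \<open>X\<close> with \<open>lebesgue\<close> to the whole space with
  \<open>lborel\<close>.\<close>

lemma distr_Laplacian_distr_of:
  fixes A :: "real^'n::finite^'n"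
  assumes A: "transpose A = A" and \<psi>: "\<psi> \<in> test_functions X"
    and K: "closure {x. \<psi> x \<noteq> 0} \<subseteq> K" "K \<subseteq> X"
    and F: "integrable lborel F" "\<And>x. x \<in> K \<Longrightarrow> F x = real_of_ereal (u x)"
  shows "distr_Laplacian A (distr_of X u) \<psi> = (\<integral>z. F z * sym_inner (Hess \<psi> z) A \<partial>lborel)"
    and "integrable lborel (\<lambda>z. F z * sym_inner (Hess \<psi> z) A)"
proof -
  have [measurable]: "F \<in> borel_measurable borel" using F(1) by auto
  have C2: "Ck_on 2 UNIV \<psi>" and cpt: "compact (closure {x. \<psi> x \<noteq> 0})"
    using \<psi> by (auto simp: test_functions_def smooth_on_def)
  have cont: "continuous_on UNIV (\<lambda>z. Hess \<psi> z $ i $ j)" for i j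
    using continuous_on_Hess[OF C2] by (intro continuous_intros)
  then have [measurable]: "(\<lambda>z. Hess \<psi> z $ i $ j) \<in> borel_measurable borel" for i j
    by (rule borel_measurable_continuous_onI)
  have int: "integrable lborel (\<lambda>z. F z * Hess \<psi> z $ i $ j)" for i j
  proof -
    have "bounded ((\<lambda>z. Hess \<psi> z $ i $ j) ` closure {x. \<psi> x \<noteq> 0})"
      using cont by (intro compact_imp_bounded compact_continuous_image cpt) (auto intro: continuous_on_subset)
    then obtain B where B: "B > 0" "\<And>z. z \<in> closure {x. \<psi> x \<noteq> 0} \<Longrightarrow> \<bar>Hess \<psi> z $ i $ j\<bar> \<le> B"
      by (auto simp: bounded_pos)
    have "\<bar>Hess \<psi> z $ i $ j\<bar> \<le> B" for z
      using B Hess_eq_0_outside[of z \<psi>] by (cases "z \<in> closure {x. \<psi> x \<noteq> 0}") auto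
    then show ?thesis by (intro integrable_mult_bounded[OF F(1)]) auto
  qed
  have D: "distr_partial i (distr_partial j (distr_of X u)) \<psi> = (\<integral>z. F z * Hess \<psi> z $ j $ i \<partial>lborel)" for i j
  proof -
    have "distr_partial i (distr_partial j (distr_of X u)) \<psi>
        = (\<integral>z. indicator X z *\<^sub>R (real_of_ereal (u z) * partial j (partial i \<psi>) z) \<partial>lebesgue)"
      by (simp add: distr_partial_def distr_of_def set_lebesgue_integral_def)
    also have "\<dots> = (\<integral>z. F z * Hess \<psi> z $ j $ i \<partial>lebesgue)"
    proof (rule Bochner_Integration.integral_cong[OF refl])
      fix z
      show "indicator X z *\<^sub>R (real_of_ereal (u z) * partial j (partial i \<psi>) z) = F z * Hess \<psi> z $ j $ i"
      proof (cases "z \<in> closure {x. \<psi> x \<noteq> 0}")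
        case True
        then have "z \<in> K" "z \<in> X" using K by auto
        then show ?thesis by (simp add: F(2) Hess_def)
      next
        case False
        then have "Hess \<psi> z $ j $ i = 0" by (simp add: Hess_eq_0_outside)
        then show ?thesis by (simp add: Hess_def)
      qed
    qed
    also have "\<dots> = (\<integral>z. F z * Hess \<psi> z $ j $ i \<partial>lborel)"
      by (rule integral_completion) measurable
    finally show ?thesis .
  qed
  have A': "A $ i $ j = A $ j $ i" for i j
    using arg_cong[OF A, of "\<lambda>M. M $ j $ i"] by (simp add: transpose_def)
  have eq: "F z * sym_inner (Hess \<psi> z) A = (\<Sum>i\<in>UNIV. \<Sum>j\<in>UNIV. F z * Hess \<psi> z $ i $ j * A $ j $ i)" for z
    unfolding sym_inner_eq sum_distrib_left by (simp only: mult.assoc)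
  show "integrable lborel (\<lambda>z. F z * sym_inner (Hess \<psi> z) A)"
    unfolding eq by (intro Bochner_Integration.integrable_sum integrable_mult_left int)
  have "distr_Laplacian A (distr_of X u) \<psi>
      = (\<Sum>i\<in>UNIV. \<Sum>j\<in>UNIV. (\<integral>z. F z * Hess \<psi> z $ j $ i \<partial>lborel) * A $ j $ i)"
    unfolding distr_Laplacian_def D ..
  also have "\<dots> = (\<Sum>i\<in>UNIV. \<Sum>j\<in>UNIV. (\<integral>z. F z * Hess \<psi> z $ i $ j \<partial>lborel) * A $ j $ i)"
    by (subst sum.swap) (simp only: A')
  also have "\<dots> = (\<integral>z. F z * sym_inner (Hess \<psi> z) A \<partial>lborel)"
    unfolding eq by (simp add: int)
  finally show "distr_Laplacian A (distr_of X u) \<psi> = (\<integral>z. F z * sym_inner (Hess \<psi> z) A \<partial>lborel)" .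
qed

section \<open>From monotone means to the pointwise mean value inequality\<close>

context elliptic_kernel
begin

lemma abs_mean_le:
  assumes "g \<in> borel_measurable borel" "\<And>x. \<bar>g x\<bar> \<le> B"
  shows "\<bar>mean r g x\<bar> \<le> B"
proof -
  have i: "integrable lborel (\<lambda>y. g (x + r *\<^sub>R y) * \<kappa> y)" by (rule integrable_mean_bounded[OF assms])
  have "\<bar>mean r g x\<bar> \<le> (\<integral>y. \<bar>g (x + r *\<^sub>R y) * \<kappa> y\<bar> \<partial>lborel)"
    unfolding mean_def by (rule integral_abs_bound)
  also have "\<dots> \<le> (\<integral>y. B * \<kappa> y \<partial>lborel)"
  proof (rule integral_mono)
    show "integrable lborel (\<lambda>y. \<bar>g (x + r *\<^sub>R y) * \<kappa> y\<bar>)" by (rule integrable_abs[OF i])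
    show "integrable lborel (\<lambda>y. B * \<kappa> y)" using integrable_\<kappa>_1 by simp
    show "\<bar>g (x + r *\<^sub>R y) * \<kappa> y\<bar> \<le> B * \<kappa> y" for y
      using assms(2) \<kappa>_nonneg[of y] by (simp add: abs_mult mult_right_mono)
  qed
  also have "\<dots> = B" by (simp add: integral_\<kappa>)
  finally show ?thesis .
qed

lemma mean_tendsto:
  assumes g: "continuous_on UNIV g" "\<And>x. \<bar>g x\<bar> \<le> B" and h: "h \<longlonglongrightarrow> 0"
  shows "(\<lambda>m. mean (h m) g x) \<longlonglongrightarrow> g x"
proof -
  have [measurable]: "g \<in> borel_measurable borel" using g(1) by (rule borel_measurable_continuous_onI)
  have "(\<lambda>m. mean (h m) g x) \<longlonglongrightarrow> (\<integral>y. g x * \<kappa> y \<partial>lborel)"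
    unfolding mean_def
  proof (rule integral_dominated_convergence[where w="\<lambda>y. B * \<kappa> y"])
    show "AE y in lborel. (\<lambda>m. g (x + h m *\<^sub>R y) * \<kappa> y) \<longlonglongrightarrow> g x * \<kappa> y"
    proof (rule AE_I2)
      fix y
      have "isCont g x" using g(1) by (simp add: continuous_on_eq_continuous_at)
      moreover have "(\<lambda>m. x + h m *\<^sub>R y) \<longlonglongrightarrow> x + 0 *\<^sub>R y" by (intro tendsto_intros h)
      ultimately have "(\<lambda>m. g (x + h m *\<^sub>R y)) \<longlonglongrightarrow> g x"
        using isCont_tendsto_compose[of x g "\<lambda>m. x + h m *\<^sub>R y"] by simp
      then show "(\<lambda>m. g (x + h m *\<^sub>R y) * \<kappa> y) \<longlonglongrightarrow> g x * \<kappa> y" by (intro tendsto_intros)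
    qed
    show "AE y in lborel. norm (g (x + h m *\<^sub>R y) * \<kappa> y) \<le> B * \<kappa> y" for m
      using g(2) \<kappa>_nonneg by (auto simp: abs_mult intro!: mult_right_mono)
    show "integrable lborel (\<lambda>y. B * \<kappa> y)" using integrable_\<kappa>_1 by simp
  qed measurable
  then show ?thesis by (simp add: integral_\<kappa>)
qed

text \<open>Tests the monotonicity of \<open>mean r F\<close> in \<open>r\<close> against continuous functions decreasing to the
  indicator function of \<open>K\<close>.\<close>

lemma integral_le_integral_mean:
  assumes F: "integrable lborel F" and r: "0 < r" and W: "open W"
    and pos: "\<And>x s. x \<in> W \<Longrightarrow> 0 < s \<Longrightarrow> s \<le> r \<Longrightarrow>
      0 \<le> (\<integral>z. F z * sym_inner (Hess (test_fun x (1 / s)) z) A \<partial>lborel)"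
    and K: "compact K" "K \<subseteq> W"
  shows "(\<integral>x. indicator K x * F x \<partial>lborel) \<le> (\<integral>x. indicator K x * mean r F x \<partial>lborel)"
proof (cases "K = {}")
  case False
  have [measurable]: "F \<in> borel_measurable borel" using F by auto
  have [measurable]: "K \<in> sets borel" using K(1) by (simp add: borel_compact)
  define g where "g = mean r F"
  have cg: "continuous_on UNIV g" unfolding g_def by (rule continuous_on_mean[OF F r])
  then have [measurable]: "g \<in> borel_measurable borel" by (rule borel_measurable_continuous_onI)
  obtain e where e: "e > 0" "compact {x + y |x y. x \<in> K \<and> y \<in> cball 0 e}"
    "{x + y |x y. x \<in> K \<and> y \<in> cball 0 e} \<subseteq> W"
    by (rule compact_cball_neighbourhood[OF K(1) W K(2)])
  define K' where "K' = {x + y |x y. x \<in> K \<and> y \<in> cball 0 e}"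
  have K': "compact K'" "K' \<subseteq> W" using e by (simp_all add: K'_def)
  obtain M where M: "real M * e \<ge> 1"
  proof -
    obtain M where "1 / e < real M" using reals_Archimedean2 by blast
    then have "real M * e \<ge> 1" using e(1) by (simp add: divide_less_eq)
    then show ?thesis by (rule that)
  qed
  \<comment> \<open>Slopes of at least \<open>M\<close>, where \<open>M * e \<ge> 1\<close>, make
    \<open>\<psi> m\<close> vanish outside the \<open>e\<close>-neighbourhood \<open>K'\<close>;
    slopes growing with \<open>m\<close> make it decrease to the indicator function of
    \<open>K\<close>.\<close>
  define \<psi> where "\<psi> m x = max 0 (1 - real (M + m) * infdist x K)" for m x
  have \<psi>01: "0 \<le> \<psi> m x" "\<psi> m x \<le> 1" for m x
    using infdist_nonneg[of x K] by (auto simp: \<psi>_def)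
  then have \<psi>_abs: "\<bar>\<psi> m x\<bar> \<le> 1" for m x by simp
  have c\<psi>: "continuous_on S (\<psi> m)" for m S
    unfolding \<psi>_def by (intro continuous_intros)
  then have [measurable]: "\<psi> m \<in> borel_measurable borel" for m
    by (rule borel_measurable_continuous_onI)
  have \<psi>0: "\<psi> m x = 0" if "x \<notin> K'" for m x
  proof -
    have "e \<le> infdist x K"
    proof (rule ccontr)
      assume *: "\<not> ?thesis"
      obtain k where k: "k \<in> K" "infdist x K = dist x k"
        using infdist_attains_inf[of K x] K(1) False by (auto simp: compact_imp_closed)
      have "x = k + (x - k)" by simp
      moreover have "x - k \<in> cball 0 e" using * k(2) by (simp add: dist_norm norm_minus_commute)
      ultimately have "x \<in> K'" using k(1) unfolding K'_def by blast
      then show False using that by simp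
    qed
    then have "real (M + m) * e \<le> real (M + m) * infdist x K" by (intro mult_left_mono) auto
    moreover have "1 \<le> real (M + m) * e" using M e(1) by (simp add: distrib_right add_increasing2)
    ultimately have "1 - real (M + m) * infdist x K \<le> 0" by linarith
    then show ?thesis by (simp add: \<psi>_def)
  qed
  have int: "integrable lborel (\<lambda>x. \<psi> m x * h x)" if "continuous_on UNIV h" for h m
    by (rule integrable_lborel_compact_support[OF K'(1)])
      (auto intro!: continuous_intros c\<psi> continuous_on_subset[OF that] simp: \<psi>0)
  \<comment> \<open>A small averaging radius \<open>s j\<close> is put on \<open>\<psi> m\<close>,
    moved to \<open>F\<close> by \<open>mean_adjoint\<close>, and there enlarged to \<open>r\<close>
    by monotonicity; afterwards \<open>s j\<close> tends to 0.\<close>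
  have step: "(\<integral>x. F x * \<psi> m x \<partial>lborel) \<le> (\<integral>x. \<psi> m x * g x \<partial>lborel)" for m
  proof -
    define s where "s j = r / real (Suc j)" for j
    have s: "0 < s j" "s j \<le> r" for j using r by (auto simp: s_def field_simps)
    have s0: "s \<longlonglongrightarrow> 0"
      unfolding s_def using LIMSEQ_inverse_real_of_nat[THEN tendsto_mult_right_zero, of r]
      by (simp add: divide_inverse mult.commute)
    have "(\<lambda>j. \<integral>x. F x * mean (s j) (\<psi> m) x \<partial>lborel) \<longlonglongrightarrow> (\<integral>x. F x * \<psi> m x \<partial>lborel)"
    proof (rule integral_dominated_convergence[where w="\<lambda>x. \<bar>F x\<bar>"])
      show "AE x in lborel. (\<lambda>j. F x * mean (s j) (\<psi> m) x) \<longlonglongrightarrow> F x * \<psi> m x"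
        by (intro AE_I2 tendsto_mult_left mean_tendsto[OF c\<psi> \<psi>_abs s0])
      show "AE x in lborel. norm (F x * mean (s j) (\<psi> m) x) \<le> \<bar>F x\<bar>" for j
        using abs_mean_le[of "\<psi> m" 1 "s j"] \<psi>_abs
        by (auto simp: abs_mult intro!: mult_left_le)
      have "integrable lborel (\<psi> m)" using int[of "\<lambda>_. 1" m] by simp
      then have "continuous_on UNIV (mean (s j) (\<psi> m))" for j
        using s(1) by (rule continuous_on_mean)
      then have [measurable]: "mean (s j) (\<psi> m) \<in> borel_measurable borel" for j
        by (rule borel_measurable_continuous_onI)
      show "(\<lambda>x. F x * mean (s j) (\<psi> m) x) \<in> borel_measurable lborel" for j by measurable
    qed (use F in auto)
    moreover have "(\<integral>x. F x * mean (s j) (\<psi> m) x \<partial>lborel) \<le> (\<integral>x. \<psi> m x * g x \<partial>lborel)" for j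
    proof -
      have "(\<integral>x. F x * mean (s j) (\<psi> m) x \<partial>lborel) = (\<integral>x. \<psi> m x * mean (s j) F x \<partial>lborel)"
        by (rule mean_adjoint[OF F _ \<psi>_abs, symmetric]) simp
      also have "\<dots> \<le> (\<integral>x. \<psi> m x * g x \<partial>lborel)"
      proof (rule integral_mono)
        fix x
        show "\<psi> m x * mean (s j) F x \<le> \<psi> m x * g x"
        proof (cases "x \<in> K'")
          case True
          then have "x \<in> W" using K'(2) by blast
          then have "mean (s j) F x \<le> g x" unfolding g_def
            by (intro mean_mono_radius[OF F s] pos) (use s(1)[of j] in linarith)+
          then show ?thesis using \<psi>01(1) by (rule mult_left_mono)
        next
          case False
          then show ?thesis by (simp add: \<psi>0)
        qed
      qed (intro int continuous_on_mean[OF F s(1)] cg)+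
      finally show ?thesis .
    qed
    ultimately show ?thesis by (intro LIMSEQ_le_const2) blast+
  qed
  have lim: "(\<lambda>m. \<psi> m x) \<longlonglongrightarrow> indicator K x" for x
  proof (cases "x \<in> K")
    case True
    then show ?thesis by (simp add: \<psi>_def)
  next
    case no: False
    then have d: "0 < infdist x K"
      using K(1) False by (metis compact_imp_closed in_closed_iff_infdist_zero infdist_nonneg less_eq_real_def)
    obtain N where N: "1 / infdist x K < real N" using reals_Archimedean2 by blast
    have "\<psi> m x = 0" if "m \<ge> N" for m
    proof -
      have "1 < real N * infdist x K" using N d by (simp add: divide_less_eq)
      also have "\<dots> \<le> real (M + m) * infdist x K" using that d by (intro mult_right_mono) auto
      finally show ?thesis by (simp add: \<psi>_def)
    qed
    then have "eventually (\<lambda>m. 0 = \<psi> m x) sequentially" by (auto simp: eventually_sequentially)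
    then show ?thesis using no by (auto intro: Lim_transform_eventually)
  qed
  have L1: "(\<lambda>m. \<integral>x. F x * \<psi> m x \<partial>lborel) \<longlonglongrightarrow> (\<integral>x. F x * indicator K x \<partial>lborel)"
  proof (rule integral_dominated_convergence[where w="\<lambda>x. \<bar>F x\<bar>"])
    show "AE x in lborel. (\<lambda>m. F x * \<psi> m x) \<longlonglongrightarrow> F x * indicator K x"
      by (intro AE_I2 tendsto_mult_left lim)
    show "AE x in lborel. norm (F x * \<psi> m x) \<le> \<bar>F x\<bar>" for m
      using \<psi>_abs by (auto simp: abs_mult intro!: mult_left_le)
  qed (use F in auto)
  have L2: "(\<lambda>m. \<integral>x. \<psi> m x * g x \<partial>lborel) \<longlonglongrightarrow> (\<integral>x. indicator K x * g x \<partial>lborel)"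
  proof (rule integral_dominated_convergence[where w="\<lambda>x. \<bar>indicator K' x *\<^sub>R g x\<bar>"])
    show "AE x in lborel. (\<lambda>m. \<psi> m x * g x) \<longlonglongrightarrow> indicator K x * g x"
      by (intro AE_I2 tendsto_mult_right lim)
    show "AE x in lborel. norm (\<psi> m x * g x) \<le> \<bar>indicator K' x *\<^sub>R g x\<bar>" for m
    proof (rule AE_I2)
      fix x
      show "norm (\<psi> m x * g x) \<le> \<bar>indicator K' x *\<^sub>R g x\<bar>"
        using \<psi>0[of x m] mult_right_mono[OF \<psi>01(2)[of m x], of "\<bar>g x\<bar>"] \<psi>01(1)[of m x]
        by (cases "x \<in> K'") (simp_all add: abs_mult)
    qed
    show "integrable lborel (\<lambda>x. \<bar>indicator K' x *\<^sub>R g x\<bar>)"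
      by (intro integrable_abs borel_integrable_compact K' continuous_on_subset[OF cg]) simp
  qed measurable
  have "(\<integral>x. F x * indicator K x \<partial>lborel) \<le> (\<integral>x. indicator K x * g x \<partial>lborel)"
    by (rule LIMSEQ_le[OF L1 L2]) (use step in blast)
  then show ?thesis by (simp add: g_def mult.commute)
qed simp

text \<open>On a compact subset \<open>K\<close> of the exceptional set \<open>E\<close> the
  function \<open>F - mean r F\<close> is positive, yet its integral is at most 0 by
  \<open>integral_le_integral_mean\<close>; so \<open>K\<close> is null, and inner regularity makes
  \<open>E\<close> null.\<close>

lemma AE_le_mean:
  assumes F: "integrable lborel F" and r: "0 < r" and W: "open W" "bounded W"
    and pos: "\<And>x s. x \<in> W \<Longrightarrow> 0 < s \<Longrightarrow> s \<le> r \<Longrightarrow>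
      0 \<le> (\<integral>z. F z * sym_inner (Hess (test_fun x (1 / s)) z) A \<partial>lborel)"
  shows "AE x in lborel. x \<in> W \<longrightarrow> F x \<le> mean r F x"
proof -
  have [measurable]: "F \<in> borel_measurable borel" "W \<in> sets borel" using F W by auto
  have cg: "continuous_on UNIV (mean r F)" by (rule continuous_on_mean[OF F r])
  then have [measurable]: "mean r F \<in> borel_measurable borel" by (rule borel_measurable_continuous_onI)
  define E where "E = {x. x \<in> W \<and> mean r F x < F x}"
  have [measurable]: "E \<in> sets borel" unfolding E_def by measurable
  \<comment> \<open>Restriction to the bounded set \<open>W\<close> produces the finite measure that
    \<open>inner_regular\<close> asks for.\<close>
  define M where "M = density lborel (\<lambda>x. indicator W x)"
  have sM: "sets M = sets borel" by (simp add: M_def)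
  have eM: "emeasure M S = emeasure lborel (W \<inter> S)" if "S \<in> sets borel" for S
    using that by (simp add: M_def emeasure_density indicator_inter_arith[symmetric])
  have "emeasure M (space M) \<noteq> \<infinity>"
    using eM[of UNIV] emeasure_bounded_finite[OF W(2)] by (simp add: M_def)
  from inner_regular[OF sM this, of E]
  have reg: "emeasure M E = (SUP K\<in>{K. K \<subseteq> E \<and> compact K}. emeasure M K)" by simp
  have "emeasure M K = 0" if K: "K \<subseteq> E" "compact K" for K
  proof -
    have [measurable]: "K \<in> sets borel" using K(2) by (simp add: borel_compact)
    have KW: "K \<subseteq> W" using K(1) by (auto simp: E_def)
    have iF: "integrable lborel (\<lambda>x. indicator K x * F x)"
      using integrable_mult_bounded[OF F, of "indicator K" 1] by (simp add: mult.commute)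
    have ig: "integrable lborel (\<lambda>x. indicator K x * mean r F x)"
      using borel_integrable_compact[OF K(2) continuous_on_subset[OF cg]] by simp
    have "(\<integral>x. indicator K x * F x - indicator K x * mean r F x \<partial>lborel) \<le> 0"
      using integral_le_integral_mean[OF F r W(1) pos K(2) KW] iF ig by simp
    moreover have nn: "0 \<le> indicator K x * F x - indicator K x * mean r F x" for x
      using K(1) by (cases "x \<in> K") (auto simp: E_def less_imp_le)
    ultimately have "(\<integral>x. indicator K x * F x - indicator K x * mean r F x \<partial>lborel) = 0"
      by (intro antisym Bochner_Integration.integral_nonneg)
    then have "AE x in lborel. indicator K x * F x - indicator K x * mean r F x = 0"
      using integral_nonneg_eq_0_iff_AE[OF Bochner_Integration.integrable_diff[OF iF ig]] nn by simp
    then have "AE x in lborel. x \<notin> K"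
    proof eventually_elim
      case (elim x)
      then show ?case using K(1) by (auto simp: E_def)
    qed
    then have "emeasure lborel K = 0"
      by (subst (asm) AE_iff_measurable[where N=K]) auto
    moreover have "W \<inter> K = K" using KW by blast
    ultimately show ?thesis using eM[of K] by simp
  qed
  then have "emeasure M E \<le> 0" unfolding reg by (intro SUP_least) simp
  moreover have "W \<inter> E = E" by (auto simp: E_def)
  ultimately have "emeasure lborel E = 0" using eM[of E] by auto
  then have "E \<in> null_sets lborel" by (simp add: null_sets_def)
  then show ?thesis
    by (rule AE_I'[of E]) (auto simp: E_def not_le)
qed

lemma cball_subset_enlarge:
  fixes x0 :: "real^'n"
  assumes "open X" "cball x0 r \<subseteq> X" "0 < r"
  obtains e where "e > 0" "cball x0 (r + e) \<subseteq> X"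
proof -
  obtain e where e: "e > 0" "(\<Union>x\<in>cball x0 r. ball x e) \<subseteq> X"
    using compact_subset_open_imp_ball_epsilon_subset[OF compact_cball assms(1,2)] by blast
  have "z \<in> X" if z: "z \<in> cball x0 (r + e/2)" for z
  proof (cases "dist x0 z \<le> r")
    case True
    then show ?thesis using assms(2) by auto
  next
    case False
    define d where "d = norm (z - x0)"
    have d: "d > r" "d \<le> r + e/2" using False z by (auto simp: d_def dist_norm norm_minus_commute)
    \<comment> \<open>Radial projection of \<open>z\<close> to the sphere of radius
      \<open>r\<close>, which is at distance at most \<open>e / 2\<close> from
      \<open>z\<close>.\<close>
    define x where "x = x0 + (r / d) *\<^sub>R (z - x0)"
    have "dist x0 x = r" using d assms(3) by (simp add: x_def dist_norm d_def[symmetric])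
    then have x: "x \<in> cball x0 r" by simp
    have "z - x = (1 - r / d) *\<^sub>R (z - x0)" by (simp add: x_def algebra_simps)
    then have "norm (z - x) = \<bar>1 - r / d\<bar> * d" by (simp add: d_def)
    also have "\<dots> = (1 - r / d) * d" using d assms(3) by (simp add: divide_le_eq)
    also have "\<dots> = d - r" using d assms(3) by (simp add: left_diff_distrib)
    finally have "z \<in> ball x e" using d e(1) by (simp add: dist_norm norm_minus_commute)
    with x show ?thesis using e(2) by blast
  qed
  then have "cball x0 (r + e / 2) \<subseteq> X" by blast
  moreover have "0 < e / 2" using e(1) by simp
  ultimately show ?thesis using that by blast
qed

lemma mean_mono_AE:
  assumes "0 < r" and F: "integrable lborel F" and G: "integrable lborel G"
    and le: "AE z in lborel. z \<in> cball x r \<longrightarrow> F z \<le> G z"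
  shows "mean r F x \<le> mean r G x"
proof -
  have [measurable]: "F \<in> borel_measurable borel" "G \<in> borel_measurable borel" using F G by auto
  obtain B where B: "\<And>y. \<kappa> y \<le> B" using \<kappa>_bounded by blast
  have int: "integrable lborel (\<lambda>z. f z * \<kappa> ((1 / r) *\<^sub>R (z - x)))" if "integrable lborel f" for f :: "real^'n \<Rightarrow> real"
    by (rule integrable_mult_bounded[OF that, of _ B]) (use B \<kappa>_nonneg in auto)
  have "(\<integral>z. F z * \<kappa> ((1 / r) *\<^sub>R (z - x)) \<partial>lborel) \<le> (\<integral>z. G z * \<kappa> ((1 / r) *\<^sub>R (z - x)) \<partial>lborel)"
  proof (rule integral_mono_AE[OF int[OF F] int[OF G]])
    show "AE z in lborel. F z * \<kappa> ((1 / r) *\<^sub>R (z - x)) \<le> G z * \<kappa> ((1 / r) *\<^sub>R (z - x))"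
      using le
    proof eventually_elim
      case (elim z)
      have "z \<in> cball x r" if "norm ((1 / r) *\<^sub>R (z - x)) \<le> 1"
        using that assms(1) by (simp add: dist_norm norm_minus_commute divide_le_eq)
      then show ?case using elim by (intro mult_\<kappa>_mono) blast
    qed
  qed
  then show ?thesis
    using assms(1) by (simp add: mean_kernel mult_left_mono)
qed

text \<open>The inequality holds almost everywhere near \<open>x0\<close>; continuity of the mean
  carries it over to the essential limes superior, which is \<open>v x0\<close> by the normalisation
  in \<open>PSH\<close>. An integrable majorant \<open>G\<close> instead of \<open>v\<close> on the
  right is the form that suprema, truncations and the maximum principle need.\<close>

lemma PSH_le_mean:
  assumes A: "A \<in> polar_cone P" and v: "v \<in> PSH P X" and X: "open X"
    and r: "0 < r" "cball x0 r \<subseteq> X" and G: "integrable lborel G"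
    and le: "\<And>z. z \<in> cball x0 r \<Longrightarrow> v z \<le> ereal (G z)"
  shows "v x0 \<le> ereal (mean r G x0)"
proof -
  have usc: "usc_on X v" and L1: "AE x in lebesgue. x \<in> X \<longrightarrow> \<bar>v x\<bar> \<noteq> \<infinity>"
    "\<And>K. compact K \<Longrightarrow> K \<subseteq> X \<Longrightarrow> (\<lambda>x. real_of_ereal (v x)) absolutely_integrable_on K"
    and psh: "psh_distr P X (distr_of X v)" and ess: "\<And>x. x \<in> X \<Longrightarrow> v x = ess_limsup X v x"
    using v by (auto simp: PSH_def USC_def L1_loc_def)
  \<comment> \<open>The enlarged ball contains the supports of all test functions of radius at most
    \<open>r\<close> centred in \<open>W\<close>, so a single \<open>F\<close> serves them
    all.\<close>
  obtain e where e: "e > 0" "cball x0 (r + e) \<subseteq> X" by (rule cball_subset_enlarge[OF X r(2,1)])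
  define F where "F z = indicator (cball x0 (r + e)) z * real_of_ereal (v z)" for z
  have Fm: "F \<in> borel_measurable borel"
    unfolding F_def by (rule usc_on_real_measurable[OF usc_on_subset[OF usc e(2)]]) simp
  have F_eq: "F z = real_of_ereal (v z)" if "z \<in> cball x0 (r + e)" for z
    using that by (simp add: F_def)
  have "integrable lebesgue F"
    using L1(2)[OF compact_cball e(2)] by (simp add: set_integrable_def F_def[abs_def])
  then have F: "integrable lborel F" using Fm by (simp add: integrable_completion)
  define W where "W = ball x0 e"
  have "AE x in lborel. x \<in> W \<longrightarrow> F x \<le> mean r F x"
  proof (rule AE_le_mean[OF F r(1)])
    fix x s assume x: "x \<in> W" and s: "0 < s" "s \<le> r"
    have sub: "cball x s \<subseteq> cball x0 (r + e)"
    proof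
      fix z assume "z \<in> cball x s"
      then show "z \<in> cball x0 (r + e)" using x s(2) dist_triangle[of x0 z x] by (auto simp: W_def)
    qed
    let ?\<psi> = "test_fun x (1 / s)"
    have \<psi>: "?\<psi> \<in> test_functions (cball x0 (r + e))"
      by (rule test_functions_test_fun) (use s sub in simp_all)
    then have supp: "closure {z. ?\<psi> z \<noteq> 0} \<subseteq> cball x0 (r + e)"
      unfolding test_functions_def by blast
    have \<psi>X: "?\<psi> \<in> test_functions X"
      using \<psi> e(2) unfolding test_functions_def by blast
    have "0 \<le> distr_Laplacian A (distr_of X v) ?\<psi>"
      using psh A \<psi>X test_fun_nonneg unfolding psh_distr_def distr_nonneg_def by blast
    then show "0 \<le> (\<integral>z. F z * sym_inner (Hess ?\<psi> z) A \<partial>lborel)"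
      using distr_Laplacian_distr_of(1)[OF A_sym \<psi>X supp e(2) F F_eq] by simp
  qed (auto simp: W_def)
  then have "AE x in lebesgue. x \<in> W \<longrightarrow> F x \<le> mean r F x" by (rule AE_completion)
  with L1(1) have AE: "AE x in lebesgue. x \<in> W \<longrightarrow> v x \<le> ereal (mean r F x)"
  proof eventually_elim
    case (elim x)
    show ?case
    proof
      assume x: "x \<in> W"
      then have "x \<in> cball x0 (r + e)" using r(1) by (simp add: W_def)
      then have "F x = real_of_ereal (v x)" "x \<in> X" using F_eq e(2) by blast+
      then have "v x = ereal (F x)" using elim(1) by (simp add: ereal_real')
      then show "v x \<le> ereal (mean r F x)" using elim(2) x by simp
    qed
  qed
  have "ess_limsup X v x0 \<le> ereal (mean r F x0) + ereal \<epsilon>" if \<epsilon>: "0 < \<epsilon>" for \<epsilon>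
  proof -
    have "isCont (mean r F) x0"
      using continuous_on_mean[OF F r(1)] by (simp add: continuous_on_eq_continuous_at)
    then obtain d where d: "d > 0" "\<And>x. dist x x0 < d \<Longrightarrow> dist (mean r F x) (mean r F x0) < \<epsilon>"
      using \<epsilon> unfolding continuous_at_eps_delta by blast
    define \<rho> where "\<rho> = min d e"
    let ?B = "ball x0 \<rho> \<inter> X"
    have B: "?B \<in> sets lebesgue" using X by auto
    then have B': "?B \<inter> space lebesgue \<in> sets lebesgue" by simp
    have "esssup (lebesgue_on ?B) v \<le> ereal (mean r F x0 + \<epsilon>)"
    proof (rule esssup_I)
      show "v \<in> borel_measurable (lebesgue_on ?B)"
        by (rule usc_on_measurable(1)[OF usc_on_subset[OF usc] B]) simp
      show "AE x in lebesgue_on ?B. v x \<le> ereal (mean r F x0 + \<epsilon>)"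
        unfolding AE_restrict_space_iff[OF B'] using AE
      proof eventually_elim
        case (elim x)
        show ?case
        proof
          assume "x \<in> ?B"
          then have "x \<in> W" "dist x x0 < d" by (auto simp: \<rho>_def W_def dist_commute)
          then have "v x \<le> ereal (mean r F x)" "mean r F x \<le> mean r F x0 + \<epsilon>"
            using elim d(2)[of x] by (auto simp: dist_real_def)
          then show "v x \<le> ereal (mean r F x0 + \<epsilon>)" by (meson ereal_less_eq(3) order_trans)
        qed
      qed
    qed
    moreover have "\<rho> > 0" using d e by (simp add: \<rho>_def)
    ultimately have "ess_limsup X v x0 \<le> ereal (mean r F x0 + \<epsilon>)"
      unfolding ess_limsup_def by (metis INF_lower2 greaterThan_iff)
    then show ?thesis by simp
  qed
  then have "ess_limsup X v x0 \<le> ereal (mean r F x0)"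
    by (rule ereal_le_epsilon2)
  moreover have "x0 \<in> X" using r by auto
  moreover have "mean r F x0 \<le> mean r G x0"
  proof (rule mean_mono_AE[OF r(1) F G])
    have "AE x in lborel. x \<in> X \<longrightarrow> \<bar>v x\<bar> \<noteq> \<infinity>" using L1(1) by (simp add: AE_completion_iff)
    then show "AE z in lborel. z \<in> cball x0 r \<longrightarrow> F z \<le> G z"
    proof eventually_elim
      case (elim z)
      show ?case
      proof
        assume z: "z \<in> cball x0 r"
        then have "v z = ereal (F z)" using elim r(2) F_eq[of z] e(1) by (auto simp: ereal_real')
        then show "F z \<le> G z" using le[OF z] by simp
      qed
    qed
  qed
  ultimately show ?thesis using ess[of x0] by (metis ereal_less_eq(3) order_trans)
qed

end

subsection \<open>The polar cone\<close>

lemma sym_inner_add_left: "sym_inner (A + B) C = sym_inner A C + sym_inner B C"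
  by (simp add: sym_inner_eq distrib_right sum.distrib)

lemma sym_inner_scaleR_left: "sym_inner (c *\<^sub>R A) C = c * sym_inner A C"
  by (simp add: sym_inner_eq sum_distrib_left mult.assoc)

lemma sym_inner_commute: "sym_inner A B = sym_inner B A"
  unfolding sym_inner_eq by (subst sum.swap) (simp only: mult.commute)

lemma sym_inner_scaleR_right: "sym_inner C (c *\<^sub>R A) = c * sym_inner C A"
  using sym_inner_scaleR_left sym_inner_commute by metis

lemma continuous_on_sym_inner [continuous_intros]:
  "continuous_on S f \<Longrightarrow> continuous_on S g \<Longrightarrow> continuous_on S (\<lambda>x. sym_inner (f x) (g x))"
  unfolding sym_inner_eq by (intro continuous_intros)

lemma transpose_add_scaleR:
  "transpose (A + B) = transpose A + transpose (B::real^'n^'m)" "transpose (c *\<^sub>R A) = c *\<^sub>R transpose A"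
  by (simp_all add: transpose_def vec_eq_iff)

lemma Sym2_UNIV: "Sym2 UNIV = {A::real^'n::finite^'n. transpose A = A}"
proof -
  have "w = 0" if "w \<in> (UNIV :: (real^'n) set)\<^sup>\<bottom>" for w :: "real^'n"
  proof -
    have "w \<bullet> w = 0" using that unfolding orthogonal_comp_def orthogonal_def by blast
    then show ?thesis by simp
  qed
  then show ?thesis unfolding Sym2_def by auto
qed

lemma polar_cone_add: "A \<in> polar_cone P \<Longrightarrow> B \<in> polar_cone P \<Longrightarrow> A + B \<in> polar_cone P"
  by (auto simp: polar_cone_def Sym2_UNIV transpose_add_scaleR sym_inner_add_left)

lemma polar_cone_scaleR: "A \<in> polar_cone P \<Longrightarrow> 0 \<le> c \<Longrightarrow> c *\<^sub>R A \<in> polar_cone P"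
  by (auto simp: polar_cone_def Sym2_UNIV transpose_add_scaleR sym_inner_scaleR_left)

lemma zero_in_polar_cone: "0 \<in> polar_cone P"
  by (auto simp: polar_cone_def Sym2_UNIV sym_inner_eq transpose_def vec_eq_iff)

lemma convex_polar_cone: "convex (polar_cone P)"
  by (intro convexI polar_cone_add polar_cone_scaleR) auto

lemma closed_polar_cone: "closed (polar_cone (P::(real^'n::finite^'n) set))"
proof -
  have "polar_cone P = {A. transpose A = A} \<inter> (\<Inter>B\<in>P. {A. 0 \<le> sym_inner A B})"
    by (auto simp: polar_cone_def Sym2_UNIV)
  moreover have "closed {A::real^'n^'n. transpose A = A}"
    unfolding transpose_def by (intro closed_Collect_eq continuous_intros)
  moreover have "closed {A. 0 \<le> sym_inner A B}" for B :: "real^'n^'n"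
    by (intro closed_Collect_le continuous_intros)
  ultimately show ?thesis by (simp add: closed_Int closed_INT)
qed

text \<open>The polar cone contains 0, so its span is its affine hull. This opens the theory of
  relative interiors of convex sets.\<close>

lemma Int_polar_eq_rel_interior: "Int_polar P = rel_interior (polar_cone P)"
proof -
  have "affine hull polar_cone P = span (polar_cone P)"
    by (intro affine_hull_span_0 hull_inc zero_in_polar_cone)
  then show ?thesis by (simp add: Int_polar_def interior_of_def rel_interior_def)
qed

text \<open>A relative interior point \<open>A0\<close> pulls every element of the polar cone into
  the relative interior, where ellipticity applies. This is how degenerate matrices are approximated
  by definite ones.\<close>

lemma elliptic_coneE:
  assumes "elliptic_cone P"
  obtains A0 where "A0 \<in> polar_cone P" "positive_definite A0"
    "\<forall>A\<in>polar_cone P. \<forall>t>0. positive_definite (A + t *\<^sub>R A0)"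
proof -
  have pd: "positive_definite A" if "A \<in> rel_interior (polar_cone P)" for A
    using assms that by (simp add: elliptic_cone_def Int_polar_eq_rel_interior)
  have "rel_interior (polar_cone P) \<noteq> {}"
    using rel_interior_eq_empty[OF convex_polar_cone] zero_in_polar_cone by blast
  then obtain A0 where A0: "A0 \<in> rel_interior (polar_cone P)" by blast
  have "positive_definite (A + t *\<^sub>R A0)" if A: "A \<in> polar_cone P" "0 < t" for A t
  proof -
    \<comment> \<open>With this \<open>e\<close> the convex combination
      \<open>(1 - e) A + e A0\<close> is \<open>(1 - e)\<close> times
      \<open>A + t A0\<close>.\<close>
    define e where "e = t / (1 + t)"
    have e: "0 < e" "e \<le> 1" "e = t * (1 - e)" "0 < 1 - e" using A(2) by (auto simp: e_def field_simps)
    have "A - e *\<^sub>R (A - A0) \<in> rel_interior (polar_cone P)"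
      by (rule rel_interior_convex_shrink[OF convex_polar_cone A0 A(1) e(1,2)])
    moreover have "(1 - e) *\<^sub>R (A + t *\<^sub>R A0) = (1 - e) *\<^sub>R A + e *\<^sub>R A0"
      unfolding scaleR_add_right scaleR_scaleR mult.commute[of "1 - e"] e(3)[symmetric] ..
    moreover have "A - e *\<^sub>R (A - A0) = (1 - e) *\<^sub>R A + e *\<^sub>R A0"
      by (simp add: algebra_simps)
    ultimately have pd': "positive_definite ((1 - e) *\<^sub>R (A + t *\<^sub>R A0))" using pd by metis
    have "0 < ((A + t *\<^sub>R A0) *v x) \<bullet> x" if "x \<noteq> 0" for x
    proof -
      have "0 < (((1 - e) *\<^sub>R (A + t *\<^sub>R A0)) *v x) \<bullet> x" using pd' that unfolding positive_definite_def by blast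
      also have "\<dots> = (1 - e) * (((A + t *\<^sub>R A0) *v x) \<bullet> x)"
        by (simp only: scaleR_matrix_vector_assoc[symmetric] inner_scaleR_left)
      finally show ?thesis using e(4) by (simp add: zero_less_mult_iff)
    qed
    moreover have "A + t *\<^sub>R A0 \<in> polar_cone P"
      using A A0 rel_interior_subset by (intro polar_cone_add polar_cone_scaleR) auto
    then have "transpose (A + t *\<^sub>R A0) = A + t *\<^sub>R A0" by (simp add: polar_cone_def Sym2_UNIV)
    ultimately show ?thesis by (simp add: positive_definite_def)
  qed
  then have "\<forall>A\<in>polar_cone P. \<forall>t>0. positive_definite (A + t *\<^sub>R A0)" by blast
  moreover have "A0 \<in> polar_cone P" using A0 rel_interior_subset by blast
  ultimately show ?thesis using that pd[OF A0] by blast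
qed

text \<open>Limit of the positive definite matrices \<open>A + t A0\<close> as \<open>t\<close>
  tends to 0.\<close>

lemma polar_cone_psd:
  assumes "elliptic_cone P" "A \<in> polar_cone P"
  shows "0 \<le> (A *v x) \<bullet> x"
proof (cases "x = 0")
  case False
  obtain A0 where A0: "A0 \<in> polar_cone P" "positive_definite A0"
    "\<forall>A\<in>polar_cone P. \<forall>t>0. positive_definite (A + t *\<^sub>R A0)"
    by (rule elliptic_coneE[OF assms(1)])
  have "0 \<le> (A *v x) \<bullet> x + t * ((A0 *v x) \<bullet> x)" if "0 < t" for t
  proof -
    have "0 < ((A + t *\<^sub>R A0) *v x) \<bullet> x"
      using A0(3) assms(2) that False unfolding positive_definite_def by blast
    then show ?thesis
      by (simp add: matrix_vector_mult_add_rdistrib inner_add_left flip: scaleR_matrix_vector_assoc)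
  qed
  then have "((\<lambda>t. (A *v x) \<bullet> x + t * ((A0 *v x) \<bullet> x)) \<longlongrightarrow> (A *v x) \<bullet> x + 0 * ((A0 *v x) \<bullet> x)) (at_right 0)"
    by (intro tendsto_intros)
  moreover have "eventually (\<lambda>t. 0 \<le> (A *v x) \<bullet> x + t * ((A0 *v x) \<bullet> x)) (at_right 0)"
    using \<open>\<And>t. 0 < t \<Longrightarrow> 0 \<le> (A *v x) \<bullet> x + t * ((A0 *v x) \<bullet> x)\<close>
    by (auto simp: eventually_at_filter)
  ultimately have "0 \<le> (A *v x) \<bullet> x + 0 * ((A0 *v x) \<bullet> x)"
    by (rule tendsto_lowerbound) simp
  then show ?thesis by simp
qed simp

text \<open>\<open>Q\<close> is the inverse of \<open>A\<close> divided by the minimum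
  \<open>m\<close> of its quadratic form on the unit sphere, which gives \<open>Q_ge\<close>;
  multiplying \<open>A\<close> by \<open>m\<close> restores the inverse relation. A positive factor
  does not lead out of the polar cone.\<close>

lemma positive_definite_elliptic_kernel:
  fixes A :: "real^'n::finite^'n"
  assumes "positive_definite A"
  obtains c Q where "0 < c" "elliptic_kernel (c *\<^sub>R A) Q"
proof -
  have sym: "transpose A = A" and pos: "\<And>x. x \<noteq> 0 \<Longrightarrow> 0 < (A *v x) \<bullet> x"
    using assms by (auto simp: positive_definite_def)
  have "x = 0" if "A *v x = 0" for x using pos[of x] that by auto
  then obtain B where BA: "B ** A = mat 1" using matrix_left_invertible_ker[of A] by blast
  then have AB: "A ** B = mat 1" using matrix_left_right_inverse by blast
  have "transpose B ** A = mat 1"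
    using arg_cong[OF AB, of transpose] sym by (simp add: matrix_transpose_mul transpose_mat)
  then have "transpose B ** (A ** B) = B" by (simp add: matrix_mul_assoc)
  then have symB: "transpose B = B" by (simp add: AB)
  have posB: "0 < (B *v y) \<bullet> y" if "y \<noteq> 0" for y
  proof -
    have y: "A *v (B *v y) = y" by (simp add: matrix_vector_mul_assoc AB)
    then have "B *v y \<noteq> 0" using that by auto
    from pos[OF this] show ?thesis by (simp add: y inner_commute)
  qed
  have "continuous_on (sphere 0 1) (\<lambda>y. (B *v y) \<bullet> y)"
    by (intro continuous_on_inner bounded_linear.continuous_on[OF matrix_vector_mul_bounded_linear] continuous_on_id)
  moreover have "axis (undefined::'n) 1 \<in> sphere (0::real^'n) 1" by simp
  then have "sphere (0::real^'n) 1 \<noteq> {}" by blast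
  ultimately have "\<exists>y0\<in>sphere 0 1. \<forall>y\<in>sphere 0 1. (B *v y0) \<bullet> y0 \<le> (B *v y) \<bullet> y"
    by (intro continuous_attains_inf compact_sphere)
  then obtain y0 where y0: "y0 \<in> sphere 0 1" "\<And>y. y \<in> sphere 0 1 \<Longrightarrow> (B *v y0) \<bullet> y0 \<le> (B *v y) \<bullet> y"
    by blast
  define m where "m = (B *v y0) \<bullet> y0"
  have m: "0 < m" unfolding m_def using y0(1) by (intro posB) auto
  have "(norm y)\<^sup>2 \<le> (((1 / m) *\<^sub>R B) *v y) \<bullet> y" for y
  proof (cases "y = 0")
    case False
    have "m \<le> (B *v ((1 / norm y) *\<^sub>R y)) \<bullet> ((1 / norm y) *\<^sub>R y)"
      unfolding m_def using False by (intro y0(2)) simp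
    also have "\<dots> = (B *v y) \<bullet> y / (norm y)\<^sup>2"
      by (simp add: matrix_vector_mult_scaleR power2_eq_square)
    finally have "m * (norm y)\<^sup>2 \<le> (B *v y) \<bullet> y" using False by (simp add: pos_le_divide_eq)
    then have "(norm y)\<^sup>2 \<le> (B *v y) \<bullet> y / m" using m by (simp add: pos_le_divide_eq mult.commute)
    also have "\<dots> = (((1 / m) *\<^sub>R B) *v y) \<bullet> y"
      by (simp flip: scaleR_matrix_vector_assoc)
    finally show ?thesis .
  qed simp
  moreover have "(m *\<^sub>R A) ** ((1 / m) *\<^sub>R B) = A ** B"
    using m by (simp add: matrix_matrix_mult_def vec_eq_iff)
  then have "(m *\<^sub>R A) ** ((1 / m) *\<^sub>R B) = mat 1" unfolding AB .
  ultimately have "elliptic_kernel (m *\<^sub>R A) ((1 / m) *\<^sub>R B)"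
    using sym symB by (simp add: elliptic_kernel_def transpose_add_scaleR)
  then show ?thesis using that m by blast
qed

subsection \<open>The local mean value inequality\<close>

text \<open>\<open>mean\<close> depends on \<open>Q\<close> alone, so \<open>A\<close> is not a
  parameter. One \<open>r0\<close> for all points of a compact set is what allows the inequality to
  be integrated against a test function and to be localised and glued.\<close>

definition locally_submean :: "(real^'n) set \<Rightarrow> real^'n^'n \<Rightarrow> (real^'n::finite \<Rightarrow> real) \<Rightarrow> bool" where
  "locally_submean X Q f \<longleftrightarrow> (\<forall>K. compact K \<and> K \<subseteq> X \<longrightarrow>
     (\<exists>r0>0. \<forall>x\<in>K. \<forall>r. 0 < r \<and> r < r0 \<longrightarrow> f x \<le> elliptic_kernel.mean Q r f x))"

lemma locally_submeanD:
  assumes "locally_submean X Q f" "compact K" "K \<subseteq> X"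
  obtains r0 where "r0 > 0" "\<And>x r. x \<in> K \<Longrightarrow> 0 < r \<Longrightarrow> r < r0 \<Longrightarrow> f x \<le> elliptic_kernel.mean Q r f x"
  using assms unfolding locally_submean_def by meson

lemma compact_cball_radius:
  fixes K X :: "'a::euclidean_space set"
  assumes "compact K" "open X" "K \<subseteq> X"
  obtains e where "e > 0" "\<And>x r. x \<in> K \<Longrightarrow> r < e \<Longrightarrow> cball x r \<subseteq> X"
proof -
  obtain e where e: "e > 0" "(\<Union>x\<in>K. ball x e) \<subseteq> X"
    using compact_subset_open_imp_ball_epsilon_subset[OF assms] by blast
  have "cball x r \<subseteq> X" if "x \<in> K" "r < e" for x r
  proof -
    have "cball x r \<subseteq> ball x e" using that(2) by auto
    then show ?thesis using e(2) that(1) by blast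
  qed
  with e(1) show ?thesis by (rule that)
qed

context elliptic_kernel
begin

lemma mean_mono:
  assumes "F \<in> borel_measurable borel" "\<And>z. \<bar>F z\<bar> \<le> B" "G \<in> borel_measurable borel" "\<And>z. \<bar>G z\<bar> \<le> C"
    and "0 < r" "\<And>z. z \<in> cball x r \<Longrightarrow> F z \<le> G z"
  shows "mean r F x \<le> mean r G x"
  unfolding mean_def
proof (rule integral_mono)
  show "integrable lborel (\<lambda>y. F (x + r *\<^sub>R y) * \<kappa> y)" by (rule integrable_mean_bounded[OF assms(1,2)])
  show "integrable lborel (\<lambda>y. G (x + r *\<^sub>R y) * \<kappa> y)" by (rule integrable_mean_bounded[OF assms(3,4)])
  show "F (x + r *\<^sub>R y) * \<kappa> y \<le> G (x + r *\<^sub>R y) * \<kappa> y" for y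
    using assms(5) by (intro mult_\<kappa>_mono assms(6)) (simp add: dist_norm mult_left_le)
qed

lemma mean_const: "mean r (\<lambda>_. c) x = c"
  by (simp add: mean_def integral_\<kappa>)

lemma integrable_cball_bounded:
  assumes "g \<in> borel_measurable borel" "\<And>z. \<bar>g z\<bar> \<le> B"
  shows "integrable lborel (\<lambda>z::real^'n. indicator (cball x r) z * g z :: real)"
  by (rule integrable_mult_bounded[OF integrable_indicator_bounded assms]) auto

lemma locally_submean_cong:
  assumes "open X" "\<And>x. x \<in> X \<Longrightarrow> f x = g x" "locally_submean X Q f"
  shows "locally_submean X Q g"
  unfolding locally_submean_def
proof (intro allI impI)
  fix K assume K: "compact K \<and> K \<subseteq> X"
  obtain r1 where r1: "r1 > 0" "\<And>x r. x \<in> K \<Longrightarrow> 0 < r \<Longrightarrow> r < r1 \<Longrightarrow> f x \<le> mean r f x"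
    using locally_submeanD[OF assms(3)] K by blast
  obtain r2 where r2: "r2 > 0" "\<And>x r. x \<in> K \<Longrightarrow> r < r2 \<Longrightarrow> cball x r \<subseteq> X"
    using compact_cball_radius[of K X] K assms(1) by blast
  have "g x \<le> mean r g x" if x: "x \<in> K" and r: "0 < r" "r < min r1 r2" for x r
  proof -
    have "mean r f x = mean r g x"
      using r2(2)[OF x, of r] r by (intro mean_cong assms(2)) auto
    then show ?thesis using r1(2)[OF x, of r] r assms(2)[of x] x K by auto
  qed
  then show "\<exists>r0>0. \<forall>x\<in>K. \<forall>r. 0 < r \<and> r < r0 \<longrightarrow> g x \<le> mean r g x"
    using r1(1) r2(1) by (intro exI[of _ "min r1 r2"]) auto
qed

lemma locally_submean_quadratic:
  assumes "0 \<le> sym_inner B A"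
  shows "locally_submean X Q (\<lambda>x. (B *v x) \<bullet> x + b \<bullet> x + c)"
  unfolding locally_submean_def
proof (intro allI impI exI[of _ 1] conjI ballI)
  fix x r
  have "0 \<le> r\<^sup>2 * moment * sym_inner B A"
    using assms moment_pos by simp
  then show "(B *v x) \<bullet> x + b \<bullet> x + c \<le> mean r (\<lambda>x. (B *v x) \<bullet> x + b \<bullet> x + c) x"
    by (simp add: mean_quadratic)
qed simp

lemma locally_submean_const: "locally_submean X Q (\<lambda>x. c)"
  unfolding locally_submean_def by (auto simp: mean_const intro: exI[of _ 1])

lemma C2_less_mean:
  assumes "open X" "Ck_on 2 X h" "\<And>x. x \<in> X \<Longrightarrow> 0 < sym_inner (Hess h x) A"
    and K: "compact K" "K \<subseteq> X"
  shows "\<exists>r0>0. \<forall>x\<in>K. \<forall>r. 0 < r \<and> r < r0 \<longrightarrow> cball x r \<subseteq> X \<and> h x < mean r h x"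
proof (cases "K = {}")
  case True
  then show ?thesis by (auto intro: exI[of _ 1])
next
  case False
  have "continuous_on K (\<lambda>x. sym_inner (Hess h x) A)"
    using continuous_on_subset[OF continuous_on_Hess[OF assms(2)] K(2)] by (intro continuous_intros)
  then obtain x0 where x0: "x0 \<in> K" "\<And>x. x \<in> K \<Longrightarrow> sym_inner (Hess h x0) A \<le> sym_inner (Hess h x) A"
    using continuous_attains_inf[OF K(1) False] by blast
  \<comment> \<open>Half of the least second-order coefficient in \<open>mean_Taylor\<close> over
    \<open>K\<close>, so the Taylor error consumes at most half of the gain.\<close>
  define \<epsilon> where "\<epsilon> = moment * sym_inner (Hess h x0) A / 4"
  have \<epsilon>: "\<epsilon> > 0" using assms(3)[of x0] x0(1) K(2) moment_pos by (auto simp: \<epsilon>_def)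
  obtain r0 where r0: "r0 > 0" and T: "\<And>x r. x \<in> K \<Longrightarrow> 0 < r \<Longrightarrow> r < r0 \<Longrightarrow> cball x r \<subseteq> X \<and>
    \<bar>mean r h x - h x - r\<^sup>2 * (moment * sym_inner (Hess h x) A / 2)\<bar> \<le> \<epsilon> * r\<^sup>2"
    using mean_Taylor[OF assms(1,2) K \<epsilon>] by blast
  have "cball x r \<subseteq> X \<and> h x < mean r h x" if x: "x \<in> K" and r: "0 < r" "r < r0" for x r
  proof -
    have "2 * \<epsilon> \<le> moment * sym_inner (Hess h x) A / 2"
      using mult_left_mono[OF x0(2)[OF x], of moment] moment_pos by (simp add: \<epsilon>_def)
    then have "r\<^sup>2 * (2 * \<epsilon>) \<le> r\<^sup>2 * (moment * sym_inner (Hess h x) A / 2)"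
      by (rule mult_left_mono) simp
    moreover have "r\<^sup>2 * (2 * \<epsilon>) = 2 * (\<epsilon> * r\<^sup>2)" by simp
    moreover have "0 < \<epsilon> * r\<^sup>2" using \<epsilon> r(1) by simp
    moreover have "- (mean r h x - h x - r\<^sup>2 * (moment * sym_inner (Hess h x) A / 2)) \<le> \<epsilon> * r\<^sup>2"
      using T[OF x r] abs_le_iff by blast
    ultimately have "h x < mean r h x" by linarith
    then show ?thesis using T[OF x r] by blast
  qed
  with r0 show ?thesis by blast
qed

lemma locally_submean_C2:
  assumes "open X" "Ck_on 2 X h" "\<And>x. x \<in> X \<Longrightarrow> 0 < sym_inner (Hess h x) A"
  shows "locally_submean X Q h"
  unfolding locally_submean_def using C2_less_mean[OF assms] by (meson less_imp_le)

text \<open>If the ball of radius \<open>\<eta>/2\<close> about \<open>x\<close> lies in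
  \<open>D\<close>, both inequalities pass to the maximum for small radii. Otherwise
  \<open>le\<close> makes the glued function equal to \<open>a\<close> at \<open>x\<close>, and it
  is at least \<open>a\<close> everywhere. The margin makes the points of the first kind in
  \<open>K\<close> a compact subset of \<open>X \<inter> D\<close>, which keeps the radii
  uniform.\<close>

lemma locally_submean_glue:
  assumes X: "open X" and D: "open D" and \<eta>: "\<eta> > 0"
    and a: "a \<in> borel_measurable borel" "\<And>x. \<bar>a x\<bar> \<le> B" "locally_submean X Q a"
    and b: "b \<in> borel_measurable borel" "\<And>x. \<bar>b x\<bar> \<le> C" "locally_submean (X \<inter> D) Q b"
    and le: "\<And>x. x \<in> X \<Longrightarrow> x \<in> D \<Longrightarrow> \<not> ball x \<eta> \<subseteq> D \<Longrightarrow> b x \<le> a x"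
  shows "locally_submean X Q (\<lambda>x. if x \<in> D then max (a x) (b x) else a x)" (is "locally_submean X Q ?g")
  unfolding locally_submean_def
proof (intro allI impI)
  fix K assume K: "compact K \<and> K \<subseteq> X"
  have [measurable]: "a \<in> borel_measurable borel" "b \<in> borel_measurable borel" "D \<in> sets borel"
    using a b D by auto
  have gm: "?g \<in> borel_measurable borel" by measurable
  have gb: "\<bar>?g x\<bar> \<le> max B C" for x using a(2)[of x] b(2)[of x] by (auto simp: max_def)
  define K' where "K' = K \<inter> {x. ball x (\<eta>/2) \<subseteq> D}"
  have "closed {x. ball x (\<eta>/2) \<subseteq> D}"
  proof -
    have "{x. ball x (\<eta>/2) \<subseteq> D} = (\<Inter>z\<in>-D. - ball z (\<eta>/2))" by (auto simp: dist_commute)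
    moreover have "closed (\<Inter>z\<in>-D. - ball z (\<eta>/2))" by (intro closed_INT ballI closed_Compl open_ball)
    ultimately show ?thesis by simp
  qed
  then have K': "compact K'" "K' \<subseteq> X \<inter> D"
    using K \<eta> unfolding K'_def by (auto intro: compact_Int_closed)
  obtain r1 where r1: "r1 > 0" "\<And>x r. x \<in> K \<Longrightarrow> 0 < r \<Longrightarrow> r < r1 \<Longrightarrow> a x \<le> mean r a x"
    using locally_submeanD[OF a(3)] K by blast
  obtain r2 where r2: "r2 > 0" "\<And>x r. x \<in> K' \<Longrightarrow> 0 < r \<Longrightarrow> r < r2 \<Longrightarrow> b x \<le> mean r b x"
    using locally_submeanD[OF b(3) K'] by blast
  obtain r3 where r3: "r3 > 0" "\<And>x r. x \<in> K \<Longrightarrow> r < r3 \<Longrightarrow> cball x r \<subseteq> X"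
    using compact_cball_radius[of K X] K X by blast
  define r0 where "r0 = Min {r1, r2, r3, \<eta>/2}"
  have r0: "r0 > 0" "r0 \<le> r1" "r0 \<le> r2" "r0 \<le> r3" "r0 \<le> \<eta>/2"
    using r1 r2 r3 \<eta> by (auto simp: r0_def)
  have "?g x \<le> mean r ?g x" if x: "x \<in> K" and r: "0 < r" "r < r0" for x r
  proof -
    have "a x \<le> mean r a x" using r1(2)[OF x r(1)] r(2) r0 by simp
    also have "\<dots> \<le> mean r ?g x"
      by (rule mean_mono[OF a(1,2) gm gb r(1)]) auto
    finally have ax: "a x \<le> mean r ?g x" .
    show ?thesis
    proof (cases "x \<in> K'")
      case True
      have "b x \<le> mean r b x" using r2(2)[OF True r(1)] r(2) r0 by simp
      also have "\<dots> \<le> mean r ?g x"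
      proof (rule mean_mono[OF b(1,2) gm gb r(1)])
        fix z assume "z \<in> cball x r"
        then have "z \<in> ball x (\<eta>/2)" using r(2) r0 by auto
        then have "z \<in> D" using True unfolding K'_def by blast
        then show "b z \<le> ?g z" by simp
      qed
      finally show ?thesis using ax by auto
    next
      case False
      then have "\<not> ball x (\<eta>/2) \<subseteq> D" using x unfolding K'_def by blast
      then obtain z where "z \<notin> D" "z \<in> ball x (\<eta>/2)" by blast
      then have z: "z \<notin> D" "dist x z < \<eta>/2" by auto
      have "?g x = a x"
      proof (cases "x \<in> D")
        case True
        moreover have "z \<in> ball x \<eta>" using z(2) \<eta> by auto
        ultimately have "b x \<le> a x" using le[of x] x K z(1) by blast
        then show ?thesis by simp
      qed simp
      then show ?thesis using ax by simp
    qed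
  qed
  then show "\<exists>r0>0. \<forall>x\<in>K. \<forall>r. 0 < r \<and> r < r0 \<longrightarrow> ?g x \<le> mean r ?g x"
    using r0(1) by blast
qed

end

subsection \<open>Upper semi-continuous functions\<close>

lemma usc_on_cong:
  assumes "\<And>x. x \<in> S \<Longrightarrow> u x = v x" "usc_on S u"
  shows "usc_on S v"
  unfolding usc_on_def
proof (intro ballI conjI allI impI)
  fix x c assume x: "x \<in> S"
  then show "v x < \<infinity>" using assms by (auto simp: usc_on_def)
  assume "v x < c"
  then have "\<forall>\<^sub>F y in at x within S. u y < c" using assms x by (auto simp: usc_on_def)
  moreover have "\<forall>\<^sub>F y in at x within S. y \<in> S" by (auto simp: eventually_at_filter)
  ultimately show "\<forall>\<^sub>F y in at x within S. v y < c"
    by eventually_elim (use assms(1) in auto)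
qed

lemma usc_on_continuous:
  assumes "continuous_on S f"
  shows "usc_on S (\<lambda>x. ereal (f x))"
  unfolding usc_on_def
proof (intro ballI conjI allI impI)
  fix x c assume x: "x \<in> S" "ereal (f x) < c"
  have "((\<lambda>y. ereal (f y)) \<longlongrightarrow> ereal (f x)) (at x within S)"
    using assms x(1) by (auto simp: continuous_on_def intro!: tendsto_intros)
  then show "\<forall>\<^sub>F y in at x within S. ereal (f y) < c" using x(2) by (rule order_tendstoD)
qed simp

lemma usc_on_max:
  assumes "usc_on S u" "usc_on S v"
  shows "usc_on S (\<lambda>x. max (u x) (v x))"
  unfolding usc_on_def
proof (intro ballI conjI allI impI)
  fix x c assume x: "x \<in> S"
  then show "max (u x) (v x) < \<infinity>" using assms by (auto simp: usc_on_def max_def)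
  assume "max (u x) (v x) < c"
  then have "\<forall>\<^sub>F y in at x within S. u y < c" "\<forall>\<^sub>F y in at x within S. v y < c"
    using assms x by (auto simp: usc_on_def)
  then show "\<forall>\<^sub>F y in at x within S. max (u y) (v y) < c" by eventually_elim simp
qed

lemma usc_on_locally:
  assumes "\<And>x. x \<in> S \<Longrightarrow> \<exists>N. open N \<and> x \<in> N \<and> usc_on (S \<inter> N) u"
  shows "usc_on S u"
  unfolding usc_on_def
proof (intro ballI conjI allI impI)
  fix x c assume x: "x \<in> S"
  obtain N where N: "open N" "x \<in> N" "usc_on (S \<inter> N) u" using assms[OF x] by blast
  then show "u x < \<infinity>" using x by (auto simp: usc_on_def)
  assume "u x < c"
  then have "\<forall>\<^sub>F y in at x within (S \<inter> N). u y < c" using N x by (auto simp: usc_on_def)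
  then show "\<forall>\<^sub>F y in at x within S. u y < c"
    using at_within_nhd[OF N(2,1), of "S \<inter> N" S] by (simp add: Int_assoc)
qed

lemma usc_on_add_continuous:
  assumes "usc_on S v" "continuous_on S h"
  shows "usc_on S (\<lambda>x. v x + ereal (h x))"
  unfolding usc_on_def
proof (intro ballI conjI allI impI)
  fix x c assume x: "x \<in> S"
  then have fin: "v x < \<infinity>" using assms(1) by (auto simp: usc_on_def)
  then show "v x + ereal (h x) < \<infinity>" by (cases "v x") auto
  assume c: "v x + ereal (h x) < c"
  then have "v x < c - ereal (h x)" by (cases "v x"; cases c) auto
  then obtain e where e: "v x < ereal e" "ereal e < c - ereal (h x)" using ereal_dense2 by blast
  then have "ereal (h x) < c - ereal e" by (cases c) auto
  moreover have "((\<lambda>y. ereal (h y)) \<longlongrightarrow> ereal (h x)) (at x within S)"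
    using assms(2) x by (auto simp: continuous_on_def intro!: tendsto_intros)
  ultimately have "\<forall>\<^sub>F y in at x within S. ereal (h y) < c - ereal e" by (intro order_tendstoD(2))
  moreover have "\<forall>\<^sub>F y in at x within S. v y < ereal e" using assms(1) x e(1) by (auto simp: usc_on_def)
  ultimately show "\<forall>\<^sub>F y in at x within S. v y + ereal (h y) < c"
  proof eventually_elim
    case (elim y)
    then show ?case by (cases "v y"; cases c) auto
  qed
qed

lemma usc_on_attains_max:
  assumes "compact S" "S \<noteq> {}" "usc_on S w"
  obtains x where "x \<in> S" "\<And>y. y \<in> S \<Longrightarrow> w y \<le> w x"
proof -
  have "\<exists>x\<in>S. \<forall>y\<in>S. w y \<le> w x"
  proof (rule ccontr)
    assume "\<not> ?thesis"
    then have no: "\<exists>y\<in>S. w x < w y" if "x \<in> S" for x using that by (meson not_le)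
    have "\<forall>y. \<exists>U. open U \<and> {x\<in>S. w x < w y} = S \<inter> U" using usc_on_sublevel[OF assms(3)] by blast
    then obtain U where U: "\<And>y. open (U y)" "\<And>y. {x\<in>S. w x < w y} = S \<inter> U y" by metis
    have "S \<subseteq> (\<Union>y\<in>S. U y)" using no U(2) by blast
    then obtain T where T: "T \<subseteq> S" "finite T" "S \<subseteq> (\<Union>y\<in>T. U y)"
      using compactE_image[OF assms(1), of S U] U(1) by blast
    have "T \<noteq> {}" using T(3) assms(2) by auto
    then have "Max (w ` T) \<in> w ` T" using T(2) by (intro Max_in) auto
    then obtain y where "y \<in> T" "w y = Max (w ` T)" by auto
    then have y: "y \<in> T" "\<And>z. z \<in> T \<Longrightarrow> w z \<le> w y" using T(2) by simp_all
    then obtain z where "z \<in> T" "y \<in> U z" using T by blast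
    then have "w y < w z" using U(2)[of z] y(1) T(1) by blast
    then show False using y(2)[OF \<open>z \<in> T\<close>] by simp
  qed
  then show ?thesis using that by blast
qed

section \<open>Back to distributions, and the maximum principle\<close>

context elliptic_kernel
begin

text \<open>Integrating \<open>mean r f - f \<ge> 0\<close> against \<open>\<psi>\<close> and moving
  the mean to \<open>\<psi>\<close> by \<open>mean_adjoint\<close> leaves
  \<open>mean r \<psi> - \<psi>\<close>, which \<open>mean_Taylor\<close> expands. Division by
  \<open>r\<^sup>2\<close> and \<open>\<epsilon>\<close> tending to 0 finish the proof.\<close>

lemma distr_Laplacian_nonneg:
  assumes X: "open X" and f: "f \<in> borel_measurable borel" "\<And>x. \<bar>f x\<bar> \<le> B" "locally_submean X Q f"
    and u: "\<And>x. x \<in> X \<Longrightarrow> u x = ereal (f x)"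
    and \<psi>: "\<psi> \<in> test_functions X" "\<And>x. 0 \<le> \<psi> x"
  shows "0 \<le> distr_Laplacian A (distr_of X u) \<psi>"
proof -
  define K where "K = closure {x. \<psi> x \<noteq> 0}"
  have K: "compact K" "K \<subseteq> X" and C2: "Ck_on 2 UNIV \<psi>"
    using \<psi>(1) by (auto simp: test_functions_def smooth_on_def K_def)
  have \<psi>0: "\<psi> x = 0" if "x \<notin> K" for x
    using that subsetD[OF closure_subset, of x "{x. \<psi> x \<noteq> 0}"] unfolding K_def by blast
  have c\<psi>: "continuous_on S \<psi>" for S
    using Ck_on_continuous[OF C2] continuous_on_subset by blast
  have [measurable]: "\<psi> \<in> borel_measurable borel" "f \<in> borel_measurable borel"
    using c\<psi> f(1) by (auto intro: borel_measurable_continuous_onI)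
  have "bounded (\<psi> ` K)" by (intro compact_imp_bounded compact_continuous_image c\<psi> K)
  then obtain M where M: "M > 0" "\<And>x. x \<in> K \<Longrightarrow> \<bar>\<psi> x\<bar> \<le> M" by (auto simp: bounded_pos)
  have \<psi>M: "\<bar>\<psi> x\<bar> \<le> M" for x using M \<psi>0[of x] by (cases "x \<in> K") auto
  obtain e where e: "e > 0" "compact {x + y |x y. x \<in> K \<and> y \<in> cball 0 e}"
    "{x + y |x y. x \<in> K \<and> y \<in> cball 0 e} \<subseteq> X"
    by (rule compact_cball_neighbourhood[OF K(1) X K(2)])
  \<comment> \<open>Balls of radius at most \<open>e\<close> about points of \<open>K\<close> stay
    in \<open>K'\<close>, so cutting \<open>f\<close> off outside \<open>K'\<close> does not change
    its means on the support of \<open>\<psi>\<close>.\<close>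
  define K' where "K' = {x + y |x y. x \<in> K \<and> y \<in> cball 0 e}"
  have K': "compact K'" "K' \<subseteq> X" using e by (simp_all add: K'_def)
  have ball_K': "z \<in> K'" if "x \<in> K" "dist x z \<le> e" for x z
  proof -
    have "z = x + (z - x)" "z - x \<in> cball 0 e" using that(2) by (auto simp: dist_norm norm_minus_commute)
    then show ?thesis using that(1) unfolding K'_def by blast
  qed
  have KK': "K \<subseteq> K'" using ball_K'[of _ _] e(1) by force
  define F where "F z = indicator K' z * f z" for z
  have [measurable]: "K' \<in> sets borel" using K'(1) by (rule borel_compact)
  have F: "integrable lborel F"
    unfolding F_def
    by (rule integrable_mult_bounded[OF integrable_indicator_bounded f(1,2)])
      (simp_all add: compact_imp_bounded K'(1))
  have F_eq: "F z = f z" if "z \<in> K'" for z using that by (simp add: F_def)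
  define D where "D = (\<integral>z. F z * sym_inner (Hess \<psi> z) A \<partial>lborel)"
  have Fu: "F x = real_of_ereal (u x)" if "x \<in> K'" for x
    using that u K'(2) F_eq by auto
  have supp: "closure {x. \<psi> x \<noteq> 0} \<subseteq> K'" using KK' unfolding K_def .
  note L = distr_Laplacian_distr_of[OF A_sym \<psi>(1) supp K'(2) F Fu]
  obtain r1 where r1: "r1 > 0" "\<And>x r. x \<in> K \<Longrightarrow> 0 < r \<Longrightarrow> r < r1 \<Longrightarrow> f x \<le> mean r f x"
    using locally_submeanD[OF f(3) K] by blast
  have "0 \<le> moment / 2 * D + \<epsilon> * (\<integral>z. \<bar>F z\<bar> \<partial>lborel)" if \<epsilon>: "\<epsilon> > 0" for \<epsilon>
  proof -
    obtain r2 where r2: "r2 > 0" and T: "\<And>x r. x \<in> K' \<Longrightarrow> 0 < r \<Longrightarrow> r < r2 \<Longrightarrow>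
      \<bar>mean r \<psi> x - \<psi> x - r\<^sup>2 * (moment * sym_inner (Hess \<psi> x) A / 2)\<bar> \<le> \<epsilon> * r\<^sup>2"
      using mean_Taylor[OF open_UNIV C2 K'(1) _ \<epsilon>] by blast
    define r where "r = Min {r1, r2, e} / 2"
    have r: "0 < r" "r < r1" "r < r2" "r \<le> e"
      using r1(1) r2 e(1) by (auto simp: r_def min_def)
    have i1: "integrable lborel (\<lambda>x. \<psi> x * mean r F x)"
      by (rule integrable_lborel_compact_support[OF K(1)])
        (auto intro!: continuous_intros c\<psi> continuous_on_subset[OF continuous_on_mean[OF F r(1)]] simp: \<psi>0)
    have i2: "integrable lborel (\<lambda>x. F x * \<psi> x)"
      by (rule integrable_mult_bounded[OF F _ \<psi>M]) measurable
    have "integrable lborel \<psi>"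
      by (rule integrable_lborel_compact_support[OF K(1) c\<psi> \<psi>0])
    then have "continuous_on UNIV (mean r \<psi>)" using r(1) by (rule continuous_on_mean)
    then have [measurable]: "mean r \<psi> \<in> borel_measurable borel" by (rule borel_measurable_continuous_onI)
    have i3: "integrable lborel (\<lambda>x. F x * mean r \<psi> x)"
      by (rule integrable_mult_bounded[OF F _ abs_mean_le[OF _ \<psi>M]]) measurable
    have "0 \<le> (\<integral>x. \<psi> x * mean r F x - F x * \<psi> x \<partial>lborel)"
    proof (rule Bochner_Integration.integral_nonneg)
      fix x
      show "0 \<le> \<psi> x * mean r F x - F x * \<psi> x"
      proof (cases "x \<in> K")
        case True
        have "mean r F x = mean r f x"
          using r(4) by (intro mean_cong[OF r(1)] F_eq ball_K'[OF True]) simp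
        moreover have "F x = f x" using True KK' by (intro F_eq) blast
        ultimately have "F x \<le> mean r F x" using r1(2)[OF True r(1,2)] by simp
        then have "\<psi> x * F x \<le> \<psi> x * mean r F x" using \<psi>(2) by (rule mult_left_mono)
        then show ?thesis by (simp add: mult.commute)
      qed (simp add: \<psi>0)
    qed
    also have "\<dots> = (\<integral>x. \<psi> x * mean r F x \<partial>lborel) - (\<integral>x. F x * \<psi> x \<partial>lborel)"
      by (rule Bochner_Integration.integral_diff[OF i1 i2])
    also have "(\<integral>x. \<psi> x * mean r F x \<partial>lborel) = (\<integral>x. F x * mean r \<psi> x \<partial>lborel)"
      by (rule mean_adjoint[OF F _ \<psi>M]) measurable
    also have "\<dots> - (\<integral>x. F x * \<psi> x \<partial>lborel) = (\<integral>x. F x * mean r \<psi> x - F x * \<psi> x \<partial>lborel)"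
      by (rule Bochner_Integration.integral_diff[OF i3 i2, symmetric])
    also have "\<dots> \<le> (\<integral>x. r\<^sup>2 * (moment / 2) * (F x * sym_inner (Hess \<psi> x) A) + \<epsilon> * r\<^sup>2 * \<bar>F x\<bar> \<partial>lborel)"
    proof (rule integral_mono)
      show "integrable lborel (\<lambda>x. F x * mean r \<psi> x - F x * \<psi> x)"
        by (rule Bochner_Integration.integrable_diff[OF i3 i2])
      show "integrable lborel (\<lambda>x. r\<^sup>2 * (moment / 2) * (F x * sym_inner (Hess \<psi> x) A) + \<epsilon> * r\<^sup>2 * \<bar>F x\<bar>)"
        by (intro Bochner_Integration.integrable_add integrable_mult_right L(2) integrable_abs F)
      fix x
      show "F x * mean r \<psi> x - F x * \<psi> x \<le> r\<^sup>2 * (moment / 2) * (F x * sym_inner (Hess \<psi> x) A) + \<epsilon> * r\<^sup>2 * \<bar>F x\<bar>"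
      proof (cases "x \<in> K'")
        case True
        define E where "E = mean r \<psi> x - \<psi> x - r\<^sup>2 * (moment * sym_inner (Hess \<psi> x) A / 2)"
        have "F x * E \<le> \<bar>F x\<bar> * \<bar>E\<bar>" by (simp flip: abs_mult)
        also have "\<dots> \<le> \<bar>F x\<bar> * (\<epsilon> * r\<^sup>2)"
          using T[OF True r(1,3)] unfolding E_def by (rule mult_left_mono) simp
        finally have "F x * E \<le> \<epsilon> * r\<^sup>2 * \<bar>F x\<bar>" by (simp only: mult.commute)
        moreover have "F x * mean r \<psi> x - F x * \<psi> x = F x * E + r\<^sup>2 * (moment / 2) * (F x * sym_inner (Hess \<psi> x) A)"
          unfolding E_def by (simp add: right_diff_distrib)
        ultimately show ?thesis by linarith
      qed (simp add: F_def)
    qed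
    also have "\<dots> = r\<^sup>2 * (moment / 2) * D + \<epsilon> * r\<^sup>2 * (\<integral>z. \<bar>F z\<bar> \<partial>lborel)"
      unfolding D_def using L(2) F by (subst Bochner_Integration.integral_add) simp_all
    also have "\<dots> = r\<^sup>2 * (moment / 2 * D + \<epsilon> * (\<integral>z. \<bar>F z\<bar> \<partial>lborel))"
      by (simp add: distrib_left)
    finally show ?thesis using r(1) by (simp add: zero_le_mult_iff)
  qed
  then have ev: "eventually (\<lambda>\<epsilon>. 0 \<le> moment / 2 * D + \<epsilon> * (\<integral>z. \<bar>F z\<bar> \<partial>lborel)) (at_right 0)"
    unfolding eventually_at_filter by (intro always_eventually) simp
  have "((\<lambda>\<epsilon>. moment / 2 * D + \<epsilon> * (\<integral>z. \<bar>F z\<bar> \<partial>lborel)) \<longlongrightarrow> moment / 2 * D + 0 * (\<integral>z. \<bar>F z\<bar> \<partial>lborel)) (at_right 0)"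
    by (intro tendsto_intros)
  from tendsto_lowerbound[OF this ev] have "0 \<le> moment / 2 * D + 0 * (\<integral>z. \<bar>F z\<bar> \<partial>lborel)" by simp
  then have "0 \<le> D" using moment_pos by (simp add: zero_le_mult_iff)
  then show ?thesis using L(1) by (simp add: D_def)
qed

text \<open>An almost everywhere bound near \<open>x\<close> bounds the mean over a small ball, and
  that mean bounds \<open>u x\<close>.\<close>

lemma le_ess_limsup:
  assumes X: "open X" and f: "f \<in> borel_measurable borel" "\<And>x. \<bar>f x\<bar> \<le> B" "locally_submean X Q f"
    and u: "\<And>x. x \<in> X \<Longrightarrow> u x = ereal (f x)" and x: "x \<in> X"
  shows "u x \<le> ess_limsup X u x"
  unfolding ess_limsup_def
proof (rule INF_greatest)
  fix \<rho> :: real assume "\<rho> \<in> {0<..}"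
  then have \<rho>: "\<rho> > 0" by simp
  let ?S = "ball x \<rho> \<inter> X"
  have S: "?S \<in> sets lebesgue" using X by auto
  then have S': "?S \<inter> space lebesgue \<in> sets lebesgue" by simp
  show "u x \<le> esssup (lebesgue_on ?S) u"
  proof (rule ereal_le_real)
    fix e assume e: "esssup (lebesgue_on ?S) u \<le> ereal e"
    have "AE z in lebesgue_on ?S. u z \<le> ereal e"
      using esssup_AE[of u "lebesgue_on ?S"] by eventually_elim (use e in order)
    then have "AE z in lebesgue. z \<in> ?S \<longrightarrow> u z \<le> ereal e"
      unfolding AE_restrict_space_iff[OF S'] .
    then have AE: "AE z in lborel. z \<in> ?S \<longrightarrow> u z \<le> ereal e" by (simp add: AE_completion_iff)
    have "compact {x}" "{x} \<subseteq> X" using x by simp_all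
    then obtain r1 where r1: "r1 > 0" "\<And>y r. y \<in> {x} \<Longrightarrow> 0 < r \<Longrightarrow> r < r1 \<Longrightarrow> f y \<le> mean r f y"
      using locally_submeanD[OF f(3)] by blast
    obtain r2 where r2: "r2 > 0" "cball x r2 \<subseteq> X" using X x open_contains_cball by blast
    define r where "r = Min {r1, r2, \<rho>} / 2"
    have r: "0 < r" "r < r1" "r < r2" "r < \<rho>"
      using r1(1) r2(1) \<rho> by (auto simp: r_def min_def)
    have sub: "cball x r \<subseteq> ?S" using r r2(2) by (auto simp: subset_iff)
    have "f x \<le> mean r f x" using r1(2) r by simp
    also have "mean r f x = mean r (\<lambda>z. indicator (cball x r) z * f z) x"
      by (rule mean_cong[OF r(1)]) simp
    also have "\<dots> \<le> mean r (\<lambda>z. indicator (cball x r) z * e) x"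
    proof (rule mean_mono_AE[OF r(1)])
      show "integrable lborel (\<lambda>z. indicator (cball x r) z * f z)" by (rule integrable_cball_bounded[OF f(1,2)])
      show "integrable lborel (\<lambda>z. indicator (cball x r) z * e)"
        by (rule integrable_cball_bounded[of "\<lambda>_. e" "\<bar>e\<bar>"]) auto
      show "AE z in lborel. z \<in> cball x r \<longrightarrow> indicator (cball x r) z * f z \<le> indicator (cball x r) z * e"
        using AE
      proof eventually_elim
        case (elim z)
        show ?case
        proof
          assume z: "z \<in> cball x r"
          then have "z \<in> ?S" using sub by blast
          then have "f z \<le> e" using elim u[of z] by simp
          then show "indicator (cball x r) z * f z \<le> indicator (cball x r) z * e" using z by simp
        qed
      qed
    qed
    also have "\<dots> = mean r (\<lambda>_. e) x" by (rule mean_cong[OF r(1)]) simp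
    also have "\<dots> = e" by (rule mean_const)
    finally show "u x \<le> ereal e" using u[OF x] by simp
  qed
qed

text \<open>At a maximum point \<open>x0\<close> of \<open>v + h\<close> inside \<open>T\<close>,
  with \<open>a = v x0\<close>, the function \<open>v\<close> lies below
  \<open>a + h x0 - h\<close>. Averaging gives \<open>a \<le> a + h x0 - mean r h x0\<close>, which
  contradicts the strict inequality in \<open>C2_less_mean\<close>.\<close>

lemma max_principle:
  assumes A: "A \<in> polar_cone P" and v: "v \<in> PSH P X" and X: "open X"
    and S: "compact S" "usc_on S v" and T: "open T" "T \<subseteq> S" "T \<subseteq> X"
    and h: "continuous_on S h" "Ck_on 2 T h" "\<And>x. x \<in> T \<Longrightarrow> 0 < sym_inner (Hess h x) A"
    and bd: "\<And>x. x \<in> S \<Longrightarrow> x \<notin> T \<Longrightarrow> v x + ereal (h x) \<le> ereal c"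
    and x: "x \<in> S"
  shows "v x + ereal (h x) \<le> ereal c"
proof -
  define w where "w y = v y + ereal (h y)" for y
  have "usc_on S w" unfolding w_def[abs_def] by (rule usc_on_add_continuous[OF S(2) h(1)])
  moreover have "S \<noteq> {}" using x by blast
  ultimately obtain x0 where x0: "x0 \<in> S" "\<And>y. y \<in> S \<Longrightarrow> w y \<le> w x0"
    using usc_on_attains_max[OF S(1)] by blast
  have "w x0 \<le> ereal c"
  proof (rule ccontr)
    assume neg: "\<not> w x0 \<le> ereal c"
    then have T0: "x0 \<in> T" using bd[OF x0(1)] unfolding w_def by blast
    have "v x0 < \<infinity>" using S(2) x0(1) unfolding usc_on_def by blast
    with neg obtain a where a: "v x0 = ereal a" unfolding w_def by (cases "v x0") auto
    obtain r0 where r0: "r0 > 0" and R: "\<And>r. 0 < r \<Longrightarrow> r < r0 \<Longrightarrow> cball x0 r \<subseteq> T \<and> h x0 < mean r h x0"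
      using C2_less_mean[OF T(1) h(2,3), of "{x0}"] T0 by auto
    define r where "r = r0 / 2"
    have r: "0 < r" "cball x0 r \<subseteq> T" "h x0 < mean r h x0" using r0 R[of r] by (auto simp: r_def)
    define G where "G z = indicator (cball x0 r) z *\<^sub>R (a + h x0 - h z)" for z
    have ch: "continuous_on (cball x0 r) h"
      using continuous_on_subset[OF Ck_on_continuous[OF h(2)] r(2)] .
    have "v x0 \<le> ereal (mean r G x0)"
    proof (rule PSH_le_mean[OF A v X r(1)])
      show "cball x0 r \<subseteq> X" using r(2) T(3) by blast
      show "integrable lborel G"
        unfolding G_def by (intro borel_integrable_compact continuous_intros ch) simp
      fix z assume z: "z \<in> cball x0 r"
      then have "w z \<le> w x0" using r(2) T(2) by (intro x0(2)) blast
      then have "v z + ereal (h z) \<le> ereal (a + h x0)" by (simp add: w_def a)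
      then show "v z \<le> ereal (G z)" using z by (cases "v z") (auto simp: G_def)
    qed
    also have "mean r G x0 = mean r (\<lambda>z. a + h x0 - h z) x0"
      by (rule mean_cong[OF r(1)]) (simp add: G_def)
    also have "\<dots> = a + h x0 - mean r h x0"
    proof -
      have "mean r (\<lambda>z. a + h x0 - h z) x0 = (\<integral>y. (a + h x0) * \<kappa> y - h (x0 + r *\<^sub>R y) * \<kappa> y \<partial>lborel)"
        unfolding mean_def by (simp only: left_diff_distrib)
      also have "\<dots> = (\<integral>y. (a + h x0) * \<kappa> y \<partial>lborel) - mean r h x0"
        unfolding mean_def
        by (rule Bochner_Integration.integral_diff[OF integrable_mult_right[OF integrable_\<kappa>_1] integrable_mean_continuous[OF r(1) ch]])
      finally show ?thesis by (simp add: integral_\<kappa>)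
    qed
    finally show False using a r(3) by simp
  qed
  then show ?thesis using x0(2)[OF x] unfolding w_def by order
qed

end

lemma distr_Laplacian_add: "distr_Laplacian (A + B) T \<psi> = distr_Laplacian A T \<psi> + distr_Laplacian B T \<psi>"
  by (simp add: distr_Laplacian_def distrib_left sum.distrib)

lemma distr_Laplacian_scaleR: "distr_Laplacian (c *\<^sub>R A) T \<psi> = c * distr_Laplacian A T \<psi>"
  by (simp add: distr_Laplacian_def sum_distrib_left mult_ac)

lemma ess_limsup_le:
  assumes X: "open X" and u: "usc_on X u" and x: "x \<in> X"
  shows "ess_limsup X u x \<le> u x"
proof (rule dense_ge)
  fix c assume c: "u x < c"
  then have "\<forall>\<^sub>F y in at x within X. u y < c" using u x by (auto simp: usc_on_def)
  then obtain d where d: "d > 0" "\<And>y. y \<in> X \<Longrightarrow> y \<noteq> x \<Longrightarrow> dist y x < d \<Longrightarrow> u y < c"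
    by (auto simp: eventually_at)
  let ?S = "ball x d \<inter> X"
  have S: "?S \<in> sets lebesgue" using X by auto
  have "esssup (lebesgue_on ?S) u \<le> c"
  proof (rule esssup_I)
    show "u \<in> borel_measurable (lebesgue_on ?S)"
      by (rule usc_on_measurable(1)[OF usc_on_subset[OF u] S]) simp
    show "AE y in lebesgue_on ?S. u y \<le> c"
    proof (rule AE_I2)
      fix y assume "y \<in> space (lebesgue_on ?S)"
      then have "y \<in> X" "dist y x < d" by (auto simp: dist_commute)
      then show "u y \<le> c" using d(2)[of y] c by (cases "y = x") auto
    qed
  qed
  then show "ess_limsup X u x \<le> c"
    unfolding ess_limsup_def using d(1) by (metis INF_lower2 greaterThan_iff)
qed

text \<open>The premise \<open>sub\<close> concerns matrices that have a kernel, hence definite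
  ones; any \<open>A\<close> of the polar cone is reached from \<open>A + t A0\<close> as
  \<open>t\<close> tends to 0. The essential limes superior is bounded above by semi-continuity and
  below by \<open>le_ess_limsup\<close>. The bounded total function \<open>f\<close> represents
  \<open>u\<close> in integrals over the whole space.\<close>

lemma PSH_I:
  fixes P :: "(real^'n::finite^'n) set"
  assumes P: "elliptic_cone P" and X: "open X"
    and f: "f \<in> borel_measurable borel" "\<And>x. \<bar>f x\<bar> \<le> B"
    and usc: "usc_on X u" and u: "\<And>x. x \<in> X \<Longrightarrow> u x = ereal (f x)"
    and sub: "\<And>A Q. A \<in> polar_cone P \<Longrightarrow> elliptic_kernel A Q \<Longrightarrow> locally_submean X Q f"
  shows "u \<in> PSH P X"
proof -
  obtain A0 where A0: "A0 \<in> polar_cone P" "positive_definite A0"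
    "\<forall>A\<in>polar_cone P. \<forall>t>0. positive_definite (A + t *\<^sub>R A0)"
    by (rule elliptic_coneE[OF P])
  have "u \<in> USC X"
    unfolding USC_def
  proof (intro CollectI conjI ballI usc)
    fix C assume C: "C \<in> components X"
    then obtain x where "x \<in> C" "x \<in> X" using in_components_nonempty in_components_subset by blast
    then show "\<exists>x\<in>C. u x \<noteq> - \<infinity>" using u by force
  qed
  moreover have "u \<in> L1_loc X"
    unfolding L1_loc_def
  proof (intro CollectI conjI allI impI)
    show "AE x in lebesgue. x \<in> X \<longrightarrow> \<bar>u x\<bar> \<noteq> \<infinity>" by (intro AE_I2) (simp add: u)
    fix K assume K: "compact K \<and> K \<subseteq> X"
    then have [measurable]: "K \<in> sets borel" by (simp add: borel_compact)
    have "integrable lborel (indicator K :: real^'n \<Rightarrow> real)"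
      using K by (intro integrable_indicator_bounded) (simp_all add: compact_imp_bounded)
    from integrable_mult_bounded[OF this f] have *: "integrable lborel (\<lambda>x. indicator K x * f x)" .
    have "(\<lambda>x. indicator K x *\<^sub>R real_of_ereal (u x)) = (\<lambda>x. indicator K x * f x)"
    proof
      fix x show "indicator K x *\<^sub>R real_of_ereal (u x) = indicator K x * f x"
        using K u[of x] by (cases "x \<in> K") auto
    qed
    with * show "(\<lambda>x. real_of_ereal (u x)) absolutely_integrable_on K"
      unfolding set_integrable_def by (simp add: integrable_completion)
  qed
  moreover have "psh_distr P X (distr_of X u)"
    unfolding psh_distr_def distr_nonneg_def
  proof (intro ballI impI)
    fix A \<psi> assume A: "A \<in> polar_cone P" and \<psi>: "\<psi> \<in> test_functions X" "\<forall>x. 0 \<le> \<psi> x"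
    let ?L = "\<lambda>A. distr_Laplacian A (distr_of X u) \<psi>"
    have "0 \<le> ?L A + t * ?L A0" if t: "0 < t" for t
    proof -
      have "positive_definite (A + t *\<^sub>R A0)" using A0(3) A t by blast
      then obtain c Q where c: "0 < c" "elliptic_kernel (c *\<^sub>R (A + t *\<^sub>R A0)) Q"
        by (rule positive_definite_elliptic_kernel)
      have "c *\<^sub>R (A + t *\<^sub>R A0) \<in> polar_cone P"
        using A A0(1) t c(1) by (intro polar_cone_scaleR polar_cone_add) simp_all
      from elliptic_kernel.distr_Laplacian_nonneg[OF c(2) X f sub[OF this c(2)] u \<psi>(1)]
      have "0 \<le> ?L (c *\<^sub>R (A + t *\<^sub>R A0))" using \<psi>(2) by simp
      also have "\<dots> = c * (?L A + t * ?L A0)"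
        by (simp only: distr_Laplacian_scaleR distr_Laplacian_add)
      finally show ?thesis using c(1) by (simp add: zero_le_mult_iff)
    qed
    then have ev: "eventually (\<lambda>t. 0 \<le> ?L A + t * ?L A0) (at_right 0)"
      unfolding eventually_at_filter by (intro always_eventually) simp
    have "((\<lambda>t. ?L A + t * ?L A0) \<longlongrightarrow> ?L A + 0 * ?L A0) (at_right 0)" by (intro tendsto_intros)
    from tendsto_lowerbound[OF this ev] show "0 \<le> ?L A" by simp
  qed
  moreover have "u x = ess_limsup X u x" if x: "x \<in> X" for x
  proof (rule antisym)
    show "ess_limsup X u x \<le> u x" by (rule ess_limsup_le[OF X usc x])
    obtain c Q where c: "0 < c" "elliptic_kernel (c *\<^sub>R A0) Q"
      by (rule positive_definite_elliptic_kernel[OF A0(2)])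
    have "c *\<^sub>R A0 \<in> polar_cone P" using A0(1) c(1) by (intro polar_cone_scaleR) simp_all
    from elliptic_kernel.le_ess_limsup[OF c(2) X f sub[OF this c(2)] u x]
    show "u x \<le> ess_limsup X u x" by simp
  qed
  ultimately show ?thesis by (simp add: PSH_def)
qed

text \<open>The dichotomy of \<open>locally_submean_glue\<close>: near each point the glued function
  is either the maximum or \<open>a\<close> alone.\<close>

lemma usc_on_glue:
  assumes D: "open D" and \<eta>: "\<eta> > 0"
    and a: "usc_on S (\<lambda>x. ereal (a x))" and b: "usc_on (S \<inter> D) (\<lambda>x. ereal (b x))"
    and le: "\<And>x. x \<in> S \<Longrightarrow> x \<in> D \<Longrightarrow> \<not> ball x \<eta> \<subseteq> D \<Longrightarrow> b x \<le> a x"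
  shows "usc_on S (\<lambda>x. ereal (if x \<in> D then max (a x) (b x) else a x))" (is "usc_on S ?g")
proof (rule usc_on_locally)
  fix x assume x: "x \<in> S"
  show "\<exists>N. open N \<and> x \<in> N \<and> usc_on (S \<inter> N) ?g"
  proof (cases "ball x (\<eta>/2) \<subseteq> D")
    case True
    have "usc_on (S \<inter> ball x (\<eta>/2)) (\<lambda>x. max (ereal (a x)) (ereal (b x)))"
      by (intro usc_on_max usc_on_subset[OF a] usc_on_subset[OF b]) (use True in auto)
    then have "usc_on (S \<inter> ball x (\<eta>/2)) ?g"
      by (rule usc_on_cong[rotated]) (use True in \<open>auto simp: max_def\<close>)
    then show ?thesis using \<eta> by (intro exI[of _ "ball x (\<eta>/2)"]) simp
  next
    case False
    then obtain z where z: "z \<in> ball x (\<eta>/2)" "z \<notin> D" by blast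
    have "usc_on (S \<inter> ball x (\<eta>/2)) (\<lambda>x. ereal (a x))"
      by (rule usc_on_subset[OF a]) blast
    then have "usc_on (S \<inter> ball x (\<eta>/2)) ?g"
    proof (rule usc_on_cong[rotated])
      fix y assume y: "y \<in> S \<inter> ball x (\<eta>/2)"
      have "dist y z < \<eta>" using y z(1) dist_triangle_half_r[of x y \<eta> z] by (simp add: dist_commute)
      then have "\<not> ball y \<eta> \<subseteq> D" using z(2) by auto
      then have "b y \<le> a y" if "y \<in> D" using le[of y] y that by blast
      then show "ereal (a y) = ?g y" by auto
    qed
    then show ?thesis using \<eta> by (intro exI[of _ "ball x (\<eta>/2)"]) simp
  qed
qed

subsection \<open>Barriers\<close>

lemma compact_infdist_neighbourhood:
  fixes G U :: "'a::euclidean_space set"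
  assumes "compact G" "G \<noteq> {}" "open U" "G \<subseteq> U"
  obtains e where "e > 0" "compact {x. infdist x G \<le> e}" "{x. infdist x G \<le> e} \<subseteq> U"
proof -
  obtain e where e: "e > 0" "compact {x + y |x y. x \<in> G \<and> y \<in> cball 0 e}"
    "{x + y |x y. x \<in> G \<and> y \<in> cball 0 e} \<subseteq> U"
    by (rule compact_cball_neighbourhood[OF assms(1,3,4)])
  have sub: "{x. infdist x G \<le> e} \<subseteq> {x + y |x y. x \<in> G \<and> y \<in> cball 0 e}"
  proof
    fix x assume x: "x \<in> {x. infdist x G \<le> e}"
    obtain k where k: "k \<in> G" "infdist x G = dist x k"
      using infdist_attains_inf[of G x] assms(1,2) by (auto simp: compact_imp_closed)
    have "x = k + (x - k)" "x - k \<in> cball 0 e" using x k(2) by (simp_all add: dist_norm norm_minus_commute)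
    then show "x \<in> {x + y |x y. x \<in> G \<and> y \<in> cball 0 e}" using k(1) by blast
  qed
  have "closed {x. infdist x G \<le> e}"
    by (intro closed_Collect_le continuous_intros)
  from compact_Int_closed[OF e(2) this] have "compact {x. infdist x G \<le> e}"
    unfolding Int_absorb1[OF sub] .
  then show ?thesis by (rule that[OF e(1)]) (rule order_trans[OF sub e(3)])
qed

text \<open>A penalty argument: on the compact set where \<open>F\<close> is not positive,
  \<open>G\<close> has a positive minimum, and a large multiple of it outweighs the bound of
  \<open>F\<close>.\<close>

lemma exists_positive_combination:
  fixes F G :: "'a::topological_space \<Rightarrow> real"
  assumes "compact T" "continuous_on T F" "continuous_on T G"
    and nn: "\<And>t. t \<in> T \<Longrightarrow> 0 \<le> G t" and pos: "\<And>t. t \<in> T \<Longrightarrow> G t = 0 \<Longrightarrow> 0 < F t"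
  shows "\<exists>l\<ge>0. \<forall>t\<in>T. 0 < F t + l * G t"
proof -
  define T1 where "T1 = T \<inter> F -` {..0}"
  have T1: "compact T1"
    unfolding T1_def using continuous_closedin_preimage[OF assms(2) closed_atMost]
    by (rule closedin_compact[OF assms(1)])
  show ?thesis
  proof (cases "T1 = {}")
    case True
    then have "0 < F t" if "t \<in> T" for t using that unfolding T1_def by (auto simp: not_le)
    then show ?thesis by (intro exI[of _ 0]) simp
  next
    case False
    have sub: "T1 \<subseteq> T" by (auto simp: T1_def)
    obtain t0 where t0: "t0 \<in> T1" "\<And>t. t \<in> T1 \<Longrightarrow> G t0 \<le> G t"
      using continuous_attains_inf[OF T1 False continuous_on_subset[OF assms(3) sub]] by blast
    have m: "0 < G t0" using nn[of t0] pos[of t0] t0(1) by (force simp: T1_def)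
    obtain B where B: "B > 0" "\<And>t. t \<in> T \<Longrightarrow> \<bar>F t\<bar> \<le> B"
      using compact_imp_bounded[OF compact_continuous_image[OF assms(2,1)]] by (auto simp: bounded_pos)
    define l where "l = (B + 1) / G t0"
    have l: "l \<ge> 0" using m B(1) by (simp add: l_def)
    have "0 < F t + l * G t" if t: "t \<in> T" for t
    proof (cases "t \<in> T1")
      case True
      have "l * G t0 \<le> l * G t" using t0(2)[OF True] l by (rule mult_left_mono)
      moreover have "l * G t0 = B + 1" using m by (simp add: l_def)
      ultimately show ?thesis using B(2)[OF t] by linarith
    next
      case False
      then have "0 < F t" using t by (auto simp: T1_def)
      then show ?thesis using nn[OF t] l by (simp add: add_pos_nonneg)
    qed
    then show ?thesis using l by blast
  qed
qed

lemma psd_null_vector: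
  fixes A :: "real^'n::finite^'n"
  assumes sym: "transpose A = A" and psd: "\<And>x. 0 \<le> (A *v x) \<bullet> x" and g: "(A *v g) \<bullet> g = 0"
  shows "A *v g = 0"
proof -
  define w where "w = A *v g"
  have s: "(A *v w) \<bullet> g = w \<bullet> w"
    unfolding w_def by (metis sym dot_lmul_matrix inner_commute vector_transpose_matrix)
  have q: "0 \<le> 2 * t * (w \<bullet> w) + t\<^sup>2 * ((A *v w) \<bullet> w)" for t
  proof -
    have "0 \<le> (A *v (g + t *\<^sub>R w)) \<bullet> (g + t *\<^sub>R w)" by (rule psd)
    also have "\<dots> = (A *v g) \<bullet> g + t * (w \<bullet> w) + t * ((A *v w) \<bullet> g) + t * t * ((A *v w) \<bullet> w)"
      unfolding matrix_vector_right_distrib matrix_vector_mult_scaleR inner_add_left inner_add_right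
        inner_scaleR_left inner_scaleR_right w_def[symmetric] by (simp add: distrib_left mult.assoc)
    finally show ?thesis unfolding s g power2_eq_square by simp
  qed
  have "w \<bullet> w = 0"
  proof (rule ccontr)
    assume "w \<bullet> w \<noteq> 0"
    then have p: "0 < w \<bullet> w" by simp
    define a where "a = (A *v w) \<bullet> w"
    have a: "0 \<le> a" unfolding a_def by (rule psd)
    \<comment> \<open>A negative value at which the linear term of the polynomial in
      \<open>q\<close> prevails over the quadratic one; \<open>a + 1\<close> keeps the denominator
      positive even if \<open>a = 0\<close>.\<close>
    define t where "t = - (w \<bullet> w) / (a + 1)"
    have t0: "t < 0" using p a by (simp add: t_def divide_neg_pos)
    have ta: "t * (a + 1) = - (w \<bullet> w)" using a by (simp add: t_def)
    have "0 \<le> t * (2 * (w \<bullet> w) + t * a)"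
      using q[of t] unfolding a_def[symmetric] power2_eq_square by (simp add: distrib_left mult_ac)
    then have "2 * (w \<bullet> w) + t * a \<le> 0" using t0 by (simp add: zero_le_mult_iff)
    moreover have "t * a = - (w \<bullet> w) - t" using ta by (simp add: distrib_left)
    ultimately show False using p t0 by linarith
  qed
  then show ?thesis by (simp add: w_def)
qed

text \<open>The orthogonal complement of the tangent hyperplane is the line of the gradient, and a
  vector on which a semidefinite form vanishes lies in the kernel of its matrix.\<close>

lemma psd_mem_Sym2_tangent:
  fixes A :: "real^'n::finite^'n"
  assumes sym: "transpose A = A" and psd: "\<And>x. 0 \<le> (A *v x) \<bullet> x"
    and g: "grad \<rho> x \<noteq> 0" "(A *v grad \<rho> x) \<bullet> grad \<rho> x = 0"
  shows "A \<in> Sym2 (tangent_hyperplane \<rho> x)"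
  unfolding Sym2_def
proof (intro CollectI conjI ballI sym)
  fix w assume w: "w \<in> (tangent_hyperplane \<rho> x)\<^sup>\<bottom>"
  define n where "n = grad \<rho> x"
  define c where "c = (w \<bullet> n) / (n \<bullet> n)"
  define v where "v = w - c *\<^sub>R n"
  have nn: "n \<bullet> n \<noteq> 0" using g(1) by (simp add: n_def)
  then have nv: "n \<bullet> v = 0" by (simp add: v_def c_def inner_diff_right inner_commute)
  then have "v \<in> tangent_hyperplane \<rho> x" by (simp add: tangent_hyperplane_def n_def)
  then have "v \<bullet> w = 0" using w by (auto simp: orthogonal_comp_def orthogonal_def)
  then have "v \<bullet> v = 0" using nv by (simp add: v_def inner_diff_right inner_diff_left inner_commute)
  then have "w = c *\<^sub>R n" by (simp add: v_def)
  then show "A *v w = 0"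
    using psd_null_vector[OF sym psd g(2)] by (simp add: matrix_vector_mult_scaleR n_def)
qed

text \<open>The Hessian of \<open>\<rho>\<^sup>2 / 2\<close> is \<open>\<rho>\<close> times that of
  \<open>\<rho>\<close> plus the rank one matrix of the gradient. On the boundary, where
  \<open>\<rho> = 0\<close>, only the rank one part is added.\<close>

lemma Hess_square_defining:
  assumes "open U" "Ck_on 2 U \<rho>" "x \<in> U"
  shows "sym_inner (Hess (\<lambda>x. \<rho> x + l / 2 * (\<rho> x * \<rho> x)) x) A
    = (1 + l * \<rho> x) * sym_inner (Hess \<rho> x) A + l * ((A *v grad \<rho> x) \<bullet> grad \<rho> x)"
proof -
  have C: "Ck_on 2 U (\<lambda>x. \<rho> x * \<rho> x)" by (rule Ck_on_mult[OF assms(1,2,2)])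
  have C': "Ck_on 2 U (\<lambda>x. l / 2 * (\<rho> x * \<rho> x))" by (rule Ck_on_mult[OF assms(1) Ck_on_const C])
  have H: "Hess (\<lambda>x. \<rho> x + l / 2 * (\<rho> x * \<rho> x)) x = Hess \<rho> x + (l / 2) *\<^sub>R Hess (\<lambda>x. \<rho> x * \<rho> x) x"
    using Hess_add[OF assms(1,2) C' assms(3)] Hess_cmult[OF assms(1) C assms(3), of "l / 2"] by simp
  have g: "(\<Sum>i\<in>UNIV. \<Sum>j\<in>UNIV. grad \<rho> x $ i * grad \<rho> x $ j * A $ j $ i) = (A *v grad \<rho> x) \<bullet> grad \<rho> x"
  proof -
    have "(A *v w) \<bullet> w = (\<Sum>j\<in>UNIV. \<Sum>i\<in>UNIV. w $ i * w $ j * A $ j $ i)" for w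
      unfolding inner_vec_def matrix_vector_mult_def vec_lambda_beta inner_real_def sum_distrib_right
      by (simp only: mult_ac)
    then show ?thesis by (subst sum.swap) (simp only:)
  qed
  have "sym_inner (Hess (\<lambda>x. \<rho> x * \<rho> x) x) A
      = (\<Sum>i\<in>UNIV. \<Sum>j\<in>UNIV. 2 * \<rho> x * (Hess \<rho> x $ i $ j * A $ j $ i) + 2 * (grad \<rho> x $ i * grad \<rho> x $ j * A $ j $ i))"
    unfolding sym_inner_eq Hess_mult[OF assms(1,2,2,3)]
    by (intro sum.cong refl) (simp add: grad_def algebra_simps)
  also have "\<dots> = 2 * \<rho> x * sym_inner (Hess \<rho> x) A + 2 * ((A *v grad \<rho> x) \<bullet> grad \<rho> x)"
    unfolding g[symmetric] sym_inner_eq by (simp add: sum.distrib sum_distrib_left)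
  finally show ?thesis
    unfolding H sym_inner_add_left sym_inner_scaleR_left by (simp add: distrib_left distrib_right)
qed

lemma continuous_on_matrix_vector_mult [continuous_intros]:
  "continuous_on S f \<Longrightarrow> continuous_on S g \<Longrightarrow> continuous_on S (\<lambda>x. (f x :: real^'n::finite^'m::finite) *v g x)"
  by (rule bounded_bilinear.continuous_on[OF bounded_bilinear_matrix_vector_mult])

lemma defining_function_boundary:
  assumes "open \<Omega>" "defining_function \<Omega> U \<rho>" "x \<in> frontier \<Omega>"
  shows "\<rho> x = 0"
proof -
  have U: "open U" "x \<in> U" and C: "continuous_on U \<rho>" and \<Omega>: "\<Omega> \<inter> U = {x\<in>U. \<rho> x < 0}"
    using assms by (auto simp: defining_function_def smooth_on_def dest: spec[of _ 0])
  have "x \<notin> \<Omega>" using assms(1,3) by (simp add: frontier_def interior_open)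
  then have "0 \<le> \<rho> x" using U \<Omega> by force
  moreover have "\<not> 0 < \<rho> x"
  proof
    assume "0 < \<rho> x"
    have "open (U \<inter> \<rho> -` {0<..})" using C U(1) by (simp add: continuous_open_preimage)
    moreover have "x \<in> U \<inter> \<rho> -` {0<..}" using \<open>0 < \<rho> x\<close> U by simp
    moreover have "x \<in> closure \<Omega>" using assms(3) by (simp add: frontier_def)
    ultimately obtain y where "y \<in> \<Omega>" "y \<in> U \<inter> \<rho> -` {0<..}"
      by (metis (no_types, lifting) closure_iff_nhds_not_empty disjoint_iff inf_commute subset_refl)
    then have "y \<in> \<Omega> \<inter> U" "0 < \<rho> y" by auto
    then show False unfolding \<Omega> by simp
  qed
  ultimately show ?thesis by simp
qed

text \<open>Adding a large multiple of \<open>\<rho>\<^sup>2\<close> makes a defining function strictly plurisubharmonic near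
  the boundary: on the boundary this adds a multiple of \<open>\<langle>A\<nabla>\<rho>, \<nabla>\<rho>\<rangle>\<close> to \<open>\<langle>Hess \<rho>, A\<rangle>\<close>, and this
  is positive unless \<open>A\<close> is tangential.\<close>

lemma strictly_psh_defining_function:
  fixes \<Omega> :: "(real^'n::finite) set"
  assumes P: "elliptic_cone P" and \<Omega>: "open \<Omega>" "bounded \<Omega>" "\<Omega> \<noteq> {}"
    and def: "defining_function \<Omega> U \<rho>" and conv: "\<And>x. x \<in> frontier \<Omega> \<Longrightarrow> strictly_convex_at P \<rho> x"
  obtains \<sigma> d c where "0 < d" "0 < c" "Ck_on 2 U \<sigma>"
    "compact {x. infdist x (frontier \<Omega>) \<le> d}" "{x. infdist x (frontier \<Omega>) \<le> d} \<subseteq> U"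
    "\<forall>x\<in>frontier \<Omega>. \<sigma> x = 0" "\<forall>x\<in>\<Omega>. infdist x (frontier \<Omega>) \<le> d \<longrightarrow> \<sigma> x < 0"
    "\<forall>x. infdist x (frontier \<Omega>) \<le> d \<longrightarrow> (\<forall>A\<in>polar_cone P. norm A = 1 \<longrightarrow> c \<le> sym_inner (Hess \<sigma> x) A)"
proof -
  define G where "G = frontier \<Omega>"
  have G: "compact G" "G \<noteq> {}"
    using \<Omega> by (auto simp: G_def compact_frontier_bounded frontier_eq_empty)
  have U: "open U" "G \<subseteq> U" and C2: "Ck_on 2 U \<rho>" and C1: "Ck_on 1 U \<rho>"
    and \<Omega>U: "\<Omega> \<inter> U = {x\<in>U. \<rho> x < 0}" and gr: "\<And>x. x \<in> G \<Longrightarrow> grad \<rho> x \<noteq> 0"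
    using def unfolding defining_function_def smooth_on_def G_def by blast+
  have \<rho>0: "\<rho> x = 0" if "x \<in> G" for x
    using defining_function_boundary[OF \<Omega>(1) def] that by (simp add: G_def)
  \<comment> \<open>The condition is homogeneous in \<open>A\<close>; the unit matrices form a
    compact slice of the closed cone.\<close>
  define S where "S = polar_cone P \<inter> sphere 0 1"
  have S: "compact S"
    unfolding S_def by (rule closed_Int_compact[OF closed_polar_cone compact_sphere])
  have cH: "continuous_on U (Hess \<rho>)" and cg: "continuous_on U (grad \<rho>)"
    by (rule continuous_on_Hess[OF C2], rule continuous_on_grad[OF C1])
  have fst: "fst ` (V \<times> S) \<subseteq> U" if "V \<subseteq> U" for V using that by auto
  have "\<exists>l\<ge>0. \<forall>t\<in>G \<times> S. 0 < sym_inner (Hess \<rho> (fst t)) (snd t)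
      + l * ((snd t *v grad \<rho> (fst t)) \<bullet> grad \<rho> (fst t))"
  proof (rule exists_positive_combination)
    show "compact (G \<times> S)" by (rule compact_Times[OF G(1) S])
    show "continuous_on (G \<times> S) (\<lambda>t. sym_inner (Hess \<rho> (fst t)) (snd t))"
      by (intro continuous_intros continuous_on_compose2[OF cH] fst U(2))
    show "continuous_on (G \<times> S) (\<lambda>t. (snd t *v grad \<rho> (fst t)) \<bullet> grad \<rho> (fst t))"
      by (intro continuous_intros continuous_on_compose2[OF cg] fst U(2))
    fix t assume t: "t \<in> G \<times> S"
    then have A: "fst t \<in> G" "snd t \<in> polar_cone P" "norm (snd t) = 1" by (auto simp: S_def)
    show "0 \<le> (snd t *v grad \<rho> (fst t)) \<bullet> grad \<rho> (fst t)" by (rule polar_cone_psd[OF P A(2)])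
    assume "(snd t *v grad \<rho> (fst t)) \<bullet> grad \<rho> (fst t) = 0"
    then have "snd t \<in> Sym2 (tangent_hyperplane \<rho> (fst t))"
      using A(2) polar_cone_psd[OF P A(2)] gr[OF A(1)]
      by (intro psd_mem_Sym2_tangent) (auto simp: polar_cone_def Sym2_UNIV)
    moreover have "snd t \<noteq> 0" using A(3) by auto
    ultimately show "0 < sym_inner (Hess \<rho> (fst t)) (snd t)"
      using conv[of "fst t"] A(1,2) unfolding strictly_convex_at_def G_def by blast
  qed
  then obtain l where l: "l \<ge> 0" and pos: "\<And>x A. x \<in> G \<Longrightarrow> A \<in> S \<Longrightarrow>
      0 < sym_inner (Hess \<rho> x) A + l * ((A *v grad \<rho> x) \<bullet> grad \<rho> x)"
    by force
  define \<sigma> where "\<sigma> = (\<lambda>x. \<rho> x + l / 2 * (\<rho> x * \<rho> x))"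
  have C2\<sigma>: "Ck_on 2 U \<sigma>"
    unfolding \<sigma>_def by (intro Ck_on_add Ck_on_mult U C2 Ck_on_const)
  define h where "h t = sym_inner (Hess \<sigma> (fst t)) (snd t)" for t
  have ch: "continuous_on (V \<times> S) h" if "V \<subseteq> U" for V
    unfolding h_def
    by (intro continuous_intros continuous_on_compose2[OF continuous_on_Hess[OF C2\<sigma>]] fst that)
  have hpos: "0 < h t" if "t \<in> G \<times> S" for t
  proof -
    have t: "fst t \<in> G" "snd t \<in> S" using that by auto
    then show ?thesis
      using pos[OF t] Hess_square_defining[OF U(1) C2, of "fst t" l "snd t"] U(2) \<rho>0
      by (auto simp: h_def \<sigma>_def)
  qed
  have "\<exists>c0>0. \<forall>t\<in>G \<times> S. c0 \<le> h t"
  proof (cases "G \<times> S = {}")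
    case True
    then show ?thesis by (intro exI[of _ 1]) auto
  next
    case False
    from continuous_attains_inf[OF compact_Times[OF G(1) S] this ch[OF U(2)]]
    show ?thesis using hpos by blast
  qed
  then obtain c0 where c0: "c0 > 0" "\<And>t. t \<in> G \<times> S \<Longrightarrow> c0 \<le> h t" by blast
  obtain e where e: "e > 0" "compact {x. infdist x G \<le> e}" "{x. infdist x G \<le> e} \<subseteq> U"
    by (rule compact_infdist_neighbourhood[OF G U])
  define Z where "Z = {x. infdist x G \<le> e}"
  \<comment> \<open>Uniform continuity extends the bound \<open>c0\<close> on the boundary to a tube
    around it, at the price of half the constant.\<close>
  have "uniformly_continuous_on (Z \<times> S) h"
    by (rule compact_uniformly_continuous[OF ch compact_Times[OF _ S]]) (use e in \<open>auto simp: Z_def\<close>)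
  then obtain d1 where d1: "d1 > 0" "\<And>t t'. t \<in> Z \<times> S \<Longrightarrow> t' \<in> Z \<times> S \<Longrightarrow> dist t' t < d1 \<Longrightarrow> dist (h t') (h t) < c0 / 2"
    using c0(1) unfolding uniformly_continuous_on_def by (meson half_gt_zero)
  have "uniformly_continuous_on Z \<rho>"
    by (rule compact_uniformly_continuous[OF continuous_on_subset[OF Ck_on_continuous[OF C2]]])
      (use e in \<open>auto simp: Z_def\<close>)
  \<comment> \<open>Where \<open>\<rho>\<close> is smaller than this in absolute value, the factor
    \<open>1 + l / 2 * \<rho>\<close> is positive, so \<open>\<sigma>\<close> is negative wherever
    \<open>\<rho>\<close> is.\<close>
  moreover have "0 < 1 / (l + 1)" using l by simp
  ultimately obtain d2 where d2: "d2 > 0" "\<And>x x'. x \<in> Z \<Longrightarrow> x' \<in> Z \<Longrightarrow> dist x' x < d2 \<Longrightarrow> dist (\<rho> x') (\<rho> x) < 1 / (l + 1)"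
    unfolding uniformly_continuous_on_def by meson
  define d where "d = Min {e, d1/2, d2/2}"
  have d: "0 < d" "d \<le> e" "d < d1" "d < d2" using e(1) d1(1) d2(1) by (auto simp: d_def min_def)
  have near: "\<exists>k\<in>G. dist x k \<le> d \<and> k \<in> Z \<and> x \<in> Z" if x: "infdist x G \<le> d" for x
  proof -
    obtain k where k: "k \<in> G" "infdist x G = dist x k"
      using infdist_attains_inf[of G x] G by (auto simp: compact_imp_closed)
    then show ?thesis using x d e(1) by (intro bexI[of _ k]) (auto simp: Z_def)
  qed
  have Zd: "{x. infdist x G \<le> d} \<subseteq> {x. infdist x G \<le> e}" using d(2) by auto
  show ?thesis
  proof (rule that[of d "c0 / 2" \<sigma>])
    show "0 < d" "0 < c0 / 2" "Ck_on 2 U \<sigma>" using d(1) c0(1) C2\<sigma> by simp_all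
    have "closed {x. infdist x G \<le> d}" by (intro closed_Collect_le continuous_intros)
    then show "compact {x. infdist x (frontier \<Omega>) \<le> d}"
      using compact_Int_closed[OF e(2)] Zd unfolding G_def[symmetric] by (metis inf.absorb_iff2)
    show "{x. infdist x (frontier \<Omega>) \<le> d} \<subseteq> U" using Zd e(3) unfolding G_def by blast
    show "\<forall>x\<in>frontier \<Omega>. \<sigma> x = 0" using \<rho>0 by (simp add: \<sigma>_def G_def)
    show "\<forall>x\<in>\<Omega>. infdist x (frontier \<Omega>) \<le> d \<longrightarrow> \<sigma> x < 0"
    proof (intro ballI impI)
      fix x assume x: "x \<in> \<Omega>" "infdist x (frontier \<Omega>) \<le> d"
      obtain k where k: "k \<in> G" "dist x k \<le> d" "k \<in> Z" "x \<in> Z" using near x(2) unfolding G_def by blast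
      have "x \<in> \<Omega> \<inter> U" using x(1) k(4) e(3) unfolding Z_def by blast
      then have n: "\<rho> x < 0" unfolding \<Omega>U by simp
      have "dist (\<rho> x) (\<rho> k) < 1 / (l + 1)" using d2(2)[OF k(3,4)] k(2) d(4) by linarith
      then have "- \<rho> x < 1 / (l + 1)" using \<rho>0[OF k(1)] n by (simp add: dist_real_def)
      then have "- \<rho> x * (l + 1) < 1" using l by (simp add: pos_less_divide_eq)
      then have "0 < 1 + l / 2 * \<rho> x" using n by (simp add: algebra_simps)
      then have "\<rho> x * (1 + l / 2 * \<rho> x) < 0" using n by (simp add: mult_neg_pos)
      then show "\<sigma> x < 0" by (simp add: \<sigma>_def distrib_left mult_ac)
    qed
    show "\<forall>x. infdist x (frontier \<Omega>) \<le> d \<longrightarrow> (\<forall>A\<in>polar_cone P. norm A = 1 \<longrightarrow> c0 / 2 \<le> sym_inner (Hess \<sigma> x) A)"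
    proof (intro allI ballI impI)
      fix x A assume x: "infdist x (frontier \<Omega>) \<le> d" and A: "A \<in> polar_cone P" "norm A = 1"
      obtain k where k: "k \<in> G" "dist x k \<le> d" "k \<in> Z" "x \<in> Z" using near x unfolding G_def by blast
      have AS: "A \<in> S" using A by (simp add: S_def)
      have "dist (x, A) (k, A) < d1" using k(2) d(3) by (simp add: dist_Pair_Pair)
      then have "dist (h (x, A)) (h (k, A)) < c0 / 2" using d1(2)[of "(k, A)" "(x, A)"] k AS by simp
      moreover have "c0 \<le> h (k, A)" using c0(2) k(1) AS by simp
      ultimately have "\<bar>sym_inner (Hess \<sigma> x) A - sym_inner (Hess \<sigma> k) A\<bar> < c0 / 2" "c0 \<le> sym_inner (Hess \<sigma> k) A"
        by (simp_all add: h_def dist_real_def)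
      then show "c0 / 2 \<le> sym_inner (Hess \<sigma> x) A" by linarith
    qed
  qed
qed

lemma sym_inner_pos_scale:
  assumes "\<And>A. A \<in> polar_cone P \<Longrightarrow> norm A = 1 \<Longrightarrow> 0 < sym_inner H A" "A \<in> polar_cone P" "A \<noteq> 0"
  shows "0 < sym_inner H A"
proof -
  have "0 < sym_inner H ((1 / norm A) *\<^sub>R A)"
    by (rule assms(1)) (use assms(2,3) in \<open>auto intro: polar_cone_scaleR\<close>)
  then show ?thesis using assms(3) by (simp add: sym_inner_scaleR_right zero_less_divide_iff)
qed

text \<open>\<open>h1\<close> and \<open>h2\<close> are \<open>p\<close> and \<open>- p\<close>,
  each plus \<open>C * \<sigma> - \<epsilon>\<close>, with a polynomial \<open>p\<close> that is
  \<open>\<epsilon>\<close>-close to the merely continuous \<open>\<phi>\<close>. On the boundary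
  \<open>h1 = p - \<epsilon>\<close> and \<open>- h2 = p + \<epsilon>\<close>; this gap of
  \<open>2 * \<epsilon>\<close> and two errors of \<open>\<epsilon> / 2\<close> from uniform
  continuity add up to \<open>3 * \<epsilon>\<close>. Values below \<open>- M\<close> on the inner
  half of the tube allow the barriers to be cut off there.\<close>

lemma boundary_barriers:
  fixes \<Omega> :: "(real^'n::finite) set"
  assumes P: "elliptic_cone P" and \<Omega>: "open \<Omega>" "bounded \<Omega>" "\<Omega> \<noteq> {}"
    and conv: "smooth_strictly_convex_boundary P \<Omega>"
    and \<phi>: "continuous_on (frontier \<Omega>) \<phi>" and \<epsilon>: "0 < \<epsilon>"
  obtains U h1 h2 d \<delta> where "open U" "0 < d" "0 < \<delta>" "\<delta> < d / 2"
    "compact {x. infdist x (frontier \<Omega>) \<le> d}" "{x. infdist x (frontier \<Omega>) \<le> d} \<subseteq> U"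
    "Ck_on 2 U h1" "Ck_on 2 U h2"
    "\<forall>x. infdist x (frontier \<Omega>) \<le> d \<longrightarrow> (\<forall>A\<in>polar_cone P. A \<noteq> 0 \<longrightarrow>
      0 < sym_inner (Hess h1 x) A \<and> 0 < sym_inner (Hess h2 x) A)"
    "\<forall>x\<in>frontier \<Omega>. h1 x \<le> \<phi> x \<and> \<phi> x \<le> - h2 x"
    "\<forall>x\<in>\<Omega>. d / 2 \<le> infdist x (frontier \<Omega>) \<longrightarrow> infdist x (frontier \<Omega>) \<le> d \<longrightarrow> h1 x \<le> - M \<and> h2 x \<le> - M"
    "\<forall>x x'. infdist x (frontier \<Omega>) < \<delta> \<longrightarrow> dist x x' < \<delta> \<longrightarrow> - h2 x' \<le> h1 x + 3 * \<epsilon>"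
proof -
  define G where "G = frontier \<Omega>"
  have G: "compact G" "G \<noteq> {}"
    using \<Omega> by (auto simp: G_def compact_frontier_bounded frontier_eq_empty)
  obtain U \<rho> where def: "defining_function \<Omega> U \<rho>" "\<And>x. x \<in> frontier \<Omega> \<Longrightarrow> strictly_convex_at P \<rho> x"
    using conv unfolding smooth_strictly_convex_boundary_def by blast
  have U: "open U" using def(1) by (simp add: defining_function_def)
  obtain \<sigma> d c where d: "0 < d" "0 < c" and C\<sigma>: "Ck_on 2 U \<sigma>"
    and Z: "compact {x. infdist x (frontier \<Omega>) \<le> d}" "{x. infdist x (frontier \<Omega>) \<le> d} \<subseteq> U"
    and \<sigma>0: "\<forall>x\<in>frontier \<Omega>. \<sigma> x = 0"
    and \<sigma>neg: "\<forall>x\<in>\<Omega>. infdist x (frontier \<Omega>) \<le> d \<longrightarrow> \<sigma> x < 0"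
    and \<sigma>psh: "\<forall>x. infdist x (frontier \<Omega>) \<le> d \<longrightarrow> (\<forall>A\<in>polar_cone P. norm A = 1 \<longrightarrow> c \<le> sym_inner (Hess \<sigma> x) A)"
    by (rule strictly_psh_defining_function[OF P \<Omega> def])
  define Y where "Y = {x. infdist x G \<le> d}"
  have Y: "compact Y" "Y \<subseteq> U" using Z by (simp_all add: Y_def G_def)
  obtain p where p: "real_polynomial_function p" "\<And>x. x \<in> G \<Longrightarrow> \<bar>\<phi> x - p x\<bar> < \<epsilon>"
    using Stone_Weierstrass_real_polynomial_function[OF G(1) _ \<epsilon>, of \<phi>] \<phi> unfolding G_def by metis
  have Cp: "Ck_on 2 U p" using Ck_on_subset[OF Ck_on_real_polynomial_function[OF p(1)]] by blast
  define S where "S = polar_cone P \<inter> sphere 0 1"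
  have S: "compact S"
    unfolding S_def by (rule closed_Int_compact[OF closed_polar_cone compact_sphere])
  have "continuous_on (Y \<times> S) (\<lambda>t. sym_inner (Hess p (fst t)) (snd t))"
    by (intro continuous_intros continuous_on_compose2[OF continuous_on_Hess[OF Cp]]) (use Y in auto)
  from compact_imp_bounded[OF compact_continuous_image[OF this compact_Times[OF Y(1) S]]]
  obtain N where N: "N > 0" "\<And>x A. x \<in> Y \<Longrightarrow> A \<in> S \<Longrightarrow> \<bar>sym_inner (Hess p x) A\<bar> \<le> N"
    by (force simp: bounded_pos)
  from compact_imp_bounded[OF compact_continuous_image[OF continuous_on_subset[OF Ck_on_continuous[OF Cp] Y(2)] Y(1)]]
  obtain N2 where N2: "N2 > 0" "\<And>x. x \<in> Y \<Longrightarrow> \<bar>p x\<bar> \<le> N2" by (auto simp: bounded_pos)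
  define R where "R = (closure \<Omega> \<inter> {x. d / 2 \<le> infdist x G}) \<inter> Y"
  have R: "compact R"
    unfolding R_def by (intro closed_Int_compact[OF _ Y(1)] closed_Int closed_closure closed_Collect_le continuous_intros)
  have R\<Omega>: "x \<in> \<Omega>" if "x \<in> R" for x
  proof -
    have "x \<notin> G" using that d(1) by (auto simp: R_def)
    then show ?thesis using that \<Omega>(1) by (auto simp: R_def G_def frontier_def interior_open)
  qed
  have "\<exists>s>0. \<forall>x\<in>R. \<sigma> x \<le> - s"
  proof (cases "R = {}")
    case True
    then show ?thesis by (intro exI[of _ 1]) auto
  next
    case False
    have "continuous_on R \<sigma>" using Ck_on_continuous[OF C\<sigma>] Y(2) by (auto simp: R_def intro: continuous_on_subset)
    then obtain x0 where x0: "x0 \<in> R" "\<And>x. x \<in> R \<Longrightarrow> \<sigma> x \<le> \<sigma> x0"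
      using continuous_attains_sup[OF R False] by blast
    have "\<sigma> x0 < 0" using \<sigma>neg R\<Omega>[OF x0(1)] x0(1) by (simp add: R_def Y_def G_def)
    then show ?thesis using x0(2) by (intro exI[of _ "- \<sigma> x0"]) auto
  qed
  then obtain s where s: "s > 0" "\<And>x. x \<in> R \<Longrightarrow> \<sigma> x \<le> - s" by blast
  \<comment> \<open>The first summand lets \<open>C * \<sigma>\<close> outweigh the Hessian of
    \<open>p\<close>; the second pushes both barriers below \<open>- M\<close> on \<open>R\<close>,
    where \<open>\<sigma> \<le> - s\<close>.\<close>
  define C where "C = (N + 1) / c + (N2 + \<epsilon> + \<bar>M\<bar>) / s"
  have C: "N < C * c" "N2 + \<epsilon> + \<bar>M\<bar> \<le> C * s" "0 \<le> C"
  proof -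
    have nn: "0 \<le> (N + 1) / c" "0 \<le> (N2 + \<epsilon> + \<bar>M\<bar>) / s" using N(1) N2(1) \<epsilon> d(2) s(1) by simp_all
    then show "0 \<le> C" by (simp add: C_def)
    have "(N + 1) / c * c \<le> C * c" using nn d(2) by (intro mult_right_mono) (simp_all add: C_def)
    then show "N < C * c" using d(2) by simp
    have "(N2 + \<epsilon> + \<bar>M\<bar>) / s * s \<le> C * s" using nn s(1) by (intro mult_right_mono) (simp_all add: C_def)
    then show "N2 + \<epsilon> + \<bar>M\<bar> \<le> C * s" using s(1) by simp
  qed
  define h where "h b = (\<lambda>x. b * p x + (C * \<sigma> x + - \<epsilon>))" for b
  have Ch: "Ck_on 2 U (h b)" for b
    unfolding h_def by (intro Ck_on_add Ck_on_mult U Cp C\<sigma> Ck_on_const)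
  have Hh: "Hess (h b) x = b *\<^sub>R Hess p x + C *\<^sub>R Hess \<sigma> x" if "x \<in> U" for b x
  proof -
    have a: "Ck_on 2 U (\<lambda>x. b * p x)" "Ck_on 2 U (\<lambda>x. C * \<sigma> x)"
      by (intro Ck_on_mult U Cp C\<sigma> Ck_on_const)+
    have z: "Hess (\<lambda>x. - \<epsilon>) x = 0" unfolding Hess_def vec_eq_iff by simp
    show ?thesis
      unfolding h_def Hess_add[OF U a(1) Ck_on_add[OF U a(2) Ck_on_const] that]
        Hess_add[OF U a(2) Ck_on_const that] Hess_cmult[OF U Cp that] Hess_cmult[OF U C\<sigma> that] z by simp
  qed
  have psh: "0 < sym_inner (Hess (h b) x) A"
    if b: "\<bar>b\<bar> = 1" and x: "infdist x G \<le> d" and A: "A \<in> polar_cone P" "A \<noteq> 0" for b x A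
  proof (rule sym_inner_pos_scale[OF _ A])
    fix A assume A: "A \<in> polar_cone P" "norm A = 1"
    have xY: "x \<in> Y" "x \<in> U" using x Y(2) by (auto simp: Y_def)
    have "\<bar>b * sym_inner (Hess p x) A\<bar> \<le> N" using N(2)[OF xY(1), of A] A b by (simp add: abs_mult S_def)
    moreover have "C * c \<le> C * sym_inner (Hess \<sigma> x) A"
      using \<sigma>psh A x C(3) unfolding G_def by (intro mult_left_mono) auto
    ultimately show "0 < sym_inner (Hess (h b) x) A"
      unfolding Hh[OF xY(2)] sym_inner_add_left sym_inner_scaleR_left using C(1) by linarith
  qed
  have uc: "uniformly_continuous_on Y (h b)" for b
    by (rule compact_uniformly_continuous[OF continuous_on_subset[OF Ck_on_continuous[OF Ch] Y(2)] Y(1)])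
  have e2: "0 < \<epsilon> / 2" using \<epsilon> by simp
  obtain d1 where d1: "d1 > 0" "\<And>x x'. x \<in> Y \<Longrightarrow> x' \<in> Y \<Longrightarrow> dist x' x < d1 \<Longrightarrow> dist (h 1 x') (h 1 x) < \<epsilon> / 2"
    using uc[of 1] e2 unfolding uniformly_continuous_on_def by meson
  obtain d2 where d2: "d2 > 0" "\<And>x x'. x \<in> Y \<Longrightarrow> x' \<in> Y \<Longrightarrow> dist x' x < d2 \<Longrightarrow> dist (h (-1) x') (h (-1) x) < \<epsilon> / 2"
    using uc[of "-1"] e2 unfolding uniformly_continuous_on_def by meson
  \<comment> \<open>A third, because \<open>x'\<close> may be almost \<open>2 * \<delta>\<close>
    away from the boundary point nearest to \<open>x\<close>.\<close>
  define \<delta> where "\<delta> = Min {d, d1, d2} / 3"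
  have \<delta>: "0 < \<delta>" "\<delta> < d / 2" "2 * \<delta> < d" "2 * \<delta> < d1" "2 * \<delta> < d2" "\<delta> < d1"
    using d(1) d1(1) d2(1) by (auto simp: \<delta>_def min_def)
  have bnd: "h 1 x = p x - \<epsilon>" "- h (-1) x = p x + \<epsilon>" if "x \<in> G" for x
    using \<sigma>0 that by (auto simp: h_def G_def)
  show ?thesis
  proof (rule that[of U d \<delta> "h 1" "h (-1)", folded G_def])
    show "\<forall>x. infdist x G \<le> d \<longrightarrow> (\<forall>A\<in>polar_cone P. A \<noteq> 0 \<longrightarrow>
        0 < sym_inner (Hess (h 1) x) A \<and> 0 < sym_inner (Hess (h (-1)) x) A)"
      by (simp add: psh)
    show "\<forall>x\<in>G. h 1 x \<le> \<phi> x \<and> \<phi> x \<le> - h (-1) x"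
    proof
      fix x assume x: "x \<in> G"
      show "h 1 x \<le> \<phi> x \<and> \<phi> x \<le> - h (-1) x" using bnd[OF x] p(2)[OF x] by linarith
    qed
    show "\<forall>x\<in>\<Omega>. d / 2 \<le> infdist x G \<longrightarrow> infdist x G \<le> d \<longrightarrow> h 1 x \<le> - M \<and> h (-1) x \<le> - M"
    proof (intro ballI impI)
      fix x assume *: "x \<in> \<Omega>" "d / 2 \<le> infdist x G" "infdist x G \<le> d"
      have x: "x \<in> R" "x \<in> Y" using * subsetD[OF closure_subset *(1)] by (simp_all add: R_def Y_def)
      have "C * \<sigma> x \<le> C * - s" using s(2)[OF x(1)] C(3) by (rule mult_left_mono)
      then have "C * \<sigma> x \<le> - (N2 + \<epsilon> + \<bar>M\<bar>)" using C(2) by simp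
      then show "h 1 x \<le> - M \<and> h (-1) x \<le> - M" using N2(2)[OF x(2)] \<epsilon> unfolding h_def by linarith
    qed
    show "\<forall>x x'. infdist x G < \<delta> \<longrightarrow> dist x x' < \<delta> \<longrightarrow> - h (-1) x' \<le> h 1 x + 3 * \<epsilon>"
    proof (intro allI impI)
      fix x x' assume x: "infdist x G < \<delta>" "dist x x' < \<delta>"
      obtain k where k: "k \<in> G" "infdist x G = dist x k"
        using infdist_attains_inf[of G x] G by (auto simp: compact_imp_closed)
      have kx: "dist x k < \<delta>" using x(1) k(2) by simp
      then have kx': "dist x' k < 2 * \<delta>" using x(2) dist_triangle[of x' k x] by (simp add: dist_commute)
      have "x \<in> Y" "x' \<in> Y" "k \<in> Y"
        using kx kx' \<delta> d(1) infdist_le[OF k(1), of x'] infdist_le[OF k(1), of x] k(1) by (auto simp: Y_def)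
      then have "\<bar>h 1 x - h 1 k\<bar> < \<epsilon> / 2" "\<bar>h (-1) x' - h (-1) k\<bar> < \<epsilon> / 2"
        using d1(2)[of k x] d2(2)[of k x'] kx kx' \<delta> by (simp_all add: dist_real_def)
      then show "- h (-1) x' \<le> h 1 x + 3 * \<epsilon>" using bnd[OF k(1)] by linarith
    qed
  qed (use U d \<delta> Z Ch in \<open>simp_all add: G_def\<close>)
qed

lemma elliptic_kernel_nonzero:
  assumes "elliptic_kernel A (Q :: real^'n::finite^'n)"
  shows "A \<noteq> 0"
proof
  assume "A = 0"
  then have "(mat 1 :: real^'n^'n) = 0"
    using assms by (simp add: elliptic_kernel_def matrix_matrix_mult_def vec_eq_iff)
  then have "(mat 1 :: real^'n^'n) $ undefined $ undefined = 0" by simp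
  then show False by (simp add: mat_def)
qed

section \<open>Stability of the mean value inequality\<close>

context elliptic_kernel
begin

lemma Ck_on_q: "Ck_on k UNIV q"
  using Ck_on_real_polynomial_function[OF real_polynomial_function_q[of 1 0]] by simp

text \<open>The value is twice the dimension, since the Hessian is \<open>2 Q\<close> and
  \<open>A\<close> inverts \<open>Q\<close>. It makes \<open>q\<close> the strictly subharmonic
  function of the maximum principle.\<close>

lemma Hess_q_pos: "0 < sym_inner (Hess q x) A"
proof -
  have p: "partial j q = (\<lambda>x. 2 * (Q *v x) $ j)" for j
    using partial_eq[OF has_derivative_q] by (intro ext) (simp add: inner_axis)
  have "Hess q x $ i $ j = 2 * Q $ j $ i" for i j
  proof -
    have "bounded_linear (\<lambda>z. 2 * (Q *v z) $ j)"
      using bounded_linear_const_mult[OF bounded_linear_compose[OF bounded_linear_vec_nth[of j] matrix_vector_mul_bounded_linear[of Q]], of 2]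
      by (simp add: o_def)
    from partial_eq[OF bounded_linear_imp_has_derivative[OF this], of i x]
    show ?thesis by (simp add: Hess_def p matrix_vector_mult_basis column_def)
  qed
  then have "sym_inner (Hess q x) A = 2 * (\<Sum>i\<in>UNIV. \<Sum>j\<in>UNIV. A $ j $ i * Q $ j $ i)"
    by (simp add: sym_inner_eq sum_distrib_left mult_ac)
  also have "(\<Sum>i\<in>UNIV. \<Sum>j\<in>UNIV. A $ j $ i * Q $ j $ i) = (\<Sum>i\<in>UNIV. (A ** Q) $ i $ i)"
  proof -
    have "A $ j $ i = A $ i $ j" for i j
      using arg_cong[OF A_sym, of "\<lambda>M. M $ i $ j"] by (simp add: transpose_def)
    then show ?thesis by (simp add: matrix_matrix_mult_def)
  qed
  also have "\<dots> = real CARD('n)" by (simp add: AQ mat_def)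
  finally show ?thesis by simp
qed

lemma mean_translate:
  assumes "f \<in> borel_measurable borel" "\<And>x. \<bar>f x\<bar> \<le> B"
  shows "mean r (\<lambda>x. f (x + y) - c) x = mean r f (x + y) - c"
proof -
  have "mean r (\<lambda>x. f (x + y) - c) x = (\<integral>z. f ((x + y) + r *\<^sub>R z) * \<kappa> z - c * \<kappa> z \<partial>lborel)"
    unfolding mean_def by (simp add: left_diff_distrib add_ac)
  also have "\<dots> = mean r f (x + y) - (\<integral>z. c * \<kappa> z \<partial>lborel)"
    unfolding mean_def
    by (rule Bochner_Integration.integral_diff[OF integrable_mean_bounded[OF assms] integrable_mult_right[OF integrable_\<kappa>_1]])
  finally show ?thesis by (simp add: integral_\<kappa>)
qed

lemma locally_submean_translate:
  assumes f: "f \<in> borel_measurable borel" "\<And>x. \<bar>f x\<bar> \<le> B" "locally_submean X Q f"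
  shows "locally_submean {x. x + y \<in> X} Q (\<lambda>x. f (x + y) - c)"
  unfolding locally_submean_def
proof (intro allI impI)
  fix K assume K: "compact K \<and> K \<subseteq> {x. x + y \<in> X}"
  have "compact ((\<lambda>x. x + y) ` K)" using K by (intro compact_continuous_image continuous_intros) simp
  moreover have "(\<lambda>x. x + y) ` K \<subseteq> X" using K by auto
  ultimately obtain r0 where r0: "r0 > 0" "\<And>x r. x \<in> (\<lambda>x. x + y) ` K \<Longrightarrow> 0 < r \<Longrightarrow> r < r0 \<Longrightarrow> f x \<le> mean r f x"
    using locally_submeanD[OF f(3)] by blast
  then show "\<exists>r0>0. \<forall>x\<in>K. \<forall>r. 0 < r \<and> r < r0 \<longrightarrow> f (x + y) - c \<le> mean r (\<lambda>x. f (x + y) - c) x"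
    unfolding mean_translate[OF f(1,2)] by (intro exI[of _ r0]) auto
qed

text \<open>The radii admitted by the mean value inequality for distributions do not depend on the
  function, so the inequality survives a pointwise supremum.\<close>

lemma locally_submean_SUP:
  assumes A: "A \<in> polar_cone P" and X: "open X" and V: "V \<subseteq> PSH P X"
    and f: "f \<in> borel_measurable borel" "\<And>x. \<bar>f x\<bar> \<le> B"
    and sup: "\<And>x. x \<in> X \<Longrightarrow> ereal (f x) = (SUP v\<in>V. v x)"
  shows "locally_submean X Q f"
  unfolding locally_submean_def
proof (intro allI impI)
  fix K assume K: "compact K \<and> K \<subseteq> X"
  then obtain e where e: "e > 0" "\<And>x r. x \<in> K \<Longrightarrow> r < e \<Longrightarrow> cball x r \<subseteq> X"
    using compact_cball_radius[of K X] X by blast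
  have "f x \<le> mean r f x" if x: "x \<in> K" and r: "0 < r" "r < e" for x r
  proof -
    define G where "G z = indicator (cball x r) z * f z" for z
    have "(SUP v\<in>V. v x) \<le> ereal (mean r G x)"
    proof (rule SUP_least)
      fix v assume v: "v \<in> V"
      show "v x \<le> ereal (mean r G x)"
      proof (rule PSH_le_mean[OF A subsetD[OF V v] X r(1) e(2)[OF x r(2)]])
        show "integrable lborel G" unfolding G_def by (rule integrable_cball_bounded[OF f])
        fix z assume z: "z \<in> cball x r"
        then have "z \<in> X" using e(2)[OF x r(2)] by blast
        then have "v z \<le> ereal (f z)" using sup[of z] SUP_upper[OF v, of "\<lambda>v. v z"] by simp
        then show "v z \<le> ereal (G z)" using z by (simp add: G_def)
      qed
    qed
    moreover have "mean r G x = mean r f x" by (rule mean_cong[OF r(1)]) (simp add: G_def)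
    moreover have "x \<in> X" using x K by blast
    ultimately have "ereal (f x) \<le> ereal (mean r f x)" using sup[of x] by simp
    then show ?thesis by simp
  qed
  then show "\<exists>r0>0. \<forall>x\<in>K. \<forall>r. 0 < r \<and> r < r0 \<longrightarrow> f x \<le> mean r f x"
    using e(1) by blast
qed

text \<open>Members of \<open>PSH\<close> may be unbounded below or take the value
  \<open>-\<infinity>\<close>; truncation produces the bounded real functions that can be translated
  and glued. The mean of \<open>f\<close> dominates both \<open>v x\<close> and
  \<open>m\<close>.\<close>

lemma locally_submean_truncation:
  assumes A: "A \<in> polar_cone P" and X: "open X" and v: "v \<in> PSH P X"
    and f: "f \<in> borel_measurable borel" "\<And>x. \<bar>f x\<bar> \<le> B"
    and max: "\<And>x. x \<in> X \<Longrightarrow> ereal (f x) = max (v x) (ereal m)"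
  shows "locally_submean X Q f"
  unfolding locally_submean_def
proof (intro allI impI)
  fix K assume K: "compact K \<and> K \<subseteq> X"
  then obtain e where e: "e > 0" "\<And>x r. x \<in> K \<Longrightarrow> r < e \<Longrightarrow> cball x r \<subseteq> X"
    using compact_cball_radius[of K X] X by blast
  have "f x \<le> mean r f x" if x: "x \<in> K" and r: "0 < r" "r < e" for x r
  proof -
    define G where "G z = indicator (cball x r) z * f z" for z
    have G: "integrable lborel G" unfolding G_def by (rule integrable_cball_bounded[OF f])
    have Gf: "G z = f z" "ereal (f z) = max (v z) (ereal m)" if "z \<in> cball x r" for z
      using that e(2)[OF x r(2)] max[of z] by (auto simp: G_def)
    have "v x \<le> ereal (mean r G x)"
    proof (rule PSH_le_mean[OF A v X r(1) e(2)[OF x r(2)] G])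
      fix z assume z: "z \<in> cball x r"
      show "v z \<le> ereal (G z)" using Gf[OF z] by simp
    qed
    moreover have "m \<le> mean r G x"
    proof -
      have "mean r (\<lambda>z. indicator (cball x r) z * m) x \<le> mean r G x"
      proof (rule mean_mono_AE[OF r(1) _ G])
        show "integrable lborel (\<lambda>z. indicator (cball x r) z * m)"
          by (rule integrable_cball_bounded[of "\<lambda>_. m" "\<bar>m\<bar>"]) auto
        show "AE z in lborel. z \<in> cball x r \<longrightarrow> indicator (cball x r) z * m \<le> G z"
        proof (intro AE_I2 impI)
          fix z assume z: "z \<in> cball x r"
          have "ereal m \<le> ereal (f z)" using Gf(2)[OF z] by simp
          then show "indicator (cball x r) z * m \<le> G z" using z Gf(1)[OF z] by simp
        qed
      qed
      moreover have "mean r (\<lambda>z. indicator (cball x r) z * m) x = mean r (\<lambda>_. m) x"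
        by (rule mean_cong[OF r(1)]) simp
      ultimately show ?thesis by (simp add: mean_const)
    qed
    moreover have "mean r G x = mean r f x" by (rule mean_cong[OF r(1)]) (rule Gf(1))
    moreover have "x \<in> X" using x K by blast
    ultimately have "ereal (f x) \<le> ereal (mean r f x)" using max[of x] by simp
    then show ?thesis by simp
  qed
  then show "\<exists>r0>0. \<forall>x\<in>K. \<forall>r. 0 < r \<and> r < r0 \<longrightarrow> f x \<le> mean r f x"
    using e(1) by blast
qed

end

lemma usc_on_translate_minus:
  assumes "usc_on S (\<lambda>x::'a::real_normed_vector. ereal (f x))"
  shows "usc_on {x. x + y \<in> S} (\<lambda>x. ereal (f (x + y) - c))"
  unfolding usc_on_def
proof (intro ballI conjI allI impI)
  fix x e assume x: "x \<in> {x. x + y \<in> S}" and "ereal (f (x + y) - c) < e"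
  then have lt: "ereal (f (x + y)) < e + ereal c" by (cases e) auto
  then have "\<forall>\<^sub>F z in at (x + y) within S. ereal (f z) < e + ereal c"
    using assms x unfolding usc_on_def by simp
  then obtain d where d: "d > 0" "\<And>z. z \<in> S \<Longrightarrow> z \<noteq> x + y \<Longrightarrow> dist z (x + y) < d \<Longrightarrow> ereal (f z) < e + ereal c"
    unfolding eventually_at by blast
  have "ereal (f (z + y) - c) < e" if z: "z \<in> {x. x + y \<in> S}" "z \<noteq> x" "dist z x < d" for z
  proof -
    have "ereal (f (z + y)) < e + ereal c" using d(2)[of "z + y"] z by simp
    then show ?thesis by (cases e) auto
  qed
  then show "\<forall>\<^sub>F z in at x within {x. x + y \<in> S}. ereal (f (z + y) - c) < e"
    unfolding eventually_at using d(1) by blast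
qed simp

lemma infdist_frontier_le:
  fixes \<Omega> :: "'a::real_normed_vector set"
  assumes "x \<in> \<Omega>" "z \<notin> \<Omega>"
  shows "\<exists>k\<in>frontier \<Omega>. dist x k \<le> dist x z \<and> k \<in> closed_segment x z"
proof -
  have "closed_segment x z \<inter> frontier \<Omega> \<noteq> {}"
    by (rule connected_Int_frontier) (use assms in auto)
  then obtain k where k: "k \<in> closed_segment x z" "k \<in> frontier \<Omega>" by blast
  have "dist x k \<le> dist x z" using segment_bound(1)[OF k(1)] by (simp add: dist_norm norm_minus_commute)
  then show ?thesis using k by blast
qed

subsection \<open>The Perron function\<close>

locale dirichlet_setting =
  fixes P :: "(real^'n::finite^'n) set" and \<Omega> :: "(real^'n) set" and \<phi> :: "real^'n \<Rightarrow> real"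
  assumes P: "elliptic_cone P" and \<Omega>: "open \<Omega>" "bounded \<Omega>" "\<Omega> \<noteq> {}"
    and conv: "smooth_strictly_convex_boundary P \<Omega>"
    and \<phi>: "continuous_on (frontier \<Omega>) \<phi>"
begin

lemma frontier_nonempty: "frontier \<Omega> \<noteq> {}"
  using \<Omega> by (auto simp: frontier_eq_empty)

lemma compact_closure: "compact (closure \<Omega>)"
  using \<Omega>(2) by simp

lemma closure_eq: "closure \<Omega> = \<Omega> \<union> frontier \<Omega>" and frontier_disjoint: "x \<in> frontier \<Omega> \<Longrightarrow> x \<notin> \<Omega>"
  using \<Omega>(1) closure_Un_frontier[of \<Omega>] by (auto simp: frontier_def interior_open closure_def)

lemma phi_bounded: "\<exists>M. \<forall>x\<in>frontier \<Omega>. \<bar>\<phi> x\<bar> \<le> M"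
proof -
  have "compact (frontier \<Omega>)" using \<Omega>(2) by (rule compact_frontier_bounded)
  from compact_imp_bounded[OF compact_continuous_image[OF \<phi> this]]
  show ?thesis by (auto simp: bounded_iff)
qed

lemma kernel_exists: "\<exists>A Q. A \<in> polar_cone P \<and> elliptic_kernel A Q"
proof -
  obtain A0 where A0: "A0 \<in> polar_cone P" "positive_definite A0"
    "\<forall>A\<in>polar_cone P. \<forall>t>0. positive_definite (A + t *\<^sub>R A0)"
    by (rule elliptic_coneE[OF P])
  obtain c Q where c: "0 < c" "elliptic_kernel (c *\<^sub>R A0) Q"
    by (rule positive_definite_elliptic_kernel[OF A0(2)])
  moreover have "c *\<^sub>R A0 \<in> polar_cone P" using A0(1) c(1) by (intro polar_cone_scaleR) simp_all
  ultimately show ?thesis by blast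
qed

text \<open>\<open>max_principle\<close> asks for a strictly subharmonic summand: a small multiple
  of \<open>q\<close>, which is non-negative and at most \<open>e\<close> on the closure of
  \<open>\<Omega>\<close>.\<close>

lemma PSH_boundary_le:
  assumes v: "v \<in> PSH_boundary P \<Omega> \<phi>" and M: "\<And>x. x \<in> frontier \<Omega> \<Longrightarrow> \<phi> x \<le> M" and x: "x \<in> closure \<Omega>"
  shows "v x \<le> ereal M"
proof (rule ereal_le_epsilon2)
  fix e :: real assume e: "0 < e"
  obtain A Q where A: "A \<in> polar_cone P" and k: "elliptic_kernel A Q" using kernel_exists by blast
  interpret elliptic_kernel A Q by (rule k)
  have v': "v \<in> PSH P \<Omega>" "usc_on (closure \<Omega>) v" "\<And>y. y \<in> frontier \<Omega> \<Longrightarrow> v y \<le> ereal (\<phi> y)"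
    using v by (auto simp: PSH_boundary_def)
  have cq: "continuous_on (closure \<Omega>) q" using continuous_on_q[OF continuous_on_id] by simp
  obtain B where B: "B > 0" "\<And>y. y \<in> closure \<Omega> \<Longrightarrow> \<bar>q y\<bar> \<le> B"
    using compact_imp_bounded[OF compact_continuous_image[OF cq compact_closure]] by (auto simp: bounded_pos)
  define \<eta> where "\<eta> = e / B"
  have \<eta>: "0 < \<eta>" "\<eta> * B = e" using e B(1) by (simp_all add: \<eta>_def)
  have "v x + ereal (\<eta> * q x) \<le> ereal (M + e)"
  proof (rule max_principle[OF A v'(1) \<Omega>(1) compact_closure v'(2) \<Omega>(1) closure_subset subset_refl])
    show "continuous_on (closure \<Omega>) (\<lambda>x. \<eta> * q x)" using cq by (intro continuous_intros)
    show "Ck_on 2 \<Omega> (\<lambda>x. \<eta> * q x)"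
      by (rule Ck_on_subset[OF Ck_on_mult[OF open_UNIV Ck_on_const Ck_on_q]]) simp
    show "0 < sym_inner (Hess (\<lambda>x. \<eta> * q x) y) A" for y
      using Hess_cmult[OF open_UNIV Ck_on_q, of y \<eta>] Hess_q_pos[of y] \<eta>(1)
      by (simp add: sym_inner_scaleR_left)
    fix y assume y: "y \<in> closure \<Omega>" "y \<notin> \<Omega>"
    then have fr: "y \<in> frontier \<Omega>" using closure_eq by blast
    have "\<eta> * q y \<le> \<eta> * B" using B(2)[OF y(1)] \<eta>(1) by (intro mult_left_mono) auto
    then have "ereal (\<eta> * q y) \<le> ereal e" using \<eta>(2) by simp
    moreover have "v y \<le> ereal M" using v'(3)[OF fr] M[OF fr] by (meson ereal_less_eq(3) order_trans)
    ultimately have "v y + ereal (\<eta> * q y) \<le> ereal M + ereal e" by (rule add_mono[rotated])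
    then show "v y + ereal (\<eta> * q y) \<le> ereal (M + e)" by simp
  qed (rule x)
  moreover have "v x \<le> v x + ereal (\<eta> * q x)"
    using \<eta>(1) q_nonneg[of x] by (cases "v x") auto
  ultimately show "v x \<le> ereal M + ereal e" by simp
qed

text \<open>Real-valued competitors in a form fit for gluing: total, bounded and Borel, so that
  means over the whole space make sense, and with the mean inequality for all kernels in place of
  the distributional condition.\<close>

definition subsolution :: "(real^'n \<Rightarrow> real) \<Rightarrow> bool" where
  "subsolution g \<longleftrightarrow> g \<in> borel_measurable borel \<and> (\<exists>B. \<forall>x. \<bar>g x\<bar> \<le> B) \<and>
     usc_on (closure \<Omega>) (\<lambda>x. ereal (g x)) \<and>
     (\<forall>A\<in>polar_cone P. \<forall>Q. elliptic_kernel A Q \<longrightarrow> locally_submean \<Omega> Q g) \<and>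
     (\<forall>x\<in>frontier \<Omega>. g x \<le> \<phi> x)"

lemma subsolution_PSH_boundary:
  assumes "subsolution g"
  shows "(\<lambda>x. ereal (g x)) \<in> PSH_boundary P \<Omega> \<phi>"
proof -
  obtain B where B: "\<And>x. \<bar>g x\<bar> \<le> B" using assms unfolding subsolution_def by blast
  have g: "g \<in> borel_measurable borel" "usc_on (closure \<Omega>) (\<lambda>x. ereal (g x))"
    "\<And>A Q. A \<in> polar_cone P \<Longrightarrow> elliptic_kernel A Q \<Longrightarrow> locally_submean \<Omega> Q g"
    "\<forall>x\<in>frontier \<Omega>. g x \<le> \<phi> x"
    using assms unfolding subsolution_def by blast+
  have "(\<lambda>x. ereal (g x)) \<in> PSH P \<Omega>"
    by (rule PSH_I[OF P \<Omega>(1) g(1) B usc_on_subset[OF g(2) closure_subset] refl g(3)])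
  then show ?thesis using g by (simp add: PSH_boundary_def)
qed

lemma subsolution_const: "(\<And>x. x \<in> frontier \<Omega> \<Longrightarrow> m \<le> \<phi> x) \<Longrightarrow> subsolution (\<lambda>x. m)"
  unfolding subsolution_def
  by (auto intro!: usc_on_continuous elliptic_kernel.locally_submean_const exI[of _ "\<bar>m\<bar>"])

lemma subsolution_glue:
  assumes a: "subsolution a" and D: "open D" and \<eta>: "\<eta> > 0"
    and b: "b \<in> borel_measurable borel" "\<And>x. \<bar>b x\<bar> \<le> C" "usc_on (closure \<Omega> \<inter> D) (\<lambda>x. ereal (b x))"
      "\<And>A Q. A \<in> polar_cone P \<Longrightarrow> elliptic_kernel A Q \<Longrightarrow> locally_submean (\<Omega> \<inter> D) Q b"
      "\<And>x. x \<in> frontier \<Omega> \<Longrightarrow> x \<in> D \<Longrightarrow> b x \<le> \<phi> x"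
    and le: "\<And>x. x \<in> closure \<Omega> \<Longrightarrow> x \<in> D \<Longrightarrow> \<not> ball x \<eta> \<subseteq> D \<Longrightarrow> b x \<le> a x"
  shows "subsolution (\<lambda>x. if x \<in> D then max (a x) (b x) else a x)" (is "subsolution ?g")
  unfolding subsolution_def
proof (intro conjI ballI allI impI)
  obtain B where B: "\<And>x. \<bar>a x\<bar> \<le> B" using a unfolding subsolution_def by blast
  have [measurable]: "a \<in> borel_measurable borel" "b \<in> borel_measurable borel" "D \<in> sets borel"
    using a b(1) D by (auto simp: subsolution_def)
  show "?g \<in> borel_measurable borel" by measurable
  have "\<bar>?g x\<bar> \<le> max B C" for x using B[of x] b(2)[of x] by (auto simp: max_def)
  then show "\<exists>B. \<forall>x. \<bar>?g x\<bar> \<le> B" by blast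
  show "usc_on (closure \<Omega>) (\<lambda>x. ereal (?g x))"
    by (rule usc_on_glue[OF D \<eta> _ b(3) le]) (use a in \<open>simp_all add: subsolution_def\<close>)
  show "?g x \<le> \<phi> x" if "x \<in> frontier \<Omega>" for x
    using a b(5) that by (auto simp: subsolution_def)
  fix A Q assume A: "A \<in> polar_cone P" and k: "elliptic_kernel A Q"
  have sa: "locally_submean \<Omega> Q a" using a A k unfolding subsolution_def by blast
  have "a \<in> borel_measurable borel" by measurable
  from elliptic_kernel.locally_submean_glue[OF k \<Omega>(1) D \<eta> this B sa b(1,2) b(4)[OF A k]] le closure_subset
  show "locally_submean \<Omega> Q ?g" by blast
qed

text \<open>\<open>w\<close> is the maximum of \<open>- M\<close> and \<open>h1\<close> near the
  boundary and \<open>- M\<close> elsewhere; the two pieces fit because \<open>h1 \<le> - M\<close>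
  on the inner half of the tube. The upper bound comes from the maximum principle for
  \<open>v + h2\<close> on the tube. Both barriers are \<open>3 * \<epsilon>\<close>-close near the
  boundary, so \<open>w\<close> controls all competitors at nearby points simultaneously.\<close>

lemma barrier:
  assumes \<epsilon>: "0 < \<epsilon>" and M: "\<And>x. x \<in> frontier \<Omega> \<Longrightarrow> \<bar>\<phi> x\<bar> \<le> M"
  obtains w \<delta> where "0 < \<delta>" "subsolution w" "\<forall>x. - M \<le> w x"
    "\<forall>x\<in>frontier \<Omega>. \<phi> x \<le> w x + 3 * \<epsilon>"
    "\<forall>v\<in>PSH_boundary P \<Omega> \<phi>. \<forall>x\<in>closure \<Omega>. \<forall>x'\<in>closure \<Omega>.
      infdist x (frontier \<Omega>) < \<delta> \<longrightarrow> dist x x' < \<delta> \<longrightarrow> v x' \<le> ereal (w x + 3 * \<epsilon>)"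
proof -
  obtain U h1 h2 d \<delta> where U: "open U" and d: "0 < d" "0 < \<delta>" "\<delta> < d / 2"
    and Z: "compact {x. infdist x (frontier \<Omega>) \<le> d}" "{x. infdist x (frontier \<Omega>) \<le> d} \<subseteq> U"
    and C2: "Ck_on 2 U h1" "Ck_on 2 U h2"
    and psh: "\<forall>x. infdist x (frontier \<Omega>) \<le> d \<longrightarrow> (\<forall>A\<in>polar_cone P. A \<noteq> 0 \<longrightarrow>
      0 < sym_inner (Hess h1 x) A \<and> 0 < sym_inner (Hess h2 x) A)"
    and bd: "\<forall>x\<in>frontier \<Omega>. h1 x \<le> \<phi> x \<and> \<phi> x \<le> - h2 x"
    and ring: "\<forall>x\<in>\<Omega>. d / 2 \<le> infdist x (frontier \<Omega>) \<longrightarrow> infdist x (frontier \<Omega>) \<le> d \<longrightarrow> h1 x \<le> - M \<and> h2 x \<le> - M"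
    and near: "\<forall>x x'. infdist x (frontier \<Omega>) < \<delta> \<longrightarrow> dist x x' < \<delta> \<longrightarrow> - h2 x' \<le> h1 x + 3 * \<epsilon>"
    by (rule boundary_barriers[OF P \<Omega> conv \<phi> \<epsilon>])
  define D where "D = {x. infdist x (frontier \<Omega>) < d}"
  define Y where "Y = {x. infdist x (frontier \<Omega>) \<le> d}"
  have D: "open D" unfolding D_def by (intro open_Collect_less continuous_intros)
  have DY: "D \<subseteq> Y" "Y \<subseteq> U" using Z(2) by (auto simp: D_def Y_def)
  have Y: "compact Y" using Z(1) by (simp add: Y_def)
  have frD: "x \<in> D" if "x \<in> frontier \<Omega>" for x using that d(1) by (simp add: D_def)
  define b where "b x = indicator Y x *\<^sub>R h1 x" for x
  have cY: "continuous_on Y h1" "continuous_on Y h2"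
    using C2 DY by (auto intro: continuous_on_subset[OF Ck_on_continuous])
  have bm: "b \<in> borel_measurable borel"
    unfolding b_def by (rule borel_measurable_continuous_on_indicator[OF _ cY(1)]) (use Y in \<open>simp add: borel_compact\<close>)
  obtain B where B: "B > 0" "\<And>x. x \<in> Y \<Longrightarrow> \<bar>h1 x\<bar> \<le> B"
    using compact_imp_bounded[OF compact_continuous_image[OF cY(1) Y]] by (auto simp: bounded_pos)
  have bB: "\<bar>b x\<bar> \<le> B" for x using B by (cases "x \<in> Y") (simp_all add: b_def)
  have bh: "b x = h1 x" if "x \<in> D" for x using that DY by (auto simp: b_def)
  define w where "w x = (if x \<in> D then max (- M) (b x) else - M)" for x
  have d2: "0 < d / 2" using d(1) by simp
  have w: "subsolution w"
    unfolding w_def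
  proof (rule subsolution_glue[OF subsolution_const D d2 bm bB])
    show "- M \<le> \<phi> x" if "x \<in> frontier \<Omega>" for x using M[OF that] by linarith
    have "usc_on (closure \<Omega> \<inter> D) (\<lambda>x. ereal (h1 x))"
      by (rule usc_on_continuous[OF continuous_on_subset[OF cY(1)]]) (use DY in auto)
    then show "usc_on (closure \<Omega> \<inter> D) (\<lambda>x. ereal (b x))"
      by (rule usc_on_cong[rotated]) (simp add: bh)
    show "locally_submean (\<Omega> \<inter> D) Q b" if A: "A \<in> polar_cone P" "elliptic_kernel A Q" for A Q
    proof -
      have o: "open (\<Omega> \<inter> D)" using \<Omega>(1) D by blast
      have "locally_submean (\<Omega> \<inter> D) Q h1"
      proof (rule elliptic_kernel.locally_submean_C2[OF A(2) o])
        show "Ck_on 2 (\<Omega> \<inter> D) h1" by (rule Ck_on_subset[OF C2(1)]) (use DY in blast)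
        show "0 < sym_inner (Hess h1 x) A" if "x \<in> \<Omega> \<inter> D" for x
          using psh that A(1) elliptic_kernel_nonzero[OF A(2)] by (simp add: D_def)
      qed
      then show ?thesis
        by (rule elliptic_kernel.locally_submean_cong[OF A(2) o, rotated]) (simp add: bh)
    qed
    show "b x \<le> \<phi> x" if "x \<in> frontier \<Omega>" "x \<in> D" for x using bd that bh by simp
    show "b x \<le> - M" if x: "x \<in> closure \<Omega>" "x \<in> D" "\<not> ball x (d / 2) \<subseteq> D" for x
    proof -
      obtain z where z: "z \<in> ball x (d / 2)" "z \<notin> D" using x(3) by blast
      have "infdist z (frontier \<Omega>) \<le> infdist x (frontier \<Omega>) + dist z x" by (rule infdist_triangle)
      then have *: "d / 2 \<le> infdist x (frontier \<Omega>)" using z by (simp add: D_def dist_commute)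
      then have "x \<notin> frontier \<Omega>" using d(1) by auto
      then have "x \<in> \<Omega>" using x(1) closure_eq by blast
      then show ?thesis using ring * x(2) bh by (simp add: D_def)
    qed
  qed
  have upper: "v x \<le> ereal (- h2 x)" if v: "v \<in> PSH_boundary P \<Omega> \<phi>" and x: "x \<in> closure \<Omega>" "x \<in> Y" for v x
  proof -
    obtain A Q where A: "A \<in> polar_cone P" and k: "elliptic_kernel A Q" using kernel_exists by blast
    have v': "v \<in> PSH P \<Omega>" "usc_on (closure \<Omega>) v" "\<And>y. y \<in> frontier \<Omega> \<Longrightarrow> v y \<le> ereal (\<phi> y)"
      using v by (auto simp: PSH_boundary_def)
    have "v x + ereal (h2 x) \<le> ereal 0"
    proof (rule elliptic_kernel.max_principle[OF k A v'(1) \<Omega>(1), where S="closure \<Omega> \<inter> Y" and T="\<Omega> \<inter> D"])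
      show "compact (closure \<Omega> \<inter> Y)" using compact_closure Y by (simp add: compact_Int)
      show "usc_on (closure \<Omega> \<inter> Y) v" by (rule usc_on_subset[OF v'(2)]) blast
      show "open (\<Omega> \<inter> D)" using \<Omega>(1) D by blast
      show "\<Omega> \<inter> D \<subseteq> closure \<Omega> \<inter> Y" using closure_subset DY by blast
      show "continuous_on (closure \<Omega> \<inter> Y) h2" by (rule continuous_on_subset[OF cY(2)]) blast
      show "Ck_on 2 (\<Omega> \<inter> D) h2" by (rule Ck_on_subset[OF C2(2)]) (use DY in blast)
      show "0 < sym_inner (Hess h2 y) A" if "y \<in> \<Omega> \<inter> D" for y
        using psh that A elliptic_kernel_nonzero[OF k] by (simp add: D_def)
      \<comment> \<open>Such a \<open>y\<close> is a boundary point or has distance exactly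
        \<open>d\<close> from the boundary; in the latter case \<open>v y \<le> M\<close> and
        \<open>h2 y \<le> - M\<close>.\<close>
      fix y assume y: "y \<in> closure \<Omega> \<inter> Y" "y \<notin> \<Omega> \<inter> D"
      show "v y + ereal (h2 y) \<le> ereal 0"
      proof (cases "y \<in> frontier \<Omega>")
        case True
        then have "v y \<le> ereal (\<phi> y)" "\<phi> y \<le> - h2 y" using v'(3) bd by auto
        then show ?thesis by (cases "v y") auto
      next
        case False
        then have "y \<in> \<Omega>" using y(1) closure_eq by blast
        moreover from this have "infdist y (frontier \<Omega>) = d" using y by (auto simp: D_def Y_def)
        ultimately have "h2 y \<le> - M" using ring d(1) by simp
        moreover have "v y \<le> ereal M"
          by (rule PSH_boundary_le[OF v]) (use M y(1) in \<open>auto simp: abs_le_iff\<close>)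
        ultimately show ?thesis by (cases "v y") auto
      qed
    qed (use x in simp_all)
    then show ?thesis by (cases "v x") auto
  qed
  have wh: "h1 x \<le> w x" if "x \<in> D" for x using that bh by (simp add: w_def)
  show ?thesis
  proof (rule that[of \<delta> w])
    show "0 < \<delta>" by (rule d)
    show "subsolution w" by (rule w)
    show "\<forall>x. - M \<le> w x" by (simp add: w_def)
    show "\<forall>x\<in>frontier \<Omega>. \<phi> x \<le> w x + 3 * \<epsilon>"
    proof
      fix x assume x: "x \<in> frontier \<Omega>"
      have "- h2 x \<le> h1 x + 3 * \<epsilon>" using near x d(2) by simp
      then show "\<phi> x \<le> w x + 3 * \<epsilon>" using bd x wh[OF frD[OF x]] by force
    qed
    show "\<forall>v\<in>PSH_boundary P \<Omega> \<phi>. \<forall>x\<in>closure \<Omega>. \<forall>x'\<in>closure \<Omega>.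
      infdist x (frontier \<Omega>) < \<delta> \<longrightarrow> dist x x' < \<delta> \<longrightarrow> v x' \<le> ereal (w x + 3 * \<epsilon>)"
    proof (intro ballI impI)
      fix v x x' assume v: "v \<in> PSH_boundary P \<Omega> \<phi>" and x: "x' \<in> closure \<Omega>"
        "infdist x (frontier \<Omega>) < \<delta>" "dist x x' < \<delta>"
      have "infdist x' (frontier \<Omega>) \<le> infdist x (frontier \<Omega>) + dist x' x" by (rule infdist_triangle)
      then have "x' \<in> Y" using x d(3) by (simp add: Y_def dist_commute)
      then have "v x' \<le> ereal (- h2 x')" by (rule upper[OF v x(1)])
      also have "- h2 x' \<le> h1 x + 3 * \<epsilon>" using near x by blast
      also have "h1 x \<le> w x" using x(2) d by (intro wh) (simp add: D_def)
      finally show "v x' \<le> ereal (w x + 3 * \<epsilon>)" by simp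
    qed
  qed
qed

text \<open>Walsh's argument: near the boundary the translate \<open>v(x + y) - 3\<epsilon>\<close> lies below the barrier,
  so that gluing it to the barrier gives a competitor.\<close>

lemma translate_le_subsolution:
  assumes \<epsilon>: "0 < \<epsilon>"
  obtains \<delta> where "0 < \<delta>"
    "\<forall>v\<in>PSH_boundary P \<Omega> \<phi>. \<forall>x\<in>closure \<Omega>. \<forall>x'\<in>closure \<Omega>. dist x x' < \<delta> \<longrightarrow>
      (\<exists>g. subsolution g \<and> v x' \<le> ereal (g x + 3 * \<epsilon>))"
proof -
  obtain M where M: "\<And>x. x \<in> frontier \<Omega> \<Longrightarrow> \<bar>\<phi> x\<bar> \<le> M" using phi_bounded by blast
  obtain w \<delta> where \<delta>: "0 < \<delta>" and w: "subsolution w" "\<forall>x. - M \<le> w x"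
    and near: "\<forall>v\<in>PSH_boundary P \<Omega> \<phi>. \<forall>x\<in>closure \<Omega>. \<forall>x'\<in>closure \<Omega>.
      infdist x (frontier \<Omega>) < \<delta> \<longrightarrow> dist x x' < \<delta> \<longrightarrow> v x' \<le> ereal (w x + 3 * \<epsilon>)"
    using barrier[OF \<epsilon> M] by metis
  have "\<exists>g. subsolution g \<and> v x' \<le> ereal (g x + 3 * \<epsilon>)"
    if v: "v \<in> PSH_boundary P \<Omega> \<phi>" and x: "x \<in> closure \<Omega>" "x' \<in> closure \<Omega>" "dist x x' < \<delta> / 2" for v x x'
  proof (cases "infdist x (frontier \<Omega>) < \<delta>")
    case True
    then have "v x' \<le> ereal (w x + 3 * \<epsilon>)" using near v x \<delta> by simp
    then show ?thesis using w(1) by blast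
  next
    case False
    have v': "v \<in> PSH P \<Omega>" "usc_on \<Omega> v" using v by (auto simp: PSH_boundary_def PSH_def USC_def)
    have x\<Omega>: "x \<in> \<Omega>" using False \<delta> x(1) closure_eq by auto
    have x'\<Omega>: "x' \<in> \<Omega>"
    proof (rule ccontr)
      assume "x' \<notin> \<Omega>"
      then have "infdist x (frontier \<Omega>) \<le> dist x x'" using x(2) closure_eq by (intro infdist_le) blast
      then show False using False x(3) \<delta> by simp
    qed
    define y where "y = x' - x"
    have y: "norm y < \<delta> / 2" using x(3) by (simp add: y_def dist_norm norm_minus_commute)
    have vM: "v z \<le> ereal M" if "z \<in> closure \<Omega>" for z
      by (rule PSH_boundary_le[OF v _ that]) (use M in \<open>auto simp: abs_le_iff\<close>)
    obtain x0 where "x0 \<in> frontier \<Omega>" using frontier_nonempty by blast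
    then have M0: "0 \<le> M" using M[of x0] by linarith
    \<comment> \<open>Cutting off at \<open>- M\<close> is harmless: only an upper bound for
      \<open>v x'\<close> is sought, and \<open>w \<ge> - M\<close> keeps the truncated function
      comparable with the barrier.\<close>
    define t where "t z = indicator \<Omega> z * real_of_ereal (max (v z) (ereal (- M)))" for z
    have t_eq: "ereal (t z) = max (v z) (ereal (- M))" if "z \<in> \<Omega>" for z
      using that vM[of z] closure_subset by (cases "v z") (auto simp: t_def max_def)
    have tm: "t \<in> borel_measurable borel"
      unfolding t_def
      by (rule usc_on_real_measurable[OF usc_on_max[OF v'(2) usc_on_continuous[OF continuous_on_const]]])
        (use \<Omega>(1) in simp)
    have tM: "\<bar>t z\<bar> \<le> M" for z
    proof (cases "z \<in> \<Omega>")
      case True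
      then have "max (v z) (ereal (- M)) \<le> ereal M" using vM[of z] closure_subset M0 by auto
      moreover have "ereal (- M) \<le> max (v z) (ereal (- M))" by simp
      ultimately have "ereal (t z) \<le> ereal M" "ereal (- M) \<le> ereal (t z)" unfolding t_eq[OF True] by simp_all
      then show ?thesis by (simp add: abs_le_iff)
    qed (simp add: t_def M0)
    have t_usc: "usc_on \<Omega> (\<lambda>z. ereal (t z))"
      by (rule usc_on_cong[OF t_eq[symmetric] usc_on_max[OF v'(2) usc_on_continuous[OF continuous_on_const]]])
    have t_sub: "locally_submean \<Omega> Q t" if "A \<in> polar_cone P" "elliptic_kernel A Q" for A Q
      by (rule elliptic_kernel.locally_submean_truncation[OF that(2,1) \<Omega>(1) v'(1) tm tM t_eq])
    define b where "b z = t (z + y) - 3 * \<epsilon>" for z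
    define D where "D = {z. z + y \<in> \<Omega>}"
    have D: "open D"
      unfolding D_def using continuous_open_vimage[OF \<Omega>(1), of "\<lambda>z. z + y"]
      by (simp add: vimage_def continuous_intros)
    have bw: "b z \<le> w z" if z: "z \<in> closure \<Omega>" "z \<in> D" "infdist z (frontier \<Omega>) < \<delta>" for z
    proof -
      have zy: "z + y \<in> \<Omega>" using z(2) by (simp add: D_def)
      have "dist z (z + y) < \<delta>" using y \<delta> by (simp add: dist_norm)
      moreover have "z + y \<in> closure \<Omega>" using zy closure_subset by blast
      ultimately have "v (z + y) \<le> ereal (w z + 3 * \<epsilon>)" using near v z(1,3) by blast
      moreover have "ereal (- M) \<le> ereal (w z + 3 * \<epsilon>)" using w(2)[rule_format, of z] \<epsilon> by simp
      ultimately have "ereal (t (z + y)) \<le> ereal (w z + 3 * \<epsilon>)" unfolding t_eq[OF zy] by simp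
      then show ?thesis by (simp add: b_def)
    qed
    have \<delta>2: "0 < \<delta> / 2" using \<delta> by simp
    have g: "subsolution (\<lambda>z. if z \<in> D then max (w z) (b z) else w z)"
    proof (rule subsolution_glue[OF w(1) D \<delta>2, of b "M + 3 * \<epsilon>"])
      have [measurable]: "t \<in> borel_measurable borel" by (rule tm)
      show "b \<in> borel_measurable borel" unfolding b_def by measurable
      show "\<bar>b z\<bar> \<le> M + 3 * \<epsilon>" for z using tM[of "z + y"] \<epsilon> unfolding b_def by linarith
      have "usc_on D (\<lambda>z. ereal (b z))"
        unfolding D_def b_def by (rule usc_on_translate_minus[OF t_usc])
      then show "usc_on (closure \<Omega> \<inter> D) (\<lambda>z. ereal (b z))" by (rule usc_on_subset) blast
      show "locally_submean (\<Omega> \<inter> D) Q b" if "A \<in> polar_cone P" "elliptic_kernel A Q" for A Q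
      proof -
        have "locally_submean D Q b"
          unfolding D_def b_def
          by (rule elliptic_kernel.locally_submean_translate[OF that(2) tm tM t_sub[OF that]])
        then show ?thesis unfolding locally_submean_def by blast
      qed
      \<comment> \<open>Boundary points have distance 0 from the boundary, so there the barrier
        controls the translate.\<close>
      show "b z \<le> \<phi> z" if "z \<in> frontier \<Omega>" "z \<in> D" for z
      proof -
        have "b z \<le> w z" using that \<delta> closure_eq by (intro bw) auto
        also have "w z \<le> \<phi> z" using w(1) that(1) by (simp add: subsolution_def)
        finally show ?thesis .
      qed
      \<comment> \<open>A point outside the translated domain \<open>D\<close> lies within
        \<open>\<delta> / 2\<close> of \<open>z\<close>, and the shift \<open>y\<close> is shorter
        than \<open>\<delta> / 2\<close>; together they put the boundary within
        \<open>\<delta>\<close> of \<open>z\<close>.\<close>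
      show "b z \<le> w z" if z: "z \<in> closure \<Omega>" "z \<in> D" "\<not> ball z (\<delta> / 2) \<subseteq> D" for z
      proof (rule bw[OF z(1,2)])
        obtain z' where z': "z' \<in> ball z (\<delta> / 2)" "z' \<notin> D" using z(3) by blast
        have "z + y \<in> \<Omega>" "z' + y \<notin> \<Omega>" using z(2) z'(2) by (auto simp: D_def)
        then obtain k where k: "k \<in> frontier \<Omega>" "dist (z + y) k \<le> dist (z + y) (z' + y)"
          using infdist_frontier_le by blast
        have "infdist z (frontier \<Omega>) \<le> dist z k" by (rule infdist_le[OF k(1)])
        also have "\<dots> \<le> dist z (z + y) + dist (z + y) k" by (rule dist_triangle)
        also have "\<dots> < \<delta>" using k(2) z'(1) y by (simp add: dist_norm)
        finally show "infdist z (frontier \<Omega>) < \<delta>" .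
      qed
    qed
    have "x + y = x'" by (simp add: y_def)
    then have "x \<in> D" using x'\<Omega> by (simp add: D_def)
    then have "t x' - 3 * \<epsilon> \<le> (if x \<in> D then max (w x) (b x) else w x)"
      by (simp add: b_def \<open>x + y = x'\<close>)
    then have "ereal (t x') \<le> ereal ((if x \<in> D then max (w x) (b x) else w x) + 3 * \<epsilon>)" by simp
    moreover have "v x' \<le> ereal (t x')" unfolding t_eq[OF x'\<Omega>] by simp
    ultimately show ?thesis using g by (intro exI[of _ "\<lambda>z. if z \<in> D then max (w z) (b z) else w z"]) (simp only: order_trans simp_thms)
  qed
  moreover have "0 < \<delta> / 2" using \<delta> by simp
  ultimately show ?thesis using that by blast
qed

section \<open>Continuity and plurisubharmonicity of the Perron function\<close>

context
  fixes u :: "real^'n \<Rightarrow> ereal"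
  assumes u: "\<And>x. x \<in> closure \<Omega> \<Longrightarrow> u x = (SUP v \<in> PSH_boundary P \<Omega> \<phi>. v x)"
begin

lemma subsolution_le: "subsolution g \<Longrightarrow> x \<in> closure \<Omega> \<Longrightarrow> ereal (g x) \<le> u x"
  using u SUP_upper[OF subsolution_PSH_boundary, of g "\<lambda>v. v x"] by simp

lemma perron_bounded: "\<exists>M\<ge>0. \<forall>x\<in>closure \<Omega>. ereal (- M) \<le> u x \<and> u x \<le> ereal M"
proof -
  obtain M where M: "\<And>x. x \<in> frontier \<Omega> \<Longrightarrow> \<bar>\<phi> x\<bar> \<le> M" using phi_bounded by blast
  obtain x0 where "x0 \<in> frontier \<Omega>" using frontier_nonempty by blast
  then have "0 \<le> M" using M[of x0] by linarith
  moreover have "ereal (- M) \<le> u x \<and> u x \<le> ereal M" if x: "x \<in> closure \<Omega>" for x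
  proof
    have "- M \<le> \<phi> z" if "z \<in> frontier \<Omega>" for z using M[OF that] by linarith
    then have "subsolution (\<lambda>_. - M)" by (rule subsolution_const)
    from subsolution_le[OF this x] show "ereal (- M) \<le> u x" by simp
    show "u x \<le> ereal M"
      unfolding u[OF x] by (rule SUP_least, rule PSH_boundary_le) (use M x in \<open>auto simp: abs_le_iff\<close>)
  qed
  ultimately show ?thesis by blast
qed

text \<open>The value 0 outside the closure makes it a bounded Borel function on the whole space, as
  \<open>subsolution\<close> requires.\<close>

definition perron :: "real^'n \<Rightarrow> real" where
  "perron x = (if x \<in> closure \<Omega> then real_of_ereal (u x) else 0)"

lemma perron_eq: "x \<in> closure \<Omega> \<Longrightarrow> ereal (perron x) = u x"
  using perron_bounded by (force simp: perron_def ereal_real)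

lemma perron_abs_le: "\<exists>M. \<forall>x. \<bar>perron x\<bar> \<le> M"
proof -
  obtain M where M: "M \<ge> 0" "\<forall>x\<in>closure \<Omega>. ereal (- M) \<le> u x \<and> u x \<le> ereal M" using perron_bounded by blast
  have "\<bar>perron x\<bar> \<le> M" for x
  proof (cases "x \<in> closure \<Omega>")
    case True
    then have "ereal (- M) \<le> ereal (perron x)" "ereal (perron x) \<le> ereal M"
      using M(2) unfolding perron_eq[OF True] by blast+
    then show ?thesis by (simp add: abs_le_iff)
  qed (simp add: perron_def M(1))
  then show ?thesis by blast
qed

text \<open>The \<open>\<delta>\<close> of \<open>translate_le_subsolution\<close> is the same for
  all competitors, so the estimate passes to the supremum. Exchanging \<open>x\<close> and
  \<open>x'\<close> turns it into a modulus of continuity.\<close>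

lemma perron_uniform:
  assumes "0 < \<epsilon>"
  shows "\<exists>\<delta>>0. \<forall>x\<in>closure \<Omega>. \<forall>x'\<in>closure \<Omega>. dist x x' < \<delta> \<longrightarrow> perron x' \<le> perron x + 3 * \<epsilon>"
proof -
  obtain \<delta> where \<delta>: "0 < \<delta>" "\<forall>v\<in>PSH_boundary P \<Omega> \<phi>. \<forall>x\<in>closure \<Omega>. \<forall>x'\<in>closure \<Omega>. dist x x' < \<delta> \<longrightarrow>
      (\<exists>g. subsolution g \<and> v x' \<le> ereal (g x + 3 * \<epsilon>))"
    by (rule translate_le_subsolution[OF assms])
  have "perron x' \<le> perron x + 3 * \<epsilon>" if x: "x \<in> closure \<Omega>" "x' \<in> closure \<Omega>" "dist x x' < \<delta>" for x x'
  proof -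
    have "u x' \<le> ereal (perron x + 3 * \<epsilon>)"
      unfolding u[OF x(2)]
    proof (rule SUP_least)
      fix v assume "v \<in> PSH_boundary P \<Omega> \<phi>"
      then obtain g where g: "subsolution g" "v x' \<le> ereal (g x + 3 * \<epsilon>)" using \<delta>(2) x by blast
      have "ereal (g x) \<le> ereal (perron x)" using subsolution_le[OF g(1) x(1)] perron_eq[OF x(1)] by simp
      then have "ereal (g x + 3 * \<epsilon>) \<le> ereal (perron x + 3 * \<epsilon>)" by simp
      with g(2) show "v x' \<le> ereal (perron x + 3 * \<epsilon>)" by (rule order_trans)
    qed
    then show ?thesis unfolding perron_eq[OF x(2), symmetric] by simp
  qed
  with \<delta>(1) show ?thesis by blast
qed

lemma continuous_on_perron: "continuous_on (closure \<Omega>) perron"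
  unfolding continuous_on_iff
proof (intro ballI allI impI)
  fix x and e :: real assume x: "x \<in> closure \<Omega>" and e: "0 < e"
  obtain \<delta> where \<delta>: "0 < \<delta>" "\<forall>x\<in>closure \<Omega>. \<forall>x'\<in>closure \<Omega>. dist x x' < \<delta> \<longrightarrow> perron x' \<le> perron x + 3 * (e / 4)"
    using perron_uniform[of "e / 4"] e by auto
  have "dist (perron x') (perron x) < e" if "x' \<in> closure \<Omega>" "dist x' x < \<delta>" for x'
  proof -
    have "perron x' \<le> perron x + 3 * (e / 4)" "perron x \<le> perron x' + 3 * (e / 4)"
      using \<delta>(2) x that by (simp_all add: dist_commute)
    then show ?thesis using e by (simp add: dist_real_def)
  qed
  then show "\<exists>d>0. \<forall>x'\<in>closure \<Omega>. dist x' x < d \<longrightarrow> dist (perron x') (perron x) < e"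
    using \<delta>(1) by blast
qed

lemma perron_boundary: "x \<in> frontier \<Omega> \<Longrightarrow> perron x = \<phi> x"
proof (rule antisym)
  assume x: "x \<in> frontier \<Omega>"
  then have xc: "x \<in> closure \<Omega>" using closure_eq by blast
  have "u x \<le> ereal (\<phi> x)"
    unfolding u[OF xc] by (rule SUP_least) (use x in \<open>auto simp: PSH_boundary_def\<close>)
  then show "perron x \<le> \<phi> x" unfolding perron_eq[OF xc, symmetric] by simp
  obtain M where M: "\<And>x. x \<in> frontier \<Omega> \<Longrightarrow> \<bar>\<phi> x\<bar> \<le> M" using phi_bounded by blast
  show "\<phi> x \<le> perron x"
  proof (rule field_le_epsilon)
    fix e :: real assume "0 < e"
    then have "0 < e / 3" by simp
    then obtain w where w: "subsolution w" "\<forall>x\<in>frontier \<Omega>. \<phi> x \<le> w x + 3 * (e / 3)"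
      using barrier[of "e / 3" M] M by metis
    have "ereal (w x) \<le> ereal (perron x)" using subsolution_le[OF w(1) xc] perron_eq[OF xc] by simp
    then show "\<phi> x \<le> perron x + e" using w(2) x by force
  qed
qed

text \<open>Continuity of the supremum supplies measurability and semi-continuity, and
  \<open>locally_submean_SUP\<close> the mean inequality. As a competitor itself, the Perron
  function can be modified by gluing without exceeding itself.\<close>

lemma subsolution_perron: "subsolution perron"
  unfolding subsolution_def
proof (intro conjI ballI allI impI perron_abs_le)
  have "perron = (\<lambda>x. indicator (closure \<Omega>) x *\<^sub>R perron x)"
    by (auto simp: perron_def indicator_def)
  then show m: "perron \<in> borel_measurable borel"
    using borel_measurable_continuous_on_indicator[OF _ continuous_on_perron] by simp
  show "usc_on (closure \<Omega>) (\<lambda>x. ereal (perron x))"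
    by (rule usc_on_continuous[OF continuous_on_perron])
  show "perron x \<le> \<phi> x" if "x \<in> frontier \<Omega>" for x using perron_boundary[OF that] by simp
  fix A Q assume A: "A \<in> polar_cone P" and k: "elliptic_kernel A Q"
  obtain M where M: "\<And>x. \<bar>perron x\<bar> \<le> M" using perron_abs_le by blast
  show "locally_submean \<Omega> Q perron"
  proof (rule elliptic_kernel.locally_submean_SUP[OF k A \<Omega>(1) _ m M])
    show "PSH_boundary P \<Omega> \<phi> \<subseteq> PSH P \<Omega>" by (auto simp: PSH_boundary_def)
    fix x assume "x \<in> \<Omega>"
    then have "x \<in> closure \<Omega>" using closure_subset by blast
    then show "ereal (perron x) = (SUP v\<in>PSH_boundary P \<Omega> \<phi>. v x)" using perron_eq u by simp
  qed
qed

lemma perron_PSH: "u \<in> PSH P \<Omega>"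
proof -
  obtain M where M: "\<And>x. \<bar>perron x\<bar> \<le> M" using perron_abs_le by blast
  have eq: "u x = ereal (perron x)" if "x \<in> \<Omega>" for x
    using perron_eq[OF subsetD[OF closure_subset that]] by simp
  have "usc_on \<Omega> (\<lambda>x. ereal (perron x))"
    by (rule usc_on_continuous[OF continuous_on_subset[OF continuous_on_perron closure_subset]])
  then have usc: "usc_on \<Omega> u" by (rule usc_on_cong[rotated]) (simp add: eq)
  show ?thesis
  proof (rule PSH_I[OF P \<Omega>(1) _ M usc eq])
    show "perron \<in> borel_measurable borel"
      using subsolution_perron by (simp add: subsolution_def)
    show "locally_submean \<Omega> Q perron" if "A \<in> polar_cone P" "elliptic_kernel A Q" for A Q
      using subsolution_perron that unfolding subsolution_def by blast
  qed
qed

text \<open>A quadratic function that violates the comparison on \<open>K\<close> could be glued into the Perron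
  function and would enlarge it.\<close>

lemma quadratic_le_perron:
  assumes B: "B \<in> P" and K: "compact K" "K \<subseteq> \<Omega>" and x: "x \<in> K"
    and le: "\<And>y. y \<in> frontier K \<Longrightarrow> (B *v y) \<bullet> y + b \<bullet> y + c \<le> perron y"
  shows "(B *v x) \<bullet> x + b \<bullet> x + c \<le> perron x"
proof (rule ccontr)
  assume neg: "\<not> ?thesis"
  define p where "p y = (B *v y) \<bullet> y + b \<bullet> y + c" for y
  \<comment> \<open>Half of the violation: lowered by \<open>\<mu>\<close>, the quadratic function
    still exceeds the Perron function at \<open>x\<close>, but lies below it within
    \<open>\<eta>\<close> of the boundary of \<open>K\<close>.\<close>
  define \<mu> where "\<mu> = (p x - perron x) / 2"
  have \<mu>: "0 < \<mu>" using neg by (simp add: \<mu>_def p_def)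
  have cp: "continuous_on S p" for S
    unfolding p_def by (intro continuous_intros)
  have Kc: "K \<subseteq> closure \<Omega>" using K(2) closure_subset by blast
  have "uniformly_continuous_on K (\<lambda>y. p y - perron y)"
    by (intro compact_uniformly_continuous continuous_on_diff cp continuous_on_subset[OF continuous_on_perron Kc] K(1))
  then obtain \<eta> where \<eta>: "0 < \<eta>" "\<And>y y'. y \<in> K \<Longrightarrow> y' \<in> K \<Longrightarrow> dist y' y < \<eta> \<Longrightarrow>
      dist (p y' - perron y') (p y - perron y) < \<mu>"
    using \<mu> unfolding uniformly_continuous_on_def by meson
  define D where "D = interior K"
  define f where "f y = indicator (closure \<Omega>) y *\<^sub>R (p y - \<mu>)" for y
  have DK: "D \<subseteq> K" "D \<subseteq> \<Omega>" using interior_subset K(2) unfolding D_def by blast+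
  have f: "f y = p y - \<mu>" if "y \<in> \<Omega>" for y
    using subsetD[OF closure_subset that] by (simp add: f_def)
  have cf: "continuous_on (closure \<Omega>) (\<lambda>y. p y - \<mu>)" by (intro continuous_intros cp)
  obtain C where C: "C > 0" "\<And>y. y \<in> closure \<Omega> \<Longrightarrow> \<bar>p y - \<mu>\<bar> \<le> C"
    using compact_imp_bounded[OF compact_continuous_image[OF cf compact_closure]] by (auto simp: bounded_pos)
  have "subsolution (\<lambda>y. if y \<in> D then max (perron y) (f y) else perron y)"
  proof (rule subsolution_glue[OF subsolution_perron _ \<eta>(1), of D f C])
    show "open D" by (simp add: D_def)
    show "f \<in> borel_measurable borel"
      unfolding f_def by (rule borel_measurable_continuous_on_indicator[OF _ cf]) simp
    show "\<bar>f y\<bar> \<le> C" for y using C by (cases "y \<in> closure \<Omega>") (simp_all add: f_def)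
    have "usc_on (closure \<Omega> \<inter> D) (\<lambda>y. ereal (p y - \<mu>))"
      by (rule usc_on_continuous[OF continuous_on_subset[OF cf]]) blast
    then show "usc_on (closure \<Omega> \<inter> D) (\<lambda>y. ereal (f y))"
      by (rule usc_on_cong[rotated]) (use DK f in auto)
    show "locally_submean (\<Omega> \<inter> D) Q f" if A: "A \<in> polar_cone P" "elliptic_kernel A Q" for A Q
    proof -
      \<comment> \<open>Polarity of the two cones gives the quadratic function the mean inequality
        for every kernel.\<close>
      have "0 \<le> sym_inner A B" using A(1) B unfolding polar_cone_def by blast
      then have "0 \<le> sym_inner B A" by (simp only: sym_inner_commute[of B A])
      then have "locally_submean (\<Omega> \<inter> D) Q (\<lambda>y. (B *v y) \<bullet> y + b \<bullet> y + (c - \<mu>))"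
        by (rule elliptic_kernel.locally_submean_quadratic[OF A(2)])
      then show ?thesis
        by (rule elliptic_kernel.locally_submean_cong[OF A(2), rotated 2])
          (use \<Omega>(1) f in \<open>auto simp: D_def p_def\<close>)
    qed
    show "f y \<le> \<phi> y" if "y \<in> frontier \<Omega>" "y \<in> D" for y using that DK frontier_disjoint by blast
    show "f y \<le> perron y" if y: "y \<in> D" "\<not> ball y \<eta> \<subseteq> D" for y
    proof -
      obtain z where z: "z \<in> ball y \<eta>" "z \<notin> D" using y(2) by blast
      \<comment> \<open>The segment from \<open>y\<close> leaves \<open>D\<close> at a point
        \<open>k\<close> of \<open>frontier K\<close>, where the quadratic function is at most the
        Perron function; on the way from \<open>k\<close> to \<open>y\<close> the difference grows
        by less than \<open>\<mu>\<close>.\<close>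
      obtain k where k: "k \<in> frontier D" "dist y k \<le> dist y z" using infdist_frontier_le[OF y(1) z(2)] by blast
      have kK: "k \<in> frontier K" using k(1) frontier_interior_subset unfolding D_def by blast
      then have "k \<in> K" using K(1) by (simp add: frontier_def compact_imp_closed)
      then have "dist (p y - perron y) (p k - perron k) < \<mu>"
        using \<eta>(2)[of k y] y(1) DK k(2) z(1) by auto
      moreover have "p k \<le> perron k" using le[OF kK] by (simp add: p_def)
      ultimately have "p y - perron y < \<mu>" by (simp add: dist_real_def abs_less_iff)
      then show ?thesis using f[of y] y(1) DK by auto
    qed
  qed
  from subsolution_le[OF this, of x] x Kc
  have "(if x \<in> D then max (perron x) (f x) else perron x) \<le> perron x"
    using perron_eq[of x] by (metis ereal_less_eq(3) subsetD)
  moreover have "x \<notin> frontier K" using le[of x] neg by blast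
  then have "x \<in> D" using x K(1) by (simp add: frontier_def D_def compact_imp_closed)
  ultimately have "f x \<le> perron x" by simp
  moreover have "f x = p x - \<mu>" using f x K(2) by blast
  moreover have "2 * \<mu> = p x - perron x" by (simp add: \<mu>_def)
  ultimately show False using \<mu> by linarith
qed

text \<open>Bounding \<open>B - u\<close> by an affine function amounts to bounding the quadratic
  function \<open>B\<close> minus that affine function by \<open>u\<close>. This comparison is
  available for every compact subset of \<open>\<Omega>\<close>, so \<open>\<Omega>\<close> itself
  serves as the neighbourhood required in \<open>SA\<close>.\<close>

lemma uminus_perron_PSH_tilde: "(\<lambda>x. - u x) \<in> PSH_tilde P \<Omega>"
proof -
  have eq: "u x = ereal (perron x)" if "x \<in> \<Omega>" for x
    using perron_eq[OF subsetD[OF closure_subset that]] by simp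
  have cont: "continuous_on \<Omega> perron" by (rule continuous_on_subset[OF continuous_on_perron closure_subset])
  have "(\<lambda>x. - u x) \<in> USC \<Omega>"
    unfolding USC_def
  proof (intro CollectI conjI ballI)
    have "usc_on \<Omega> (\<lambda>x. ereal (- perron x))" by (intro usc_on_continuous continuous_intros cont)
    then show "usc_on \<Omega> (\<lambda>x. - u x)" by (rule usc_on_cong[rotated]) (simp add: eq)
    fix C assume "C \<in> components \<Omega>"
    then obtain x where "x \<in> C" "x \<in> \<Omega>" using in_components_nonempty in_components_subset by blast
    then show "\<exists>x\<in>C. - u x \<noteq> - \<infinity>" using eq by force
  qed
  moreover have "(\<lambda>x. ereal ((B *v x) \<bullet> x) + - u x) \<in> SA \<Omega>" if B: "B \<in> P" for B
  proof -
    have "usc_on \<Omega> (\<lambda>x. ereal ((B *v x) \<bullet> x - perron x))"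
      by (intro usc_on_continuous continuous_intros cont)
    then have usc: "usc_on \<Omega> (\<lambda>x. ereal ((B *v x) \<bullet> x) + - u x)"
      by (rule usc_on_cong[rotated]) (simp add: eq)
    moreover have "ereal ((B *v x) \<bullet> x) + - u x \<le> ereal (b \<bullet> x + c)"
      if K: "compact K" "K \<subseteq> \<Omega>" and fr: "\<forall>x\<in>frontier K. ereal ((B *v x) \<bullet> x) + - u x \<le> ereal (b \<bullet> x + c)"
        and x: "x \<in> K" for K b c x
    proof -
      have "(B *v x) \<bullet> x + (- b) \<bullet> x + (- c) \<le> perron x"
      proof (rule quadratic_le_perron[OF B K x])
        fix y assume y: "y \<in> frontier K"
        then have "y \<in> \<Omega>" using K by (auto simp: frontier_def compact_imp_closed)
        then show "(B *v y) \<bullet> y + (- b) \<bullet> y + (- c) \<le> perron y" using fr y eq by force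
      qed
      moreover have "x \<in> \<Omega>" using x K(2) by blast
      ultimately show ?thesis using eq by simp
    qed
    ultimately have "subaffine_on \<Omega> (\<lambda>x. ereal ((B *v x) \<bullet> x) + - u x)"
      unfolding subaffine_on_def by blast
    then show ?thesis using usc \<Omega>(1) unfolding SA_def by blast
  qed
  ultimately show ?thesis by (simp add: PSH_tilde_def)
qed

end

end

theorem theorem8p1:
  fixes P :: "(real^'n::finite^'n) set"
    and \<Omega> :: "(real^'n) set"
    and \<phi> :: "real^'n \<Rightarrow> real"
    and u :: "real^'n \<Rightarrow> ereal"
  assumes "elliptic_cone P"
    and "open \<Omega>" and "connected \<Omega>" and "\<Omega> \<noteq> {}" and "bounded \<Omega>"
    and "smooth_strictly_convex_boundary P \<Omega>"
    and "continuous_on (frontier \<Omega>) \<phi>"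
    and "\<And>x. x \<in> closure \<Omega> \<Longrightarrow> u x = (SUP v \<in> PSH_boundary P \<Omega> \<phi>. v x)"
  shows "((\<forall>x \<in> closure \<Omega>. \<bar>u x\<bar> \<noteq> \<infinity>) \<and> continuous_on (closure \<Omega>) u)
    \<and> partially_pluriharmonic P \<Omega> u
    \<and> (\<forall>x \<in> frontier \<Omega>. u x = ereal (\<phi> x))"
proof -
  interpret dirichlet_setting P \<Omega> \<phi>
    by (rule dirichlet_setting.intro) (rule assms)+
  note u = assms(8)
  have eq: "u x = ereal (perron u x)" if "x \<in> closure \<Omega>" for x
    using perron_eq[OF u that] by simp
  have "continuous_on (closure \<Omega>) (\<lambda>x. ereal (perron u x))"
    by (intro continuous_on_ereal continuous_on_perron[OF u])
  then have "continuous_on (closure \<Omega>) u"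
    by (rule continuous_on_eq) (rule eq[symmetric])
  moreover have "partially_pluriharmonic P \<Omega> u"
    unfolding partially_pluriharmonic_def using perron_PSH[OF u] uminus_perron_PSH_tilde[OF u] by blast
  moreover have "u x = ereal (\<phi> x)" if "x \<in> frontier \<Omega>" for x
  proof -
    have "x \<in> closure \<Omega>" using that closure_eq by blast
    then show ?thesis using perron_boundary[OF u that] by (simp add: eq)
  qed
  moreover have "\<bar>u x\<bar> \<noteq> \<infinity>" if "x \<in> closure \<Omega>" for x
    by (simp add: eq[OF that])
  ultimately show ?thesis by (intro conjI ballI)
qed

end
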